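(* Let $K$ be a field (with the standing assumption on $\mathrm{char}(K)$ given in the context) and let $I\subset S=K[x_1,\dots,x_n]$ be a squarefree monomial ideal with $2$-linear resolution. Then $\partial^\ell(I^k)$ has linear quotients, for all $k\ge1$ and all $0\le\ell\le 2k$. In particular, $$\mathrm{reg}\,\partial^\ell(I^k)=2k-\ell$$ for all $k\ge1$ and all $0\le\ell\le2k$.
   Context: $S=K[x_1,\dots,x_n]$ is the standard graded polynomial ring over the field $K$. For a homogeneous ideal $I\subset S$, the gradient ideal $\partial(I)$ is the ideal generated by all partial derivatives $\partial f/\partial x_i$ ($1\le i\le n$) of the elements $f$ of a minimal generating set of $I$; $\partial^0(I)=I$, $\partial^1(I)=\partial(I)$ and $\partial^\ell(I)=\partial(\partial^{\ell-1}(I))$ for $\ell>1$. For a monomial ideal $I$, $\mathcal{G}(I)$ denotes its minimal monomial generating set, and $\mathrm{supp}(u)=\{i: x_i \text{ divides } u\}$ for a monomial $u$. Standing assumption: $\mathrm{char}(K)=0$, or $\mathrm{char}(K)$ is large enough that for every monomial ideal $I$ under consideration $$\partial(I)=(u/x_i:\ u\in\mathcal{G}(I),\ i\in\mathrm{supp}(u)).$$ For a homogeneous ideal $I$, $\mathrm{reg}\,I=\max\{j-i:\ \dim_K\mathrm{Tor}^S_i(K,I)_j\neq 0\}$ is the Castelnuovo–Mumford regularity. A nonzero homogeneous ideal $I$ has a $d$-linear resolution if all its minimal homogeneous generators have degree $d$ and $\mathrm{reg}\,I=d$. A monomial ideal $I$ has linear quotients if there is an order $u_1,\dots,u_m$ of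 $\mathcal{G}(I)$ such that $(u_1,\dots,u_{i-1}):(u_i)$ is generated by variables for all $i=2,\dots,m$. *)

theory Defs
  imports Complex_Main "HOL-Library.Poly_Mapping"
begin

text \<open>
  The polynomial ring over \<open>'k\<close> whose variables are indexed by the finite type \<open>'n\<close>.
  A monomial is represented by its exponent vector \<open>u :: 'n \<Rightarrow>\<^sub>0 nat\<close>.
\<close>

type_synonym ('n, 'k) mpoly = "('n \<Rightarrow>\<^sub>0 nat) \<Rightarrow>\<^sub>0 'k"

definition monom :: "('n \<Rightarrow>\<^sub>0 nat) \<Rightarrow> ('n, 'k::comm_ring_1) mpoly"
  where "monom u = Poly_Mapping.single u 1"

definition var_exp :: "'n \<Rightarrow> ('n \<Rightarrow>\<^sub>0 nat)"
  where "var_exp i = Poly_Mapping.single i 1"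

definition mdeg :: "('n::finite \<Rightarrow>\<^sub>0 nat) \<Rightarrow> nat"
  where "mdeg u = (\<Sum>i\<in>UNIV. Poly_Mapping.lookup u i)"

definition homogeneous :: "nat \<Rightarrow> ('n::finite, 'k::zero) mpoly \<Rightarrow> bool"
  where "homogeneous d f \<longleftrightarrow> (\<forall>u\<in>Poly_Mapping.keys f. mdeg u = d)"

definition partial_deriv :: "'n \<Rightarrow> ('n, 'k::comm_ring_1) mpoly \<Rightarrow> ('n, 'k) mpoly"
  where "partial_deriv i f =
    (\<Sum>u\<in>Poly_Mapping.keys f. Poly_Mapping.single (u - var_exp i)
      (of_nat (Poly_Mapping.lookup u i) * Poly_Mapping.lookup f u))"


section \<open>Ideals\<close>

definition ideal_gen :: "'r::comm_ring_1 set \<Rightarrow> 'r set"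
  where "ideal_gen = module.span (*)"

definition ideal_mult :: "'r::comm_ring_1 set \<Rightarrow> 'r set \<Rightarrow> 'r set"
  where "ideal_mult I J = ideal_gen {a * b | a b. a \<in> I \<and> b \<in> J}"

primrec ideal_power :: "'r::comm_ring_1 set \<Rightarrow> nat \<Rightarrow> 'r set"
  where
    "ideal_power I 0 = UNIV"
  | "ideal_power I (Suc k) = ideal_mult I (ideal_power I k)"

definition ideal_colon :: "'r::comm_ring_1 set \<Rightarrow> 'r set \<Rightarrow> 'r set"
  where "ideal_colon I J = {f. \<forall>g\<in>J. f * g \<in> I}"

definition min_gens :: "'r::comm_ring_1 set \<Rightarrow> 'r set \<Rightarrow> bool"
  where "min_gens G I \<longleftrightarrow> ideal_gen G = I \<and> (\<forall>H. H \<subset> G \<longrightarrow> ideal_gen H \<noteq> I)"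

definition homogeneous_ideal :: "('n::finite, 'k::comm_ring_1) mpoly set \<Rightarrow> bool"
  where "homogeneous_ideal I \<longleftrightarrow> (\<exists>G. (\<forall>f\<in>G. \<exists>d. homogeneous d f) \<and> ideal_gen G = I)"

definition min_hom_gens :: "('n::finite, 'k::comm_ring_1) mpoly set \<Rightarrow> ('n, 'k) mpoly set \<Rightarrow> bool"
  where "min_hom_gens G I \<longleftrightarrow> (\<forall>f\<in>G. \<exists>d. homogeneous d f) \<and> min_gens G I"

text \<open>
  The minimal generating set is required to consist of homogeneous elements; without this the
  ideal would depend on the choice even in characteristic 0.
\<close>

definition gradient :: "('n::finite, 'k::comm_ring_1) mpoly set \<Rightarrow> ('n, 'k) mpoly set"
  where "gradient I = ideal_gen {partial_deriv i f | i f. f \<in> (SOME G. min_hom_gens G I)}"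


section \<open>Monomial ideals\<close>

definition monomial_ideal :: "('n, 'k::comm_ring_1) mpoly set \<Rightarrow> bool"
  where "monomial_ideal I \<longleftrightarrow> (\<exists>U. I = ideal_gen (monom ` U))"

definition squarefree_monomial_ideal :: "('n, 'k::comm_ring_1) mpoly set \<Rightarrow> bool"
  where "squarefree_monomial_ideal I \<longleftrightarrow>
    (\<exists>U. (\<forall>u\<in>U. \<forall>i. Poly_Mapping.lookup u i \<le> 1) \<and> I = ideal_gen (monom ` U))"

definition monomial_gens :: "('n, 'k::comm_ring_1) mpoly set \<Rightarrow> ('n \<Rightarrow>\<^sub>0 nat) set"
  where "monomial_gens I = (THE U. min_gens (monom ` U) I)"

definition linear_quotients :: "('n, 'k::comm_ring_1) mpoly set \<Rightarrow> bool"
  where "linear_quotients I \<longleftrightarrow> monomial_ideal I \<and>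
    (\<exists>us. distinct us \<and> set us = monomial_gens I \<and>
      (\<forall>i\<in>{1..<length us}. \<exists>V.
        ideal_colon (ideal_gen (monom ` set (take i us))) (ideal_gen {monom (us ! i)}) =
        ideal_gen ((\<lambda>v. monom (var_exp v) :: ('n, 'k) mpoly) ` V)))"


section \<open>Tor and regularity\<close>

text \<open>
  A graded free resolution of the residue field \<open>'k\<close> by free modules of finite rank:
  \<open>P\<^sub>p\<close> has a basis indexed by \<open>{..<r p}\<close> whose \<open>a\<close>-th element has degree \<open>d p a\<close>, the
  differential \<open>P\<^sub>p\<^sub>+\<^sub>1 \<rightarrow> P\<^sub>p\<close> has matrix \<open>M p\<close>, and the augmentation sends the \<open>a\<close>-th basis
  element of \<open>P\<^sub>0\<close> to \<open>e a\<close>. A polynomial acts on \<open>'k\<close> through its constant term.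
\<close>

definition free_mod :: "nat \<Rightarrow> (nat \<Rightarrow> 'r::zero) set"
  where "free_mod r = {f. \<forall>a\<ge>r. f a = 0}"

definition differential ::
    "(nat \<Rightarrow> nat) \<Rightarrow> (nat \<Rightarrow> nat \<Rightarrow> nat \<Rightarrow> 'r::comm_ring_1) \<Rightarrow> nat \<Rightarrow> (nat \<Rightarrow> 'r) \<Rightarrow> nat \<Rightarrow> 'r"
  where "differential r M p f = (\<lambda>a. if a < r p then \<Sum>b<r (Suc p). M p a b * f b else 0)"

definition augmentation ::
    "(nat \<Rightarrow> nat) \<Rightarrow> (nat \<Rightarrow> 'k::comm_ring_1) \<Rightarrow> (nat \<Rightarrow> ('n, 'k) mpoly) \<Rightarrow> 'k"
  where "augmentation r e f = (\<Sum>a<r 0. Poly_Mapping.lookup (f a) 0 * e a)"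

definition graded_resolution ::
    "(nat \<Rightarrow> nat) \<Rightarrow> (nat \<Rightarrow> nat \<Rightarrow> nat) \<Rightarrow> (nat \<Rightarrow> nat \<Rightarrow> nat \<Rightarrow> ('n::finite, 'k::comm_ring_1) mpoly)
      \<Rightarrow> (nat \<Rightarrow> 'k) \<Rightarrow> bool"
  where "graded_resolution r d M e \<longleftrightarrow>
    (\<forall>p. \<forall>a<r p. \<forall>b<r (Suc p). \<forall>u\<in>Poly_Mapping.keys (M p a b). mdeg u + d p a = d (Suc p) b) \<and>
    (\<forall>a<r 0. e a \<noteq> 0 \<longrightarrow> d 0 a = 0) \<and>
    (\<forall>c. \<exists>f :: nat \<Rightarrow> ('n, 'k) mpoly. f \<in> free_mod (r 0) \<and> augmentation r e f = c) \<and>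
    (\<forall>f\<in>free_mod (r 0). augmentation r e f = 0 \<longleftrightarrow>
      (\<exists>g\<in>free_mod (r 1). differential r M 0 g = f)) \<and>
    (\<forall>p. \<forall>f\<in>free_mod (r (Suc p)). differential r M p f = (\<lambda>_. 0) \<longleftrightarrow>
      (\<exists>g\<in>free_mod (r (Suc (Suc p))). differential r M (Suc p) g = f))"

text \<open>
  The degree \<open>j\<close> part of \<open>P\<^sub>p \<otimes> I\<close>, where \<open>P\<^sub>p \<otimes> I\<close> is identified with the \<open>r p\<close>-fold direct sum
  of copies of \<open>I\<close> with shifted gradings.
\<close>

definition tensor_part ::
    "(nat \<Rightarrow> nat) \<Rightarrow> (nat \<Rightarrow> nat \<Rightarrow> nat) \<Rightarrow> ('n::finite, 'k::comm_ring_1) mpoly set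
      \<Rightarrow> nat \<Rightarrow> nat \<Rightarrow> (nat \<Rightarrow> ('n, 'k) mpoly) set"
  where "tensor_part r d I p j =
    {f\<in>free_mod (r p). \<forall>a<r p. f a \<in> I \<and> (\<forall>u\<in>Poly_Mapping.keys (f a). mdeg u + d p a = j)}"

definition tor_cycles ::
    "(nat \<Rightarrow> nat) \<Rightarrow> (nat \<Rightarrow> nat \<Rightarrow> nat) \<Rightarrow> (nat \<Rightarrow> nat \<Rightarrow> nat \<Rightarrow> ('n::finite, 'k::comm_ring_1) mpoly)
      \<Rightarrow> ('n, 'k) mpoly set \<Rightarrow> nat \<Rightarrow> nat \<Rightarrow> (nat \<Rightarrow> ('n, 'k) mpoly) set"
  where "tor_cycles r d M I i j =
    {f\<in>tensor_part r d I i j. \<forall>p. i = Suc p \<longrightarrow> differential r M p f = (\<lambda>_. 0)}"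

definition tor_boundaries ::
    "(nat \<Rightarrow> nat) \<Rightarrow> (nat \<Rightarrow> nat \<Rightarrow> nat) \<Rightarrow> (nat \<Rightarrow> nat \<Rightarrow> nat \<Rightarrow> ('n::finite, 'k::comm_ring_1) mpoly)
      \<Rightarrow> ('n, 'k) mpoly set \<Rightarrow> nat \<Rightarrow> nat \<Rightarrow> (nat \<Rightarrow> ('n, 'k) mpoly) set"
  where "tor_boundaries r d M I i j = differential r M i ` tensor_part r d I (Suc i) j"

text \<open>
  \<open>Tor\<^sub>i(K, I)\<^sub>j \<noteq> 0\<close>, with Tor as the left derived functor of \<open>_ \<otimes> I\<close> at the residue field. Since
  Tor does not depend on the resolution, the existential quantifier over resolutions is harmless.
\<close>

definition tor_nonzero :: "('n::finite, 'k::comm_ring_1) mpoly set \<Rightarrow> nat \<Rightarrow> nat \<Rightarrow> bool"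
  where "tor_nonzero I i j \<longleftrightarrow>
    (\<exists>r d M e. graded_resolution r d M e \<and> tor_cycles r d M I i j \<noteq> tor_boundaries r d M I i j)"

text \<open>
  \<open>reg I = t\<close>: the maximum of \<open>j - i\<close> over all nonvanishing \<open>Tor\<^sub>i(K, I)\<^sub>j\<close> exists and equals \<open>t\<close>.
  A relation is used because \<open>Max\<close> is unspecified on sets without a maximum.
\<close>

definition has_regularity :: "('n::finite, 'k::comm_ring_1) mpoly set \<Rightarrow> int \<Rightarrow> bool"
  where "has_regularity I t \<longleftrightarrow>
    (\<exists>i j. tor_nonzero I i j \<and> int j - int i = t) \<and>
    (\<forall>i j. tor_nonzero I i j \<longrightarrow> int j - int i \<le> t)"

definition linear_resolution :: "nat \<Rightarrow> ('n::finite, 'k::comm_ring_1) mpoly set \<Rightarrow> bool"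
  where "linear_resolution d I \<longleftrightarrow> homogeneous_ideal I \<and> I \<noteq> {0} \<and>
    (\<forall>G. min_hom_gens G I \<longrightarrow> (\<forall>f\<in>G. homogeneous d f)) \<and> has_regularity I (int d)"

end

theory Submission
  imports Defs "HOL-Library.Multiset_Order" "HOL-Library.Product_Lexorder"
    "HOL-Library.Function_Algebras"
begin

text \<open>
  A squarefree monomial ideal with 2-linear resolution is the edge ideal $I$ of a graph $E$ on the
  variables. Let $m$ be the ideal generated by the variables that lie on an edge. Removing a variable
  from a product of $a$ such variables and $s$ edges removes one of the variables or one end of an
  edge, and an edge is itself a product of two variables. Hence $\partial(m^a I^s) = m^{a+1} I^{s-1}$
  for $s \geq 1$ and $\partial(m^a) = m^{a-1}$, so that every $\partial^l(I^k)$ is some $m^a I^s$ with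
  $a + 2s = 2k - l$; see \<open>gradient_monomial_ideal\<close> and \<open>gradient_gens\<close>. The generators of
  $m^a I^s$ all have the same degree, and it remains to show two things.

  The ideal $m^a I^s$ has linear quotients. This rests on an elimination order of the vertices:
  whenever $jk$ is an edge and $i$ precedes $j$ and $k$, then $i$ is adjacent to $j$ or to $k$; in
  other words, the complement of $E$ is chordal. Adding a cone point that precedes all vertices keeps
  this property and turns $m^a I^s$ into products of $a + s$ edges in which the cone point occurs $a$
  times. Such products are ordered by their least factorization, where edges are compared
  lexicographically and multisets of edges by the multiset order. If $u$ comes before $w$, alternating
  walks in the union of the two factorizations produce a generator $w x_v / x_y$ that comes before $w$,
  with $x_v$ more frequent in $u$ and $x_y$ more frequent in $w$; see \<open>exchange_below_max\<close> and
  \<open>linear_exchange\<close>.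

  The elimination order comes from the hypothesis on the resolution. By Dirac's argument it exists
  unless the complement of $E$ contains two nonadjacent vertices $c$, $c'$ that are joined both by a
  path through a connected set $A$ and by a path through a single vertex $b$ without neighbours in $A$
  (\<open>exists_simplicial_vertex\<close>). Such a configuration is a nontrivial one-dimensional cycle, and
  \<open>no_missing_diagonal\<close> turns it into a nonzero element of $\mathrm{Tor}_i(K,I)_{i+3}$ with $i = |A|$.

  All statements on Tor are proved for one arbitrary graded resolution $P$ of $K$ by diagram chases
  with elements. The basic notion is the vanishing of the homology of $P \otimes A/B$ in one bidegree,
  for monomial ideals $B \subseteq A$. Short exact sequences of such quotients give the
  regularity of an ideal with linear quotients (\<open>vanishing_linear_quotients\<close>) and, together with the
  fact that multiplication by a variable is null-homotopic on $P$, the nonvanishing needed above.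
\<close>

section \<open>Monomial ideals as up-closed sets of exponent vectors\<close>

type_synonym 'n expo = "'n \<Rightarrow>\<^sub>0 nat"

abbreviation (input) lookup where "lookup \<equiv> Poly_Mapping.lookup"
abbreviation (input) keys where "keys \<equiv> Poly_Mapping.keys"
abbreviation (input) single where "single \<equiv> Poly_Mapping.single"

definition upset :: "'n expo set \<Rightarrow> 'n expo set"
  where "upset U = {u + w | u w. u \<in> U}"

definition up_closed :: "'n expo set \<Rightarrow> bool"
  where "up_closed A \<longleftrightarrow> (\<forall>u\<in>A. \<forall>w. u + w \<in> A)"

text \<open>
  Every monomial ideal is \<open>supported A\<close> for an up-closed set \<open>A\<close>. In this form sums, intersections and
  colons by a monomial are unions, intersections and translates of sets of exponents.
\<close>

definition supported :: "'n expo set \<Rightarrow> ('n, 'k::zero) mpoly set"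
  where "supported A = {f. keys f \<subseteq> A}"

text \<open>
  The projection onto the span of the monomials in \<open>A\<close>. It splits an element of a sum of monomial
  ideals into summands from the two ideals, and it extracts homogeneous components.
\<close>

definition keep :: "'n expo set \<Rightarrow> ('n, 'k::comm_monoid_add) mpoly \<Rightarrow> ('n, 'k) mpoly"
  where "keep A f = (\<Sum>u\<in>keys f \<inter> A. single u (lookup f u))"

lemma up_closedD: "up_closed A \<Longrightarrow> u \<in> A \<Longrightarrow> u + w \<in> A"
  by (simp add: up_closed_def)

lemma up_closedD': "up_closed A \<Longrightarrow> u \<in> A \<Longrightarrow> w + u \<in> A"
  by (metis add.commute up_closedD)

lemma upsetI: "u \<in> U \<Longrightarrow> u + w \<in> upset U"
  by (auto simp: upset_def)

lemma upset_base: "u \<in> U \<Longrightarrow> u \<in> upset U"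
  using upsetI[of u U 0] by simp

lemma upsetE:
  assumes "w \<in> upset U"
  obtains u t where "u \<in> U" "w = u + t"
  using assms by (auto simp: upset_def)

lemma up_closed_upset [simp]: "up_closed (upset U)"
  unfolding up_closed_def upset_def by (auto simp: add.assoc) blast

lemma up_closed_empty [simp]: "up_closed {}"
  by (simp add: up_closed_def)

lemma up_closed_Un: "up_closed A \<Longrightarrow> up_closed B \<Longrightarrow> up_closed (A \<union> B)"
  and up_closed_Int: "up_closed A \<Longrightarrow> up_closed B \<Longrightarrow> up_closed (A \<inter> B)"
  by (auto simp: up_closed_def)

lemma upset_Un: "upset (U \<union> V) = upset U \<union> upset V"
  by (auto simp: upset_def)

lemma upset_empty [simp]: "upset {} = {}"
  by (auto simp: upset_def)

lemma upset_least: "up_closed A \<Longrightarrow> U \<subseteq> A \<Longrightarrow> upset U \<subseteq> A"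
  by (auto simp: upset_def up_closed_def)

lemma upset_mono: "U \<subseteq> V \<Longrightarrow> upset U \<subseteq> upset V"
  by (auto simp: upset_def)

lemma mdeg_add: "mdeg (u + w) = mdeg u + mdeg w"
  by (simp add: mdeg_def lookup_add sum.distrib)

lemma mdeg_zero_iff [simp]: "mdeg u = 0 \<longleftrightarrow> u = 0"
  by (auto simp: mdeg_def poly_mapping_eq_iff fun_eq_iff)

lemma mdeg_zero [simp]: "mdeg 0 = 0"
  by simp

lemma mdeg_var_exp [simp]: "mdeg (var_exp i) = 1"
  by (simp add: mdeg_def var_exp_def lookup_single when_def)

lemma lookup_var_exp: "lookup (var_exp i) j = (if i = j then 1 else 0)"
  by (simp add: var_exp_def lookup_single when_def)

lemma add_eq_self_degree: 
  fixes u :: "'n::finite expo"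
  assumes "u = v + t" "mdeg u = mdeg v" shows "u = v"
  using assms by (simp add: mdeg_add)

lemma exponent_split_var:
  fixes u :: "'n expo"
  assumes "lookup u i > 0" shows "u = (u - var_exp i) + var_exp i"
  using assms by (auto simp: poly_mapping_eq_iff fun_eq_iff lookup_add lookup_minus lookup_var_exp)

lemma lookup_keep: "lookup (keep A f) u = (if u \<in> A then lookup f u else 0)"
proof -
  have "lookup (keep A f) u =
    (\<Sum>v\<in>keys f \<inter> A. if v = u then lookup f u else 0)"
    unfolding keep_def lookup_sum by (intro sum.cong) (auto simp: lookup_single when_def)
  also have "\<dots> = (if u \<in> A then lookup f u else 0)"
    by (auto simp: sum.delta in_keys_iff)
  finally show ?thesis .
qed

lemma keys_keep: "keys (keep A f) = keys f \<inter> A"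
  by (auto simp: in_keys_iff lookup_keep split: if_splits)

lemma keep_id: "keys f \<subseteq> A \<Longrightarrow> keep A f = f"
  by (auto simp: poly_mapping_eq_iff fun_eq_iff lookup_keep in_keys_iff)

lemma keep_zero: "keys f \<inter> A = {} \<Longrightarrow> keep A f = 0"
  by (auto simp: poly_mapping_eq_iff fun_eq_iff lookup_keep in_keys_iff)

lemma keep_add: "keep A (f + g) = keep A f + keep A g"
  by (auto simp: poly_mapping_eq_iff fun_eq_iff lookup_keep lookup_add)

lemma keep_diff: "keep A (f - g) = keep A f - keep A (g :: ('n, 'k::ab_group_add) mpoly)"
  by (auto simp: poly_mapping_eq_iff fun_eq_iff lookup_keep lookup_minus)

lemma keep_0 [simp]: "keep A 0 = 0"
  by (simp add: keep_def)

lemma keep_sum: "keep A (\<Sum>x\<in>X. f x) = (\<Sum>x\<in>X. keep A (f x))"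
  by (induction X rule: infinite_finite_induct) (auto simp: keep_add)

lemma keep_complement: "f = keep A f + keep (- A) f"
  by (auto simp: poly_mapping_eq_iff fun_eq_iff lookup_keep lookup_add)

lemma keys_mult_up_closed:
  "up_closed A \<Longrightarrow> keys g \<subseteq> A \<Longrightarrow> keys (f * g) \<subseteq> A"
  using keys_mult[of f g] up_closedD' by fastforce

lemma keys_diff_subset:
  "keys (f - g :: 'a \<Rightarrow>\<^sub>0 'b::ab_group_add) \<subseteq> keys f \<union> keys g"
  by (auto simp: in_keys_iff lookup_minus)

lemma lookup_monom_times:
  "lookup (monom w * f) (u + w) = lookup f u"
proof -
  have "lookup (monom w * f) (u + w)
      = (\<Sum>l. (if l = w then 1 else 0) * (\<Sum>q. lookup f q when u + w = l + q))"
    unfolding monom_def lookup_mult lookup_single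
    by (intro Sum_any.cong) (auto simp: when_def)
  also have "\<dots> = (\<Sum>l. (\<Sum>q. lookup f q when u + w = l + q) when l = w)"
    by (intro Sum_any.cong) (auto simp: when_def)
  also have "\<dots> = (\<Sum>q. lookup f q when u + w = w + q)"
    by simp
  also have "\<dots> = (\<Sum>q. lookup f q when q = u)"
    by (intro Sum_any.cong) (auto simp: when_def add.commute)
  finally show ?thesis by simp
qed

lemma keys_monom_times: "keys (monom w * f) = (\<lambda>u. u + w) ` keys f"
proof
  show "keys (monom w * f) \<subseteq> (\<lambda>u. u + w) ` keys f"
    using keys_mult[of "monom w" f] by (auto simp: monom_def add.commute)
  show "(\<lambda>u. u + w) ` keys f \<subseteq> keys (monom w * f)"
    by (auto simp: in_keys_iff lookup_monom_times)
qed

lemma monom_divides: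
  assumes "keys f \<subseteq> upset {w}"
  shows "\<exists>h. f = monom w * h"
proof -
  have "\<forall>u\<in>keys f. \<exists>t. u = t + w"
    using assms by (fastforce simp: upset_def add.commute)
  then obtain t where t: "\<And>u. u \<in> keys f \<Longrightarrow> u = t u + w" by metis
  have "f = (\<Sum>u\<in>keys f. single u (lookup f u))"
    using keep_id[of f UNIV] by (simp add: keep_def)
  also have "\<dots> = (\<Sum>u\<in>keys f. monom w * single (t u) (lookup f u))"
    using t by (intro sum.cong) (auto simp: monom_def mult_single add.commute)
  finally show ?thesis by (metis sum_distrib_left)
qed

lemma module_times: "module ((*) :: 'r::comm_ring_1 \<Rightarrow> 'r \<Rightarrow> 'r)"
  by unfold_locales (auto simp: algebra_simps)

lemma ideal_gen_base: "x \<in> G \<Longrightarrow> x \<in> ideal_gen G"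
  unfolding ideal_gen_def by (rule module.span_base[OF module_times])

lemma ideal_gen_add: "x \<in> ideal_gen G \<Longrightarrow> y \<in> ideal_gen G \<Longrightarrow> x + y \<in> ideal_gen G"
  unfolding ideal_gen_def by (rule module.span_add[OF module_times])

lemma ideal_gen_zero: "0 \<in> ideal_gen G"
  unfolding ideal_gen_def by (rule module.span_zero[OF module_times])

lemma ideal_gen_scale: "x \<in> ideal_gen G \<Longrightarrow> c * x \<in> ideal_gen G"
  unfolding ideal_gen_def by (rule module.span_scale[OF module_times])

lemma ideal_gen_sum: "(\<And>x. x \<in> X \<Longrightarrow> f x \<in> ideal_gen G) \<Longrightarrow> sum f X \<in> ideal_gen G"
  by (induction X rule: infinite_finite_induct) (auto intro: ideal_gen_add ideal_gen_zero)

lemma ideal_gen_least: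
  assumes "G \<subseteq> S" "0 \<in> S" "\<And>x y. x \<in> S \<Longrightarrow> y \<in> S \<Longrightarrow> x + y \<in> S" "\<And>c x. x \<in> S \<Longrightarrow> c * x \<in> S"
  shows "ideal_gen G \<subseteq> S"
  unfolding ideal_gen_def
  using assms by (intro module.span_minimal[OF module_times] module.subspaceI[OF module_times]) auto

lemma ideal_gen_explicit:
  "x \<in> ideal_gen G \<Longrightarrow> \<exists>T c. finite T \<and> T \<subseteq> G \<and> x = (\<Sum>a\<in>T. c a * a)"
  unfolding ideal_gen_def module.span_explicit[OF module_times] by blast

lemma ideal_gen_subset_iff: "ideal_gen G \<subseteq> ideal_gen H \<longleftrightarrow> G \<subseteq> ideal_gen H"
proof
  show "G \<subseteq> ideal_gen H" if "ideal_gen G \<subseteq> ideal_gen H"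
    using that ideal_gen_base by blast
  show "ideal_gen G \<subseteq> ideal_gen H" if "G \<subseteq> ideal_gen H"
    using that ideal_gen_zero ideal_gen_add ideal_gen_scale by (rule ideal_gen_least)
qed

lemma supported_ideal:
  fixes G :: "('n, 'k::comm_ring_1) mpoly set"
  assumes "up_closed A" "G \<subseteq> supported A"
  shows "ideal_gen G \<subseteq> supported A"
proof (rule ideal_gen_least[OF assms(2)])
  show "x + y \<in> supported A" if "x \<in> supported A" "y \<in> supported A" for x y :: "('n, 'k) mpoly"
    using that keys_add[of x y] by (auto simp: supported_def)
  show "c * x \<in> supported A" if "x \<in> supported A" for c x :: "('n, 'k) mpoly"
    using that keys_mult_up_closed[OF assms(1)] by (auto simp: supported_def)
qed (auto simp: supported_def)

lemma monom_in_supported [simp]: "(monom u :: ('n, 'k::field) mpoly) \<in> supported A \<longleftrightarrow> u \<in> A"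
  by (simp add: supported_def monom_def)

text \<open>
  The right-hand side is an ideal because multiplication only adds exponents, and each term of one of
  its elements is a multiple of a generator.
\<close>

lemma ideal_gen_monom:
  fixes U :: "'n expo set"
  shows "ideal_gen (monom ` U) = (supported (upset U) :: ('n, 'k::field) mpoly set)"
proof
  show "ideal_gen (monom ` U) \<subseteq> (supported (upset U) :: ('n, 'k) mpoly set)"
    by (intro supported_ideal) (auto simp: upset_base)
  show "(supported (upset U) :: ('n, 'k) mpoly set) \<subseteq> ideal_gen (monom ` U)"
  proof
    fix f :: "('n, 'k) mpoly" assume f: "f \<in> supported (upset U)"
    have "f = (\<Sum>u\<in>keys f. single u (lookup f u))"
      using keep_id[of f UNIV] by (simp add: keep_def)
    also have "\<dots> \<in> ideal_gen (monom ` U)"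
    proof (rule ideal_gen_sum)
      fix u assume "u \<in> keys f"
      then have "u \<in> upset U" using f by (auto simp: supported_def)
      then obtain v t where v: "v \<in> U" "u = v + t" by (rule upsetE)
      have "single u (lookup f u)
          = single t (lookup f u) * (monom v :: ('n, 'k) mpoly)"
        by (simp add: v monom_def mult_single add.commute)
      then show "single u (lookup f u) \<in> ideal_gen (monom ` U)"
        using v by (auto intro: ideal_gen_scale ideal_gen_base)
    qed
    finally show "f \<in> ideal_gen (monom ` U)" .
  qed
qed

lemma supported_eq_iff:
  "(supported A :: ('n, 'k::field) mpoly set) = supported B \<longleftrightarrow> A = B"
proof
  assume eq: "(supported A :: ('n, 'k) mpoly set) = supported B"
  have "u \<in> A \<longleftrightarrow> u \<in> B" for u
    using monom_in_supported[of u A, where 'k = 'k] monom_in_supported[of u B, where 'k = 'k] eq by blast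
  then show "A = B" by blast
qed simp

lemma ideal_mult_supported:
  fixes U V :: "'n expo set"
  shows "ideal_mult (supported (upset U)) (supported (upset V)) =
    (supported (upset {u + v | u v. u \<in> U \<and> v \<in> V}) :: ('n, 'k::field) mpoly set)" (is "?L = ?R")
proof
  show "?L \<subseteq> ?R"
    unfolding ideal_mult_def
  proof (rule supported_ideal)
    have "a * b \<in> ?R" if a: "a \<in> supported (upset U)" and b: "b \<in> supported (upset V)" for a b
      unfolding supported_def
    proof (intro CollectI subsetI)
      fix w assume "w \<in> keys (a * b)"
      then obtain s t where "s \<in> upset U" "t \<in> upset V" and w: "w = s + t"
        using keys_mult[of a b] a b unfolding supported_def by blast
      then obtain u s' v t' where "u \<in> U" "s = u + s'" "v \<in> V" "t = v + t'" by (auto elim!: upsetE)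
      moreover from this have "w = (u + v) + (s' + t')" by (simp add: w ac_simps)
      ultimately show "w \<in> upset {u + v | u v. u \<in> U \<and> v \<in> V}" by (auto intro: upsetI)
    qed
    then show "{a * b | a b. a \<in> supported (upset U) \<and> b \<in> supported (upset V)} \<subseteq> ?R" by blast
  qed simp
  have "monom (u + v) \<in> ?L" if "u \<in> U" "v \<in> V" for u v
  proof -
    have "(monom (u + v) :: ('n, 'k) mpoly) = monom u * monom v"
      by (simp add: monom_def mult_single)
    moreover have "(monom u :: ('n, 'k) mpoly) \<in> supported (upset U)"
      and "(monom v :: ('n, 'k) mpoly) \<in> supported (upset V)"
      using that by (simp_all add: upset_base)
    ultimately show ?thesis unfolding ideal_mult_def by (intro ideal_gen_base) blast
  qed
  then have "monom ` {u + v | u v. u \<in> U \<and> v \<in> V} \<subseteq> ?L" by blast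
  then show "?R \<subseteq> ?L"
    unfolding ideal_gen_monom[symmetric] unfolding ideal_mult_def ideal_gen_subset_iff .
qed

text \<open>
  Multiplication by a monomial translates the set of exponents, so the colon is monomial as well.
\<close>

lemma ideal_colon_supported:
  fixes U :: "'n expo set"
  shows "ideal_colon (supported (upset U)) (ideal_gen {monom w}) =
    (supported {u. u + w \<in> upset U} :: ('n, 'k::field) mpoly set)"
proof -
  have eq: "f * monom w \<in> supported (upset U) \<longleftrightarrow> f \<in> supported {u. u + w \<in> upset U}"
    for f :: "('n, 'k) mpoly"
    using keys_monom_times[of w f] by (auto simp: supported_def mult.commute)
  have "f * g \<in> supported (upset U)" if f: "f \<in> supported {u. u + w \<in> upset U}"
    and g: "g \<in> ideal_gen {monom w}" for f g :: "('n, 'k) mpoly"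
  proof -
    have "g \<in> supported (upset {w})" using g ideal_gen_monom[of "{w}", where 'k = 'k] by simp
    then obtain h where h: "g = monom w * h" using monom_divides unfolding supported_def by blast
    have "f * g = h * (f * monom w)" by (simp add: h ac_simps)
    moreover have "keys (f * monom w) \<subseteq> upset U"
      using eq[of f] f by (simp add: supported_def)
    ultimately show ?thesis
      using keys_mult_up_closed[OF up_closed_upset] by (simp add: supported_def)
  qed
  moreover have "f \<in> supported {u. u + w \<in> upset U}"
    if "\<forall>g\<in>ideal_gen {monom w}. f * g \<in> supported (upset U)" for f :: "('n, 'k) mpoly"
  proof -
    have "monom w \<in> ideal_gen {monom w :: ('n, 'k) mpoly}" by (rule ideal_gen_base) simp
    with that have "f * monom w \<in> supported (upset U)" by blast
    then show ?thesis using eq by simp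
  qed
  ultimately show ?thesis unfolding ideal_colon_def by blast
qed

lemma in_upset_vars: "u \<in> upset (var_exp ` X) \<longleftrightarrow> (\<exists>x\<in>X. lookup u x > 0)"
proof
  show "\<exists>x\<in>X. lookup u x > 0" if "u \<in> upset (var_exp ` X)"
    using that by (auto elim!: upsetE simp: lookup_add lookup_var_exp)
  assume "\<exists>x\<in>X. lookup u x > 0"
  then obtain x where x: "x \<in> X" "lookup u x > 0" by blast
  then have "u = var_exp x + (u - var_exp x)" using exponent_split_var[of u x] by (metis add.commute)
  then show "u \<in> upset (var_exp ` X)" using x(1) upsetI[of "var_exp x" "var_exp ` X"] by (metis imageI)
qed

lemma in_upset_var: "u \<in> upset {var_exp x} \<longleftrightarrow> lookup u x > 0"
  using in_upset_vars[of u "{x}"] by simp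

lemma upset_singleton_zero: "upset {0} = UNIV"
  using upsetI[of 0 "{0}"] by auto

lemma upset_insert: "upset (insert u U) = upset U \<union> upset {u}"
  using upset_Un[of U "{u}"] by simp

lemma upset_insert_var: "upset (var_exp ` insert x X) = upset (var_exp ` X) \<union> upset {var_exp x}"
  unfolding image_insert by (rule upset_insert)

lemma upset_vars_nonzerodivisor:
  "x \<notin> X \<Longrightarrow> u + var_exp x \<in> upset (var_exp ` X) \<Longrightarrow> u \<in> upset (var_exp ` X)"
  unfolding in_upset_vars by (metis add.right_neutral lookup_add lookup_var_exp)

section \<open>Minimal monomial generators\<close>

definition antichain :: "'n expo set \<Rightarrow> bool"
  where "antichain U \<longleftrightarrow> (\<forall>u\<in>U. \<forall>v\<in>U. \<forall>t. u = v + t \<longrightarrow> u = v)"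

lemma antichainD: "antichain U \<Longrightarrow> u \<in> U \<Longrightarrow> v \<in> U \<Longrightarrow> u = v + t \<Longrightarrow> u = v"
  by (simp add: antichain_def)

lemma inj_monom: "inj (monom :: _ \<Rightarrow> ('n, 'k::field) mpoly)"
proof
  fix u v :: "'n expo" assume "(monom u :: ('n, 'k) mpoly) = monom v"
  then have "keys (monom u :: ('n, 'k) mpoly) = keys (monom v :: ('n, 'k) mpoly)" by simp
  then show "u = v" by (simp add: monom_def)
qed

text \<open>
  A generator can be dropped from a set of monomials exactly when another one of them divides it.
\<close>

lemma min_gens_monom_iff:
  "min_gens (monom ` U) (supported (upset V) :: ('n, 'k::field) mpoly set) \<longleftrightarrow>
    upset U = upset V \<and> antichain U"
proof -
  have 1: "antichain U" if min: "\<forall>H. H \<subset> monom ` U \<longrightarrow> ideal_gen H \<noteq> (supported (upset U) :: ('n, 'k) mpoly set)"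
    unfolding antichain_def
  proof (intro ballI allI impI)
    fix u v t assume uv: "u \<in> U" "v \<in> U" "u = v + t"
    show "u = v"
    proof (rule ccontr)
      assume "u \<noteq> v"
      then have "U \<subseteq> upset (U - {u})"
        using uv upsetI[of v "U - {u}" t] by (auto intro: upset_base)
      then have "upset U = upset (U - {u})"
        using upset_least[OF up_closed_upset, of U "U - {u}"] upset_mono[of "U - {u}" U] by blast
      then have "ideal_gen (monom ` (U - {u})) = (supported (upset U) :: ('n, 'k) mpoly set)"
        by (simp add: ideal_gen_monom)
      moreover have "(monom ` (U - {u}) :: ('n, 'k) mpoly set) \<subset> monom ` U"
      proof -
        have "(monom ` (U - {u}) :: ('n, 'k) mpoly set) = monom ` U - {monom u}"
          by (simp add: image_set_diff[OF inj_monom])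
        moreover have "(monom u :: ('n, 'k) mpoly) \<in> monom ` U" using uv(1) by (rule imageI)
        ultimately show ?thesis by (metis Diff_iff Diff_subset insertI1 psubsetI)
      qed
      ultimately show False using min by simp
    qed
  qed
  have 2: "ideal_gen H \<noteq> (supported (upset U) :: ('n, 'k) mpoly set)"
    if anti: "antichain U" and H: "H \<subset> monom ` U" for H
  proof
    assume eq: "ideal_gen H = (supported (upset U) :: ('n, 'k) mpoly set)"
    obtain W where W: "H = monom ` W" "W \<subseteq> U" using H by (auto simp: psubset_eq subset_image_iff)
    have "W \<noteq> U" using H W(1) by auto
    then obtain u where u: "u \<in> U" "u \<notin> W" using W(2) by blast
    have "upset W = upset U" using eq by (simp add: W ideal_gen_monom supported_eq_iff)
    then have "u \<in> upset W" using upset_base[OF u(1)] by simp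
    then obtain v t where v: "v \<in> W" "u = v + t" by (rule upsetE)
    then have "u = v" using antichainD[OF anti u(1)] W(2) by auto
    then show False using v(1) u(2) by simp
  qed
  show ?thesis
  proof
    assume L: "min_gens (monom ` U) (supported (upset V) :: ('n, 'k) mpoly set)"
    then have "upset U = upset V" by (simp add: min_gens_def ideal_gen_monom supported_eq_iff)
    with L 1 show "upset U = upset V \<and> antichain U" by (simp add: min_gens_def)
  next
    assume "upset U = upset V \<and> antichain U"
    with 2 show "min_gens (monom ` U) (supported (upset V) :: ('n, 'k) mpoly set)"
      by (simp add: min_gens_def ideal_gen_monom)
  qed
qed

text \<open>
  An element \<open>u\<close> of \<open>U\<close> is a multiple of some \<open>v\<close> in \<open>V\<close>, which is a multiple of some \<open>u'\<close> in \<open>U\<close>. As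
  \<open>U\<close> is an antichain, \<open>u = u'\<close>, and therefore \<open>u = v\<close>.
\<close>

lemma antichain_upset_unique:
  assumes "antichain U" "antichain V" "upset U = upset V" shows "U = V"
proof -
  have "U \<subseteq> V" if UV: "antichain U" "upset U = upset V" for U V :: "'n expo set"
  proof
    fix u assume u: "u \<in> U"
    then have "u \<in> upset V" using upset_base UV(2) by auto
    then obtain v s where v: "v \<in> V" "u = v + s" by (rule upsetE)
    then have "v \<in> upset U" using upset_base UV(2) by auto
    then obtain u' t where u': "u' \<in> U" "v = u' + t" by (rule upsetE)
    have "u = u' + (t + s)" using v u' by (simp add: ac_simps)
    then have "u = u'" using antichainD[OF UV(1) u u'(1)] by simp
    with \<open>u = u' + (t + s)\<close> have "t + s = 0" by simp
    then have "s = 0" 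
      by (metis add_eq_0_iff_both_eq_0 lookup_add lookup_zero poly_mapping_eqI)
    then show "u \<in> V" using v by simp
  qed
  from this[of U V] this[of V U] assms show ?thesis by blast
qed

lemma monomial_gens_supported:
  assumes "antichain U"
  shows "monomial_gens (supported (upset U) :: ('n, 'k::field) mpoly set) = U"
  unfolding monomial_gens_def min_gens_monom_iff
  by (rule the_equality) (use assms antichain_upset_unique in auto)

lemma antichain_equigenerated:
  fixes U :: "'n::finite expo set"
  assumes "\<And>u. u \<in> U \<Longrightarrow> mdeg u = d" shows "antichain U"
  unfolding antichain_def
proof (intro ballI allI impI)
  fix u v t assume "u \<in> U" "v \<in> U" "u = v + t"
  then show "u = v" using add_eq_self_degree[of u v t] assms[of u] assms[of v] by simp
qed

text \<open>
  Proper divisors have smaller degree, so every exponent in \<open>U\<close> lies above a minimal one.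
\<close>

lemma minimal_elements:
  fixes U :: "'n::finite expo set"
  obtains V where "V \<subseteq> U" "antichain V" "upset V = upset U"
proof -
  define V where "V = {u\<in>U. \<forall>v\<in>U. \<forall>t. u = v + t \<longrightarrow> u = v}"
  have ex: "\<exists>v\<in>V. \<exists>t. u = v + t" if "u \<in> U" for u
    using that
  proof (induction "mdeg u" arbitrary: u rule: less_induct)
    case less
    show ?case
    proof (cases "u \<in> V")
      case True then show ?thesis by (metis add.right_neutral)
    next
      case False
      then obtain v t where v: "v \<in> U" "u = v + t" "u \<noteq> v" using less.prems by (auto simp: V_def)
      then have "t \<noteq> 0" by auto
      then have "mdeg t > 0" by (meson gr0I mdeg_zero_iff)
      then have "mdeg v < mdeg u" by (simp add: v mdeg_add)
      then obtain w s where "w \<in> V" "v = w + s" using less.hyps v(1) by blast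
      then show ?thesis using v(2) by (metis add.assoc)
    qed
  qed
  have "U \<subseteq> upset V" using ex upsetI by fastforce
  moreover have "V \<subseteq> U" by (auto simp: V_def)
  ultimately have "upset V = upset U"
    using upset_least[OF up_closed_upset, of U V] upset_mono[of V U] by blast
  then show ?thesis using that[of V] by (auto simp: V_def antichain_def)
qed

section \<open>Exchange between products of edges\<close>

definition ends :: "'a \<times> 'a \<Rightarrow> 'a multiset"
  where "ends e = {#fst e, snd e#}"

text \<open>
  A multiset of edges is a factorization of the monomial \<open>verts A\<close>, which is represented by the
  multiset of its variables.
\<close>

definition verts :: "('a \<times> 'a) multiset \<Rightarrow> 'a multiset"
  where "verts A = (\<Sum>e\<in>#A. ends e)"

lemma verts_empty [simp]: "verts {#} = {#}"
  and verts_add_mset [simp]: "verts (add_mset e A) = ends e + verts A"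
  and verts_union [simp]: "verts (A + B) = verts A + verts B"
  by (simp_all add: verts_def)

lemma size_ends [simp]: "size (ends e) = 2"
  by (simp add: ends_def)

lemma size_verts: "size (verts A) = 2 * size A"
  by (induction A) auto

lemma in_verts_iff: "x \<in># verts A \<longleftrightarrow> (\<exists>e\<in>#A. x \<in># ends e)"
  by (induction A) auto

lemma ends_split: "x \<in># ends e \<Longrightarrow> \<exists>y. ends e = {#x, y#}"
  by (auto simp: ends_def add_mset_commute)

lemma in_vertsE:
  assumes "x \<in># verts A"
  obtains e y A' where "A = add_mset e A'" "ends e = {#x, y#}"
  using assms in_verts_iff ends_split by (metis multi_member_split)

text \<open>
  Think of the edges of \<open>A\<close> as blue and of those of \<open>B\<close> as red. Starting at \<open>q\<close>, follow a red edge,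
  then a blue one, and so on. The two sides of the balance equation show that the walk can be
  continued from a red edge unless its last vertex is in \<open>h\<close>, and from a blue edge (or the start)
  unless it is in \<open>g\<close>. \<open>A1\<close> and \<open>B1\<close> are the blue and red edges of the walk.
\<close>

lemma alternating_walk:
  assumes "h + verts A + {#q#} = g + verts B"
  shows "\<exists>A1 A2 B1 B2. A = A1 + A2 \<and> B = B1 + B2 \<and>
    ((\<exists>y\<in>#g. add_mset q (verts A1) = add_mset y (verts B1)) \<or>
     (\<exists>z\<in>#h. verts A1 + {#q, z#} = verts B1))"
  using assms
proof (induction "size A" arbitrary: A B q rule: less_induct)
  case (less A B q)
  note IH = less(1) and eq = less(2)
  have "q \<in># g + verts B" unfolding eq[symmetric] by simp
  then consider "q \<in># g" | "q \<in># verts B" by auto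
  then show ?case
  proof cases
    case 1
    then show ?thesis by (intro exI[of _ "{#}"] exI[of _ A] exI[of _ B]) auto
  next
    case 2
    then obtain f s B' where f: "B = add_mset f B'" "ends f = {#q, s#}" by (rule in_vertsE)
    have eq': "h + verts A = g + verts B' + {#s#}" using eq f by simp
    have "s \<in># h + verts A" unfolding eq' by simp
    then consider "s \<in># h" | "s \<in># verts A" by auto
    then show ?thesis
    proof cases
      case 1
      then show ?thesis using f
        by (intro exI[of _ "{#}"] exI[of _ A] exI[of _ "{#f#}"] exI[of _ B']) auto
    next
      case 2
      then obtain e t A' where e: "A = add_mset e A'" "ends e = {#s, t#}" by (rule in_vertsE)
      have "h + verts A' + {#t#} = g + verts B'" using eq' e by simp
      (* The walk has passed from q along f and e to t, from where it is continued. *)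
      from IH[OF _ this] have "\<exists>A1 A2 B1 B2. A' = A1 + A2 \<and> B' = B1 + B2 \<and>
        ((\<exists>y\<in>#g. add_mset t (verts A1) = add_mset y (verts B1)) \<or>
         (\<exists>z\<in>#h. verts A1 + {#t, z#} = verts B1))" by (simp add: e)
      then obtain A1 A2 B1 B2 where *: "A' = A1 + A2" "B' = B1 + B2"
        "(\<exists>y\<in>#g. add_mset t (verts A1) = add_mset y (verts B1)) \<or>
         (\<exists>z\<in>#h. verts A1 + {#t, z#} = verts B1)" by (elim exE conjE) (rule that)
      have "(\<exists>y\<in>#g. add_mset q (verts (add_mset e A1)) = add_mset y (verts (add_mset f B1))) \<or>
        (\<exists>z\<in>#h. verts (add_mset e A1) + {#q, z#} = verts (add_mset f B1))"
        using *(3)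
      proof (elim disjE bexE)
        fix y assume y: "y \<in># g" "add_mset t (verts A1) = add_mset y (verts B1)"
        have "add_mset q (verts (add_mset e A1)) = {#q, s#} + add_mset t (verts A1)"
          by (simp add: e)
        also have "\<dots> = add_mset y (verts (add_mset f B1))" unfolding y(2) by (simp add: f)
        finally show ?thesis using y(1) by blast
      next
        fix z assume z: "z \<in># h" "verts A1 + {#t, z#} = verts B1"
        have "verts (add_mset e A1) + {#q, z#} = {#q, s#} + (verts A1 + {#t, z#})"
          by (simp add: e)
        also have "\<dots> = verts (add_mset f B1)" unfolding z(2) by (simp add: f)
        finally show ?thesis using z(1) by blast
      qed
      moreover have "A = add_mset e A1 + A2" "B = add_mset f B1 + B2" using e f * by simp_all
      ultimately show ?thesis by blast
    qed
  qed
qed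

text \<open>
  What remains off the walk is balanced again, so that further walks can be taken there.
\<close>

lemma alternating_walk_cases:
  assumes eq: "h + verts A + {#q#} = g + verts B"
  obtains (blue) A1 A2 B1 B2 y g' where "A = A1 + A2" "B = B1 + B2" "g = add_mset y g'"
      "add_mset q (verts A1) = add_mset y (verts B1)" "h + verts A2 = g' + verts B2" "size B1 = size A1"
    | (red) A1 A2 B1 B2 z h' where "A = A1 + A2" "B = B1 + B2" "h = add_mset z h'"
      "verts A1 + {#q, z#} = verts B1" "h' + verts A2 = g + verts B2" "size B1 = Suc (size A1)"
proof -
  from alternating_walk[OF eq] obtain A1 A2 B1 B2 where *: "A = A1 + A2" "B = B1 + B2"
    and alt: "(\<exists>y\<in>#g. add_mset q (verts A1) = add_mset y (verts B1)) \<or>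
     (\<exists>z\<in>#h. verts A1 + {#q, z#} = verts B1)" by (elim exE conjE) (rule that)
  from alt show ?thesis
  proof (elim disjE bexE)
    fix y assume y: "y \<in># g" "add_mset q (verts A1) = add_mset y (verts B1)"
    from y(1) obtain g' where g: "g = add_mset y g'" by (metis multi_member_split)
    have "add_mset q (verts A1) + (h + verts A2) = add_mset y (verts B1) + (g' + verts B2)"
      using eq by (simp add: g * ac_simps)
    then have "h + verts A2 = g' + verts B2" unfolding y(2) by simp
    moreover have "size B1 = size A1"
      using arg_cong[OF y(2), of size] by (simp add: size_verts)
    ultimately show ?thesis using blue[OF * g y(2)] by blast
  next
    fix z assume z: "z \<in># h" "verts A1 + {#q, z#} = verts B1"
    from z(1) obtain h' where h: "h = add_mset z h'" by (metis multi_member_split)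
    have "(verts A1 + {#q, z#}) + (h' + verts A2) = verts B1 + (g + verts B2)"
      using eq by (simp add: h * ac_simps add_mset_commute)
    then have "h' + verts A2 = g + verts B2" unfolding z(2) by simp
    moreover have "size B1 = Suc (size A1)"
      using arg_cong[OF z(2), of size] by (simp add: size_verts)
    ultimately show ?thesis using red[OF * h z(2)] by blast
  qed
qed

text \<open>
  If \<open>B\<close> has more edges than \<open>A\<close>, then \<open>h\<close> has more elements than \<open>g\<close>. A walk from \<open>h\<close> to \<open>g\<close> uses
  equally many edges of both colours and can be removed, so some walk from \<open>h\<close> must end in \<open>h\<close>.
\<close>

lemma surplus_walk:
  assumes "h + verts A = g + verts B" "size A < size B"
  shows "\<exists>A1 B1 v z. A1 \<subseteq># A \<and> B1 \<subseteq># B \<and> {#v, z#} \<subseteq># h \<and> verts A1 + {#v, z#} = verts B1"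
  using assms
proof (induction "size h" arbitrary: h g A B rule: less_induct)
  case (less h g A B)
  have "size h + 2 * size A = size g + 2 * size B"
    using arg_cong[OF less.prems(1), of size] by (simp add: size_verts)
  then have "h \<noteq> {#}" using less.prems(2) by auto
  then obtain v h' where h: "h = add_mset v h'" by (metis multiset_cases)
  have "h' + verts A + {#v#} = g + verts B" using less.prems(1) h by simp
  then show ?case
  proof (cases rule: alternating_walk_cases)
    case (red A1 A2 B1 B2 z k)
    then have "A1 \<subseteq># A" "B1 \<subseteq># B" "{#v, z#} \<subseteq># h" by (simp_all add: h)
    with red(4) show ?thesis by blast
  next
    case (blue A1 A2 B1 B2 y g')
    have "size A2 < size B2" using less.prems(2) blue by simp
    moreover have "size h' < size h" by (simp add: h)
    ultimately have "\<exists>A3 B3 w z. A3 \<subseteq># A2 \<and> B3 \<subseteq># B2 \<and> {#w, z#} \<subseteq># h' \<and>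
      verts A3 + {#w, z#} = verts B3" using less.hyps blue(5) by simp
    then obtain A3 B3 w z where w: "A3 \<subseteq># A2" "B3 \<subseteq># B2" "{#w, z#} \<subseteq># h'"
      "verts A3 + {#w, z#} = verts B3" by (elim exE conjE) (rule that)
    have "A3 \<subseteq># A" "B3 \<subseteq># B"
      using blue(1,2) w(1,2) by (simp_all add: subset_mset.add_increasing)
    moreover have "{#w, z#} \<subseteq># h"
      using subset_mset.add_increasing[of "{#v#}" "{#w, z#}" h'] w(3) by (simp add: h)
    ultimately show ?thesis using w(4) by blast
  qed
qed

text \<open>
  This is a single step of the multiset order.
\<close>

lemma replace_max_less:
  fixes m :: "'a::linorder"
  assumes "\<forall>e\<in>#Z. e < m"
  shows "A + Z < A + add_mset m R"
  unfolding less_multiset_def using assms by (intro one_step_implies_multp) auto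

text \<open>
  Let \<open>m\<close> be the largest blue edge, with ends \<open>p\<close> and \<open>q\<close>, and take alternating walks from both of its
  ends. Exchanging the colours along the union of the two walks and \<open>m\<close> removes \<open>m\<close> and inserts
  smaller edges, so the factorization decreases.
  
  If the walk from \<open>q\<close> returns to \<open>p\<close>, the product does not change. If one walk ends in \<open>g\<close> at \<open>y\<close>
  and the other one in \<open>h\<close> at \<open>v\<close>, the product changes by the factor $v/y$, as desired. If both walks
  end in \<open>g\<close> or both in \<open>h\<close>, counting edges gives a third walk, disjoint from them, with both ends in the
  other set. By assumption one end of the first edge of the third walk is joined by an edge
  \<open>n < m\<close> to \<open>p\<close> or to \<open>q\<close>. Along this bridge the third walk is connected, through \<open>m\<close>, to the walk
  from the opposite end of \<open>m\<close>, and the combined walk leads from \<open>h\<close> to \<open>g\<close>.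
\<close>

lemma exchange_below_max:
  fixes X Y :: "('a::linorder \<times> 'a) multiset"
  assumes balance: "h + verts X = g + verts Y"
    and size: "size X = size Y"
    and m: "m \<in># X" "\<forall>x\<in>#X. x \<le> m" "\<forall>y\<in>#Y. y < m"
    and bridge: "\<And>f. f \<in># X + Y \<Longrightarrow> f < m \<Longrightarrow>
      \<exists>x\<in>#ends f. \<exists>s\<in>#ends m. \<exists>n\<in>E. n < m \<and> ends n = {#x, s#}"
  shows "\<exists>X'. X' < X \<and> set_mset X' \<subseteq> set_mset X \<union> set_mset Y \<union> E \<and>
    (verts X' = verts X \<or> (\<exists>v\<in>#h. \<exists>y\<in>#g. add_mset y (verts X') = add_mset v (verts X)))"
    (is ?thesis)
proof -
  obtain A0 where X: "X = add_mset m A0" using m(1) by (metis multi_member_split)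
  have swap: ?thesis
    if "R \<subseteq># A0" "set_mset Z \<subseteq> set_mset Y \<union> E" "\<forall>e\<in>#Z. e < m" and
      eq: "verts Z = ends m + verts R \<or>
        (\<exists>v\<in>#h. \<exists>y\<in>#g. add_mset y (verts Z) = add_mset v (ends m + verts R))" for R Z
  proof -
    define C where "C = A0 - R"
    have A0: "A0 = C + R" unfolding C_def by (rule subset_mset.diff_add[OF that(1), symmetric])
    have "C + Z < X" using replace_max_less[OF that(3), of C R] by (simp add: X A0)
    moreover have "set_mset (C + Z) \<subseteq> set_mset X \<union> set_mset Y \<union> E" using that(2) by (auto simp: X A0)
    moreover have "verts (C + Z) = verts X \<or>
      (\<exists>v\<in>#h. \<exists>y\<in>#g. add_mset y (verts (C + Z)) = add_mset v (verts X))"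
      using eq
    proof (elim disjE bexE)
      assume "verts Z = ends m + verts R"
      then show ?thesis by (simp add: X A0 ac_simps)
    next
      fix v y assume vy: "v \<in># h" "y \<in># g" "add_mset y (verts Z) = add_mset v (ends m + verts R)"
      have "add_mset y (verts (C + Z)) = verts C + add_mset y (verts Z)" by simp
      also have "\<dots> = add_mset v (verts X)" unfolding vy(3) by (simp add: X A0 ac_simps)
      finally show ?thesis using vy(1,2) by (intro disjI2 bexI)
    qed
    ultimately show ?thesis by (intro exI[of _ "C + Z"] conjI)
  qed
  obtain p q where pq: "ends m = {#p, q#}" by (simp add: ends_def)
  have small: "\<forall>e\<in>#B. e < m" if "B \<subseteq># Y" for B
    using that m(3) by (auto dest: mset_subset_eqD)
  have subY: "set_mset B \<subseteq> set_mset Y" if "B \<subseteq># Y" for B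
    using that by (auto dest: mset_subset_eqD)
  have swap_plain: ?thesis
    if "R \<subseteq># A0" "Z \<subseteq># Y" "v \<in># h" "y \<in># g"
      "add_mset y (verts Z) = add_mset v (ends m + verts R)" for R Z v y
    using that(3-5) subY[OF that(2)] by (intro swap[OF that(1) _ small[OF that(2)]]) auto
  have swap_bridge: ?thesis
    if "R \<subseteq># A0" "Z \<subseteq># Y" "v \<in># h" "y \<in># g" "n \<in> E" "n < m"
      "add_mset y (verts (add_mset n Z)) = add_mset v (ends m + verts R)" for R Z v y n
  proof (rule swap[OF that(1)])
    show "set_mset (add_mset n Z) \<subseteq> set_mset Y \<union> E" using subY[OF that(2)] that(5) by auto
    show "\<forall>e\<in>#add_mset n Z. e < m" using small[OF that(2)] that(6) by auto
    show "verts (add_mset n Z) = ends m + verts R \<or>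
      (\<exists>v\<in>#h. \<exists>y\<in>#g. add_mset y (verts (add_mset n Z)) = add_mset v (ends m + verts R))"
      using that(3,4,7) by (intro disjI2 bexI)
  qed
  (* Both walks from m end in g. The third walk runs from v to z, both in h, and f is its first edge. *)
  have blue_blue: ?thesis
    if A0: "A0 = A1 + (A2 + A3)" and Y: "Y = B1 + (B2 + B3)" and g: "g = add_mset y (add_mset y' g'')"
      and w1: "add_mset q (verts A1) = add_mset y (verts B1)"
      and w2: "add_mset p (verts A2) = add_mset y' (verts B2)"
      and rest: "h + verts A3 = g'' + verts B3" "size A3 < size B3"
    for A1 A2 A3 B1 B2 B3 y y' g''
  proof -
    obtain Ax Bx v z where x: "Ax \<subseteq># A3" "Bx \<subseteq># B3" "{#v, z#} \<subseteq># h" "verts Ax + {#v, z#} = verts Bx"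
      using surplus_walk[OF rest] by (elim exE conjE) (rule that)
    have "v \<in># h" "z \<in># h" using mset_subset_eqD[OF x(3)] by auto
    have "v \<in># verts Bx" unfolding x(4)[symmetric] by simp
    then obtain f t Bx' where f: "Bx = add_mset f Bx'" "ends f = {#v, t#}" by (rule in_vertsE)
    have "f \<in># Y" using x(2) f(1) by (auto simp: Y dest: mset_subset_eqD)
    then obtain x s n where b: "x \<in># ends f" "s \<in># ends m" "n \<in> E" "n < m" "ends n = {#x, s#}"
      using bridge[of f] m(3) by auto
    have "\<exists>R Z z0. R \<subseteq># A3 \<and> Z \<subseteq># B3 \<and> z0 \<in># h \<and> add_mset x (verts Z) = add_mset z0 (verts R)"
    proof (cases "x = v")
      case True
      then show ?thesis using \<open>v \<in># h\<close>
        by (intro exI[of _ "{#}"] exI[of _ v]) simp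
    next
      case False
      then have "x = t" using b(1) f(2) by auto
      moreover have "add_mset t (verts Bx') = add_mset z (verts Ax)"
        using x(4) f by (simp add: add_mset_commute)
      moreover have "Bx' \<subseteq># B3" using x(2) f(1) by (metis mset_subset_eq_insertD subset_mset.less_imp_le)
      ultimately show ?thesis using x(1) \<open>z \<in># h\<close> by blast
    qed
    then obtain R Z z0 where r: "R \<subseteq># A3" "Z \<subseteq># B3" "z0 \<in># h" "add_mset x (verts Z) = add_mset z0 (verts R)"
      by (elim exE conjE) (rule that)
    have sub: "A1 + R \<subseteq># A0" "B1 + Z \<subseteq># Y" "A2 + R \<subseteq># A0" "B2 + Z \<subseteq># Y"
      using r(1,2) by (auto simp: A0 Y intro: subset_mset.add_increasing subset_mset.add_left_mono)
    have yg: "y \<in># g" "y' \<in># g" by (simp_all add: g)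
    from b(2) pq consider "s = p" | "s = q" by auto
    then show ?thesis
    proof cases
      case 1
      have "add_mset y (verts (add_mset n (B1 + Z))) = add_mset y (verts B1) + add_mset x (verts Z) + {#p#}"
        by (simp add: b(5) 1)
      also have "\<dots> = add_mset z0 (ends m + verts (A1 + R))"
        unfolding w1[symmetric] r(4) by (simp add: pq)
      finally show ?thesis by (rule swap_bridge[OF sub(1,2) r(3) yg(1) b(3,4)])
    next
      case 2
      have "add_mset y' (verts (add_mset n (B2 + Z))) = add_mset y' (verts B2) + add_mset x (verts Z) + {#q#}"
        by (simp add: b(5) 2)
      also have "\<dots> = add_mset z0 (ends m + verts (A2 + R))"
        unfolding w2[symmetric] r(4) by (simp add: pq)
      finally show ?thesis by (rule swap_bridge[OF sub(3,4) r(3) yg(2) b(3,4)])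
    qed
  qed
  (* The same situation with the colours interchanged. Here the first edge of the third walk is blue
     and may be another copy of m; then its vertex y in g is an end of m and the walk is already there. *)
  have red_red: ?thesis
    if A0: "A0 = A1 + (A2 + A3)" and Y: "Y = B1 + (B2 + B3)" and h: "h = add_mset z (add_mset z' h'')"
      and w1: "verts A1 + {#q, z#} = verts B1"
      and w2: "verts A2 + {#p, z'#} = verts B2"
      and rest: "h'' + verts A3 = g + verts B3" "size B3 < size A3"
    for A1 A2 A3 B1 B2 B3 z z' h''
  proof -
    obtain Bx Ax y y1 where x: "Bx \<subseteq># B3" "Ax \<subseteq># A3" "{#y, y1#} \<subseteq># g" "verts Bx + {#y, y1#} = verts Ax"
      using surplus_walk[OF rest(1)[symmetric] rest(2)] by (elim exE conjE) (rule that)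
    have "y \<in># g" "y1 \<in># g" using mset_subset_eqD[OF x(3)] by auto
    have "y \<in># verts Ax" unfolding x(4)[symmetric] by simp
    then obtain f t Ax' where f: "Ax = add_mset f Ax'" "ends f = {#y, t#}" by (rule in_vertsE)
    have "f \<in># A3" using x(2) f(1) by (auto dest: mset_subset_eqD)
    then have "f \<in># X" by (simp add: X A0)
    have zh: "z \<in># h" "z' \<in># h" by (simp_all add: h)
    have sub1: "A1 \<subseteq># A0" "B1 \<subseteq># Y" "A2 \<subseteq># A0" "B2 \<subseteq># Y"
      by (auto simp: A0 Y intro: subset_mset.add_increasing)
    show ?thesis
    proof (cases "f = m")
      case True
      then have "y \<in># ends m" using f(2) by auto
      with pq consider "y = p" | "y = q" by auto
      then show ?thesis
      proof cases
        case 1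
        have "add_mset y (verts B1) = add_mset z (ends m + verts A1)"
          unfolding w1[symmetric] by (simp add: 1 pq add_mset_commute)
        then show ?thesis by (rule swap_plain[OF sub1(1,2) zh(1) \<open>y \<in># g\<close>])
      next
        case 2
        have "add_mset y (verts B2) = add_mset z' (ends m + verts A2)"
          unfolding w2[symmetric] by (simp add: 2 pq add_mset_commute)
        then show ?thesis by (rule swap_plain[OF sub1(3,4) zh(2) \<open>y \<in># g\<close>])
      qed
    next
      case False
      then have "f < m" using m(2) \<open>f \<in># X\<close> by (metis order_le_less)
      then obtain x s n where b: "x \<in># ends f" "s \<in># ends m" "n \<in> E" "n < m" "ends n = {#x, s#}"
        using bridge[of f] \<open>f \<in># X\<close> by auto
      have "\<exists>R Z y0. R \<subseteq># A3 \<and> Z \<subseteq># B3 \<and> y0 \<in># g \<and> verts R = verts Z + {#x, y0#}"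
      proof (cases "x = y")
        case True
        then show ?thesis using x(1,2) x(4)[symmetric] \<open>y1 \<in># g\<close> by blast
      next
        case False
        then have "x = t" using b(1) f(2) by auto
        then show ?thesis using \<open>f \<in># A3\<close> \<open>y \<in># g\<close> f(2)
          by (intro exI[of _ "{#f#}"] exI[of _ "{#}"] exI[of _ y]) (simp add: add_mset_commute)
      qed
      then obtain R Z y0 where r: "R \<subseteq># A3" "Z \<subseteq># B3" "y0 \<in># g" "verts R = verts Z + {#x, y0#}"
        by (elim exE conjE) (rule that)
      have sub: "A1 + R \<subseteq># A0" "B1 + Z \<subseteq># Y" "A2 + R \<subseteq># A0" "B2 + Z \<subseteq># Y"
        using r(1,2) by (auto simp: A0 Y intro: subset_mset.add_increasing subset_mset.add_left_mono)
      from b(2) pq consider "s = p" | "s = q" by auto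
      then show ?thesis
      proof cases
        case 1
        have "add_mset y0 (verts (add_mset n (B1 + Z))) = add_mset z (ends m + verts (A1 + R))"
          by (simp add: b(5) 1 r(4) w1[symmetric] pq add_mset_commute)
        then show ?thesis by (rule swap_bridge[OF sub(1,2) zh(1) r(3) b(3,4)])
      next
        case 2
        have "add_mset y0 (verts (add_mset n (B2 + Z))) = add_mset z' (ends m + verts (A2 + R))"
          by (simp add: b(5) 2 r(4) w2[symmetric] pq add_mset_commute)
        then show ?thesis by (rule swap_bridge[OF sub(3,4) zh(2) r(3) b(3,4)])
      qed
    qed
  qed
  (* The walk from q may also stop at p; then it forms a closed walk with m. *)
  have "(h + {#p#}) + verts A0 + {#q#} = g + verts Y" using balance by (simp add: X pq add_mset_commute)
  then show ?thesis
  proof (cases rule: alternating_walk_cases)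
    case (blue A1 A' B1 B' y g')
    have "h + verts A' + {#p#} = g' + verts B'" using blue(5) by simp
    then show ?thesis
    proof (cases rule: alternating_walk_cases)
      case blue2: (blue A2 A3 B2 B3 y' g'')
      have "size A3 < size B3" using size blue(1,2,6) blue2(1,2,6) by (simp add: X)
      with blue blue2 show ?thesis by (intro blue_blue[of A1 A2 A3 B1 B2 B3 y y' g'']) simp_all
    next
      case red: (red A2 A3 B2 B3 z h')
      have "add_mset y (verts (B1 + B2)) = add_mset z (ends m + verts (A1 + A2))"
        unfolding verts_union red(4)[symmetric]
        using blue(4) by (simp add: pq add_mset_commute)
      then show ?thesis using swap_plain[of "A1 + A2" "B1 + B2" z y] by (simp add: blue(1-3) red(1-3))
    qed
  next
    case (red A1 A' B1 B' z h')
    show ?thesis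
    proof (cases "z = p")
      case True
      then have "verts B1 = ends m + verts A1" using red(4) by (simp add: pq add_mset_commute)
      then show ?thesis using small[of B1] by (intro swap[of A1 B1]) (auto simp: red(1,2))
    next
      case False
      then obtain k where k: "h = add_mset z k" "h' = add_mset p k"
        using red(3) by (auto simp: add_eq_conv_ex)
      have "k + verts A' + {#p#} = g + verts B'" using red(5) by (simp add: k)
      then show ?thesis
      proof (cases rule: alternating_walk_cases)
        case red2: (red A2 A3 B2 B3 z' h'')
        have "size B3 < size A3" using size red(1,2,6) red2(1,2,6) by (simp add: X)
        with red red2 k show ?thesis by (intro red_red[of A1 A2 A3 B1 B2 B3 z z' h'']) simp_all
      next
        case blue: (blue A2 A3 B2 B3 y g')
        have "add_mset y (verts (B1 + B2)) = add_mset z (ends m + verts (A1 + A2))"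
          unfolding verts_union red(4)[symmetric]
          using blue(4) by (simp add: pq add_mset_commute)
        then show ?thesis using swap_plain[of "A1 + A2" "B1 + B2" z y] by (simp add: red(1,2) k blue(1-3))
      qed
    qed
  qed
qed

definition products :: "('a \<times> 'a) set \<Rightarrow> 'a multiset set"
  where "products E = {verts A | A. set_mset A \<subseteq> E}"

text \<open>
  The multiset order on a well-order is a well-order, so a least factorization exists. It plays the
  part of a standard monomial in the toric ring of the edges.
\<close>

definition std_factorization :: "('a::wellorder \<times> 'a) set \<Rightarrow> 'a multiset \<Rightarrow> ('a \<times> 'a) multiset"
  where "std_factorization E w = (LEAST A. set_mset A \<subseteq> E \<and> verts A = w)"

lemma std_factorization_factorizes:
  assumes "w \<in> products E"
  shows "set_mset (std_factorization E w) \<subseteq> E" "verts (std_factorization E w) = w"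
proof -
  from assms obtain A where "set_mset A \<subseteq> E \<and> verts A = w" unfolding products_def by blast
  from LeastI[of "\<lambda>A. set_mset A \<subseteq> E \<and> verts A = w", OF this]
  show "set_mset (std_factorization E w) \<subseteq> E" "verts (std_factorization E w) = w"
    by (simp_all add: std_factorization_def)
qed

lemma std_factorization_le:
  "set_mset A \<subseteq> E \<Longrightarrow> verts A = w \<Longrightarrow> std_factorization E w \<le> A"
  unfolding std_factorization_def by (rule Least_le) simp

text \<open>
  After cancelling the common edges of the least factorizations of \<open>u\<close> and \<open>w\<close>, the largest remaining
  edge \<open>m\<close> belongs to \<open>w\<close>. Any edge \<open>f < m\<close> has an end that is joined to \<open>m\<close> by an edge below \<open>m\<close>: if
  the first vertex of \<open>f\<close> precedes \<open>m\<close>, the covering property applies, and otherwise \<open>f\<close> itself meets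
  \<open>m\<close>. So \<open>exchange_below_max\<close> applies; the product cannot be preserved because the factorization of
  \<open>w\<close> is least.
\<close>

theorem linear_exchange:
  fixes E :: "('a::wellorder \<times> 'a) set"
  assumes cover: "\<And>e f. e \<in> E \<Longrightarrow> f \<in> E \<Longrightarrow> fst f < fst e \<Longrightarrow> (fst f, fst e) \<in> E \<or> (fst f, snd e) \<in> E"
    and u: "u \<in> products E" and w: "w \<in> products E" and size: "size u = size w"
    and less: "std_factorization E u < std_factorization E w"
  shows "\<exists>v y. count w v < count u v \<and> count u y < count w y \<and>
    add_mset v (w - {#y#}) \<in> products E \<and>
    std_factorization E (add_mset v (w - {#y#})) < std_factorization E w"
proof -
  define A where "A = std_factorization E w"
  define B where "B = std_factorization E u"
  have A: "set_mset A \<subseteq> E" "verts A = w" and B: "set_mset B \<subseteq> E" "verts B = u"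
    unfolding A_def B_def using std_factorization_factorizes u w by blast+
  define C where "C = A \<inter># B"
  have AC: "A = (A - B) + C" and BC: "B = (B - A) + C"
    unfolding C_def by (auto simp: multiset_eq_iff)
  have "multp\<^sub>H\<^sub>O (<) B A" using less unfolding A_def[symmetric] B_def[symmetric]
    by (simp add: less_multiset_def multp_eq_multp\<^sub>H\<^sub>O)
  from multp\<^sub>H\<^sub>O_implies_one_step_strong[OF this]
  have ne: "A - B \<noteq> {#}" and dom: "\<forall>k\<in>#B - A. \<exists>x\<in>#A - B. k < x" by auto
  define m where "m = Max (set_mset (A - B))"
  have m: "m \<in># A - B" "\<forall>x\<in>#A - B. x \<le> m" unfolding m_def using ne by auto
  have mE: "m \<in> E" using m(1) A(1) by (auto dest: in_diffD)
  have "(u - w) + w = (w - u) + u" by (auto simp: multiset_eq_iff)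
  moreover have "w = verts (A - B) + verts C" using arg_cong[OF AC, of verts] A(2) by simp
  moreover have "u = verts (B - A) + verts C" using arg_cong[OF BC, of verts] B(2) by simp
  ultimately have balance: "(u - w) + verts (A - B) = (w - u) + verts (B - A)"
    by (metis add.assoc add_right_cancel)
  have "size A = size B" using size A(2) B(2) size_verts by (metis mult_cancel1 zero_neq_numeral)
  then have "size (A - B) = size (B - A)"
    using arg_cong[OF AC, of size] arg_cong[OF BC, of size] by simp
  moreover have "\<forall>y\<in>#B - A. y < m" using dom m(2) by (meson order_less_le_trans)
  moreover have "\<exists>x\<in>#ends f. \<exists>s\<in>#ends m. \<exists>n\<in>E. n < m \<and> ends n = {#x, s#}"
    if f: "f \<in># (A - B) + (B - A)" "f < m" for f
  proof -
    have fE: "f \<in> E" using f(1) A(1) B(1) by (auto dest: in_diffD)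
    consider "fst f < fst m" | "fst f = fst m" "snd f < snd m" using f(2) by (auto simp: less_prod_def')
    then show ?thesis
    proof cases
      case 1
      from cover[OF mE fE 1] show ?thesis
      proof
        assume "(fst f, fst m) \<in> E"
        moreover have "(fst f, fst m) < m" using 1 by (simp add: less_prod_def')
        ultimately show ?thesis
          by (intro bexI[of _ "fst f"] bexI[of _ "fst m"] bexI[of _ "(fst f, fst m)"]) (auto simp: ends_def)
      next
        assume "(fst f, snd m) \<in> E"
        moreover have "(fst f, snd m) < m" using 1 by (simp add: less_prod_def')
        ultimately show ?thesis
          by (intro bexI[of _ "fst f"] bexI[of _ "snd m"] bexI[of _ "(fst f, snd m)"]) (auto simp: ends_def)
      qed
    next
      case 2
      then show ?thesis using fE f(2)
        by (intro bexI[of _ "snd f"] bexI[of _ "fst m"] bexI[of _ f]) (auto simp: ends_def)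
    qed
  qed
  ultimately obtain X' where X': "X' < A - B" "set_mset X' \<subseteq> set_mset (A - B) \<union> set_mset (B - A) \<union> E"
    "verts X' = verts (A - B) \<or>
      (\<exists>v\<in>#u - w. \<exists>y\<in>#w - u. add_mset y (verts X') = add_mset v (verts (A - B)))"
    using exchange_below_max[OF balance _ m, of E] by blast
  have lt: "X' + C < A" using X'(1) by (subst AC) simp
  have sub: "set_mset (X' + C) \<subseteq> E" using X'(2) A(1) B(1) by (auto simp: C_def dest: in_diffD)
  from X'(3) show ?thesis
  proof (elim disjE bexE)
    assume "verts X' = verts (A - B)"
    then have "verts (X' + C) = w" using arg_cong[OF AC, of verts] A(2) by simp
    from std_factorization_le[OF sub this] lt show ?thesis by (simp add: A_def)
  next
    fix v y assume v: "v \<in># u - w" and y: "y \<in># w - u"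
      and eq: "add_mset y (verts X') = add_mset v (verts (A - B))"
    have cv: "count w v < count u v" and cy: "count u y < count w y"
      using v y by (simp_all add: in_diff_count)
    have "add_mset y (verts (X' + C)) = add_mset v w"
      using eq arg_cong[OF AC, of verts] A(2) by simp
    then have "verts (X' + C) = add_mset v w - {#y#}" by (metis add_mset_remove_trivial)
    also have "\<dots> = add_mset v (w - {#y#})"
      using cv cy by (metis diff_add_mset_swap not_less_iff_gr_or_eq count_single count_inI diff_union_swap2 add_mset_eq_singleton_iff less_asym set_mset_add_mset_insert in_diff_count insert_DiffM)
    finally have ver: "verts (X' + C) = add_mset v (w - {#y#})" .
    from sub ver[symmetric] have "add_mset v (w - {#y#}) \<in> products E" unfolding products_def by blast
    moreover have "std_factorization E (add_mset v (w - {#y#})) < std_factorization E w"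
      using std_factorization_le[OF sub ver] lt by (simp add: A_def)
    ultimately show ?thesis using cv cy by blast
  qed
qed

section \<open>Homology of a resolution of the residue field with monomial coefficients\<close>

text \<open>
  Membership of a vector in $P_p \otimes A$, where the monomial ideal \<open>A\<close> is given by its exponents.
\<close>

definition supp_in :: "'n expo set \<Rightarrow> (nat \<Rightarrow> ('n, 'k::zero) mpoly) \<Rightarrow> bool"
  where "supp_in A f \<longleftrightarrow> (\<forall>a. keys (f a) \<subseteq> A)"

definition smult :: "'r::times \<Rightarrow> (nat \<Rightarrow> 'r) \<Rightarrow> nat \<Rightarrow> 'r"
  where "smult c f = (\<lambda>a. c * f a)"

lemma smult_apply [simp]: "smult c f a = c * f a"
  by (simp add: smult_def)

lemma supp_in_UNIV [simp]: "supp_in UNIV f"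
  by (simp add: supp_in_def)

lemma supp_in_empty: "supp_in {} f \<longleftrightarrow> f = 0"
  by (auto simp: supp_in_def fun_eq_iff)

lemma supp_in_mono: "supp_in A f \<Longrightarrow> A \<subseteq> B \<Longrightarrow> supp_in B f"
  by (auto simp: supp_in_def)

lemma supp_in_add:
  assumes "supp_in A f" "supp_in A g" shows "supp_in A (f + g)"
  unfolding supp_in_def
proof
  fix a
  have "keys ((f + g) a) \<subseteq> keys (f a) \<union> keys (g a)"
    using keys_add[of "f a" "g a"] by simp
  also have "\<dots> \<subseteq> A" using assms by (simp add: supp_in_def)
  finally show "keys ((f + g) a) \<subseteq> A" .
qed

lemma supp_in_diff:
  fixes f g :: "nat \<Rightarrow> ('n, 'k::ab_group_add) mpoly"
  assumes "supp_in A f" "supp_in A g" shows "supp_in A (f - g)"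
  unfolding supp_in_def
proof
  fix a
  have "keys ((f - g) a) \<subseteq> keys (f a) \<union> keys (g a)"
    using keys_diff_subset[of "f a" "g a"] by simp
  also have "\<dots> \<subseteq> A" using assms by (simp add: supp_in_def)
  finally show "keys ((f - g) a) \<subseteq> A" .
qed

lemma supp_in_uminus: "supp_in A f \<Longrightarrow> supp_in A (- (f :: nat \<Rightarrow> ('n, 'k::ab_group_add) mpoly))"
  unfolding supp_in_def by (simp add: in_keys_iff subset_iff)

lemma supp_in_smult: "up_closed A \<Longrightarrow> supp_in A f \<Longrightarrow> supp_in A (smult c f)"
  unfolding supp_in_def smult_apply by (intro allI keys_mult_up_closed) auto

lemma supp_in_monom_smult: "supp_in (upset {w}) (smult (monom w) f)"
  unfolding supp_in_def smult_apply keys_monom_times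
  by (auto simp: add.commute[of _ w] intro: upsetI)

lemma supp_in_monom_cancel:
  assumes "\<And>u. u + w \<in> B \<Longrightarrow> u \<in> C" "supp_in B (smult (monom w) f)"
  shows "supp_in C f"
  using assms unfolding supp_in_def smult_apply keys_monom_times by blast

lemma supp_in_monom_lift:
  assumes "\<And>u. u \<in> C \<Longrightarrow> u + w \<in> B" "supp_in C f"
  shows "supp_in B (smult (monom w) f)"
  using assms unfolding supp_in_def smult_apply keys_monom_times by blast

lemma supp_in_split:
  fixes f :: "nat \<Rightarrow> ('n, 'k::ab_group_add) mpoly"
  obtains f1 f2 where "f = f1 + f2" "f1 = (\<lambda>a. keep A (f a))" "f2 = (\<lambda>a. keep (- A) (f a))"
    "supp_in A f1" "\<forall>B. supp_in B f \<longrightarrow> supp_in (B - A) f2"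
proof (rule that[OF _ refl refl])
  show "f = (\<lambda>a. keep A (f a)) + (\<lambda>a. keep (- A) (f a))"
    using keep_complement by (auto simp: fun_eq_iff)
qed (auto simp: supp_in_def keys_keep)

lemma smult_diff: "smult c (f - g) = smult c f - smult (c :: 'r::comm_ring_1) g"
  by (auto simp: fun_eq_iff algebra_simps)

lemma smult_zero [simp]: "smult c 0 = (0 :: nat \<Rightarrow> 'r::comm_ring_1)"
  by (simp add: fun_eq_iff)

lemma free_mod_add: "f \<in> free_mod n \<Longrightarrow> g \<in> free_mod n \<Longrightarrow> f + g \<in> free_mod n"
  for f g :: "nat \<Rightarrow> 'r::comm_ring_1"
  by (simp add: free_mod_def)

lemma free_mod_diff: "f \<in> free_mod n \<Longrightarrow> g \<in> free_mod n \<Longrightarrow> f - g \<in> free_mod n"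
  for f g :: "nat \<Rightarrow> 'r::comm_ring_1"
  by (simp add: free_mod_def)

lemma free_mod_smult: "f \<in> free_mod n \<Longrightarrow> smult c f \<in> free_mod n"
  for f :: "nat \<Rightarrow> 'r::comm_ring_1"
  by (simp add: free_mod_def)

lemma vector_monom_divides:
  assumes "supp_in (upset {w}) f" "f \<in> free_mod n"
  obtains h where "f = smult (monom w) h" "h \<in> free_mod n"
proof -
  have "\<forall>a. \<exists>h. f a = monom w * h" using assms(1) monom_divides unfolding supp_in_def by blast
  then obtain h where h: "\<And>a. f a = monom w * h a" by metis
  have "h a = 0" if "a \<ge> n" for a
  proof -
    have "keys (monom w * h a) = {}"
      using assms(2) that h[of a] by (simp add: free_mod_def)
    then show ?thesis by (simp add: keys_monom_times)
  qed
  then have "h \<in> free_mod n" by (simp add: free_mod_def)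
  moreover have "f = smult (monom w) h" using h by (auto simp: fun_eq_iff)
  ultimately show ?thesis using that by blast
qed

definition unit_vec :: "nat \<Rightarrow> nat \<Rightarrow> 'r::zero_neq_one"
  where "unit_vec b = (\<lambda>a. if a = b then 1 else 0)"

lemma unit_vec_free: "b < n \<Longrightarrow> unit_vec b \<in> free_mod n"
  by (simp add: unit_vec_def free_mod_def)

text \<open>
  The modules $P_p$ of the resolution consist of vectors over the polynomial ring. \<open>D\<close> is the
  differential, \<open>homog p j\<close> describes the elements of degree \<open>j\<close> of $P_p$, and \<open>hcomp p j\<close> takes the
  component of degree \<open>j\<close>.
\<close>

locale free_resolution =
  fixes r :: "nat \<Rightarrow> nat" and d :: "nat \<Rightarrow> nat \<Rightarrow> nat"
    and M :: "nat \<Rightarrow> nat \<Rightarrow> nat \<Rightarrow> ('n::finite, 'k::field) mpoly" and e :: "nat \<Rightarrow> 'k"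
  assumes graded_resolution: "graded_resolution r d M e"
begin

abbreviation D :: "nat \<Rightarrow> (nat \<Rightarrow> ('n, 'k) mpoly) \<Rightarrow> nat \<Rightarrow> ('n, 'k) mpoly"
  where "D \<equiv> differential r M"

definition homog :: "nat \<Rightarrow> nat \<Rightarrow> (nat \<Rightarrow> ('n, 'k) mpoly) \<Rightarrow> bool"
  where "homog p j f \<longleftrightarrow> f \<in> free_mod (r p) \<and> (\<forall>a. \<forall>u\<in>keys (f a). mdeg u + d p a = j)"

definition hcomp :: "nat \<Rightarrow> nat \<Rightarrow> (nat \<Rightarrow> ('n, 'k) mpoly) \<Rightarrow> nat \<Rightarrow> ('n, 'k) mpoly"
  where "hcomp p j f = (\<lambda>a. keep {u. mdeg u + d p a = j} (f a))"

lemma M_degree: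
  "a < r p \<Longrightarrow> b < r (Suc p) \<Longrightarrow> u \<in> keys (M p a b) \<Longrightarrow> mdeg u + d p a = d (Suc p) b"
  and e_degree: "a < r 0 \<Longrightarrow> e a \<noteq> 0 \<Longrightarrow> d 0 a = 0"
  and augmentation_surj: "\<exists>f :: nat \<Rightarrow> ('n, 'k) mpoly. f \<in> free_mod (r 0) \<and> augmentation r e f = c"
  and exact_0: "f \<in> free_mod (r 0) \<Longrightarrow> augmentation r e f = 0 \<longleftrightarrow> (\<exists>g\<in>free_mod (r 1). D 0 g = f)"
  and exact_Suc: "f \<in> free_mod (r (Suc p)) \<Longrightarrow>
    D p f = (\<lambda>_. 0) \<longleftrightarrow> (\<exists>g\<in>free_mod (r (Suc (Suc p))). D (Suc p) g = f)"
  using graded_resolution unfolding graded_resolution_def by blast+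

lemma D_free: "D p f \<in> free_mod (r p)"
  by (simp add: free_mod_def differential_def)

lemma D_add: "D p (f + g) = D p f + D p g"
  and D_diff: "D p (f - g) = D p f - D p g"
  and D_smult: "D p (smult c f) = smult c (D p f)"
  by (auto simp: differential_def fun_eq_iff algebra_simps sum.distrib sum_subtractf sum_distrib_left)

lemma D_zero: "D p 0 = 0"
  by (auto simp: differential_def fun_eq_iff)

lemma D_lincomb: "D p (\<lambda>a. \<Sum>b<n. c b * v b a) = (\<lambda>a. \<Sum>b<n. c b * D p (v b) a)"
proof
  fix a
  have "(\<Sum>x<r (Suc p). M p a x * (\<Sum>b<n. c b * v b x)) = (\<Sum>x<r (Suc p). \<Sum>b<n. c b * (M p a x * v b x))"
    by (simp add: sum_distrib_left ac_simps)
  also have "\<dots> = (\<Sum>b<n. c b * (\<Sum>x<r (Suc p). M p a x * v b x))"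
    by (subst sum.swap) (simp add: sum_distrib_left)
  finally show "D p (\<lambda>a. \<Sum>b<n. c b * v b a) a = (\<Sum>b<n. c b * D p (v b) a)"
    by (simp add: differential_def)
qed

lemma D_unit_expansion: "D p f = (\<lambda>a. \<Sum>b<r (Suc p). f b * D p (unit_vec b) a)"
proof
  fix a
  have "D p (unit_vec b) a = M p a b" if "a < r p" "b < r (Suc p)" for b
    using that by (simp add: differential_def unit_vec_def if_distrib cong: if_cong)
  then show "D p f a = (\<Sum>b<r (Suc p). f b * D p (unit_vec b) a)"
    by (cases "a < r p") (simp_all add: differential_def ac_simps)
qed

lemma D_D: "f \<in> free_mod (r (Suc (Suc p))) \<Longrightarrow> D p (D (Suc p) f) = 0"
  using exact_Suc[of "D (Suc p) f" p] D_free[of "Suc p" f]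
  by (auto simp: zero_fun_def)

lemma supp_in_D: "up_closed A \<Longrightarrow> supp_in A f \<Longrightarrow> supp_in A (D p f)"
  unfolding supp_in_def
proof (intro allI)
  fix a assume *: "up_closed A" "\<forall>a. keys (f a) \<subseteq> A"
  have "keys (\<Sum>b<r (Suc p). M p a b * f b) \<subseteq> A"
    using keys_sum[of "\<lambda>b. M p a b * f b" "{..<r (Suc p)}"] keys_mult_up_closed[OF *(1)] *(2) by blast
  then show "keys (D p f a) \<subseteq> A" by (simp add: differential_def)
qed

lemma homog_free: "homog p j f \<Longrightarrow> f \<in> free_mod (r p)"
  by (simp add: homog_def)

lemma homog_mono:
  assumes "homog p j f" "\<And>a. keys (g a) \<subseteq> keys (f a)"
  shows "homog p j g"
proof -
  have "g a = 0" if "a \<ge> r p" for a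
    using assms(1) assms(2)[of a] that by (simp add: homog_def free_mod_def)
  then show ?thesis using assms unfolding homog_def free_mod_def by blast
qed

lemma homog_keep: "homog p j f \<Longrightarrow> homog p j (\<lambda>a. keep A (f a))"
  by (erule homog_mono) (simp add: keys_keep)

lemma homog_add:
  assumes "homog p j f" "homog p j g" shows "homog p j (f + g)"
  unfolding homog_def
proof (intro conjI allI ballI)
  show "f + g \<in> free_mod (r p)" using assms by (simp add: homog_def free_mod_add)
  fix a u assume "u \<in> keys ((f + g) a)"
  then have "u \<in> keys (f a) \<union> keys (g a)"
    using keys_add[of "f a" "g a"] by auto
  then show "mdeg u + d p a = j" using assms by (auto simp: homog_def)
qed

lemma homog_diff:
  assumes "homog p j f" "homog p j g" shows "homog p j (f - g)"
  unfolding homog_def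
proof (intro conjI allI ballI)
  show "f - g \<in> free_mod (r p)" using assms by (simp add: homog_def free_mod_diff)
  fix a u assume "u \<in> keys ((f - g) a)"
  then have "u \<in> keys (f a) \<union> keys (g a)"
    using keys_diff_subset[of "f a" "g a"] by auto
  then show "mdeg u + d p a = j" using assms by (auto simp: homog_def)
qed

lemma homog_smult: "homog p j f \<Longrightarrow> homog p (j + mdeg w) (smult (monom w) f)"
  unfolding homog_def using free_mod_smult by (auto simp: keys_monom_times mdeg_add)

lemma homog_divide: "homog p (j + mdeg w) (smult (monom w) f) \<Longrightarrow> f \<in> free_mod (r p) \<Longrightarrow> homog p j f"
  unfolding homog_def by (auto simp: keys_monom_times mdeg_add)

lemma hcomp_homog: "f \<in> free_mod (r p) \<Longrightarrow> homog p j (hcomp p j f)"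
  by (auto simp: homog_def hcomp_def keys_keep free_mod_def)

lemma hcomp_id: "homog p j f \<Longrightarrow> hcomp p j f = f"
  by (auto simp: homog_def hcomp_def fun_eq_iff intro!: keep_id)

lemma hcomp_diff: "hcomp p j (f - g) = hcomp p j f - hcomp p j g"
  by (auto simp: hcomp_def fun_eq_iff keep_diff)

lemma supp_in_hcomp: "supp_in A f \<Longrightarrow> supp_in A (hcomp p j f)"
  by (auto simp: supp_in_def hcomp_def keys_keep)

text \<open>
  The entries of the differential are homogeneous, so it commutes with taking components.
\<close>

lemma hcomp_D: "hcomp p j (D p f) = D p (hcomp (Suc p) j f)"
proof
  fix a
  have *: "keep {u. mdeg u + d p a = j} (M p a b * f b) = M p a b * keep {u. mdeg u + d (Suc p) b = j} (f b)"
    if ab: "a < r p" "b < r (Suc p)" for b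
  proof -
    let ?K = "{u. mdeg u + d (Suc p) b = j}" and ?L = "{u. mdeg u + d p a = j}"
    have 1: "keys (M p a b * keep ?K (f b)) \<subseteq> ?L"
    proof
      fix u assume "u \<in> keys (M p a b * keep ?K (f b))"
      then obtain s t where "u = s + t" "s \<in> keys (M p a b)" "t \<in> ?K"
        using keys_mult[of "M p a b" "keep ?K (f b)"] by (auto simp: keys_keep)
      then show "u \<in> ?L" using M_degree[OF ab, of s] by (simp add: mdeg_add)
    qed
    have 2: "keys (M p a b * keep (- ?K) (f b)) \<inter> ?L = {}"
    proof -
      have "u \<notin> ?L" if u: "u \<in> keys (M p a b * keep (- ?K) (f b))" for u
      proof -
        obtain s t where "u = s + t" "s \<in> keys (M p a b)"
            "t \<in> keys (keep (- ?K) (f b))"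
          using u keys_mult[of "M p a b" "keep (- ?K) (f b)"] by blast
        moreover from this have "t \<in> - ?K" unfolding keys_keep by blast
        ultimately show ?thesis using M_degree[OF ab, of s] by (simp add: mdeg_add)
      qed
      then show ?thesis by blast
    qed
    have "M p a b * f b = M p a b * keep ?K (f b) + M p a b * keep (- ?K) (f b)"
      by (metis distrib_left keep_complement)
    then show ?thesis using keep_id[OF 1] keep_zero[OF 2] by (simp add: keep_add)
  qed
  show "hcomp p j (D p f) a = D p (hcomp (Suc p) j f) a"
    using * by (cases "a < r p") (simp_all add: hcomp_def differential_def keep_sum)
qed

lemma homog_D: "homog (Suc p) j f \<Longrightarrow> homog p j (D p f)"
  using hcomp_homog[OF D_free, of p j] by (metis hcomp_D hcomp_id)

text \<open>
  For $B \subseteq A$ this says that $\mathrm{Tor}_i(K, A/B)_j = 0$: each cycle of $P_i \otimes A/B$ of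
  degree \<open>j\<close> is a boundary. Elements of $P_i \otimes A/B$ are represented by vectors with entries in \<open>A\<close>.
\<close>

definition vanishing :: "'n expo set \<Rightarrow> 'n expo set \<Rightarrow> nat \<Rightarrow> nat \<Rightarrow> bool"
  where "vanishing A B i j \<longleftrightarrow>
    (\<forall>f. homog i j f \<longrightarrow> supp_in A f \<longrightarrow> (\<forall>p. i = Suc p \<longrightarrow> supp_in B (D p f)) \<longrightarrow>
      (\<exists>g. homog (Suc i) j g \<and> supp_in A g \<and> supp_in B (f - D i g)))"

lemma vanishingD:
  assumes "vanishing A B i j" "homog i j f" "supp_in A f" "\<And>p. i = Suc p \<Longrightarrow> supp_in B (D p f)"
  obtains g where "homog (Suc i) j g" "supp_in A g" "supp_in B (f - D i g)"
  using assms unfolding vanishing_def by metis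

text \<open>
  The preimage need not be homogeneous, since its component of degree \<open>j\<close> serves as well.
\<close>

lemma vanishingI:
  assumes "\<And>f. homog i j f \<Longrightarrow> supp_in A f \<Longrightarrow> (\<And>p. i = Suc p \<Longrightarrow> supp_in B (D p f)) \<Longrightarrow>
    \<exists>g. g \<in> free_mod (r (Suc i)) \<and> supp_in A g \<and> supp_in B (f - D i g)"
  shows "vanishing A B i j"
  unfolding vanishing_def
proof (intro allI impI)
  fix f assume f: "homog i j f" "supp_in A f" "\<forall>p. i = Suc p \<longrightarrow> supp_in B (D p f)"
  then obtain g where g: "g \<in> free_mod (r (Suc i))" "supp_in A g" "supp_in B (f - D i g)"
    using assms by blast
  have "f - D i (hcomp (Suc i) j g) = hcomp i j (f - D i g)"
    using f(1) by (simp add: hcomp_diff hcomp_D hcomp_id)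
  then show "\<exists>g. homog (Suc i) j g \<and> supp_in A g \<and> supp_in B (f - D i g)"
    using g by (intro exI[of _ "hcomp (Suc i) j g"]) (simp add: hcomp_homog supp_in_hcomp)
qed

lemma vanishing_ring_Suc: "vanishing UNIV {} (Suc i) j"
proof (rule vanishingI)
  fix f assume f: "homog (Suc i) j f" "\<And>p. Suc i = Suc p \<Longrightarrow> supp_in {} (D p f)"
  then have "D i f = 0" by (simp add: supp_in_empty)
  then obtain g where "g \<in> free_mod (r (Suc (Suc i)))" "D (Suc i) g = f"
    using exact_Suc[OF homog_free[OF f(1)]] by (auto simp: zero_fun_def)
  then show "\<exists>g. g \<in> free_mod (r (Suc (Suc i))) \<and> supp_in UNIV g \<and> supp_in {} (f - D (Suc i) g)"
    by (auto simp: supp_in_empty)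
qed

lemma vanishing_ring_0:
  assumes "j > 0" shows "vanishing UNIV {} 0 j"
proof (rule vanishingI)
  fix f assume f: "homog 0 j f"
  have "lookup (f a) 0 * e a = 0" if "a < r 0" for a
  proof (cases "e a = 0")
    case False
    then have "0 \<notin> keys (f a)"
      using f assms e_degree[OF that] by (metis add_0 homog_def mdeg_zero_iff nat_neq_iff)
    then show ?thesis by (simp add: in_keys_iff)
  qed simp
  then have "augmentation r e f = 0" unfolding augmentation_def by (intro sum.neutral) simp
  then obtain g where "g \<in> free_mod (r 1)" "D 0 g = f" using exact_0[OF homog_free[OF f]] by auto
  then show "\<exists>g. g \<in> free_mod (r (Suc 0)) \<and> supp_in UNIV g \<and> supp_in {} (f - D 0 g)"
    by (auto simp: supp_in_empty)
qed

section \<open>Exact sequences as diagram chases\<close>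

text \<open>
  The exact sequence $0 \to B \to A \to A/B \to 0$.
\<close>

lemma vanishing_trans:
  assumes "vanishing A B i j" "vanishing B {} i j" and sub: "B \<subseteq> A"
  shows "vanishing A {} i j"
proof (rule vanishingI)
  fix f assume f: "homog i j f" "supp_in A f" "\<And>p. i = Suc p \<Longrightarrow> supp_in {} (D p f)"
  have BA: "supp_in B (D p f)" if "i = Suc p" for p
    using f(3)[OF that] by (rule supp_in_mono) simp
  obtain g where g: "homog (Suc i) j g" "supp_in A g" "supp_in B (f - D i g)"
    using vanishingD[OF assms(1) f(1,2) BA] by blast
  have cyc: "supp_in {} (D p (f - D i g))" if "i = Suc p" for p
    using f(3)[OF that] D_D[of g p] homog_free[OF g(1)] that by (simp add: D_diff supp_in_empty)
  obtain h where h: "homog (Suc i) j h" "supp_in B h" "supp_in {} (f - D i g - D i h)"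
    using vanishingD[OF assms(2) homog_diff[OF f(1) homog_D[OF g(1)]] g(3) cyc] by blast
  have eq: "f - D i (g + h) = f - D i g - D i h" by (simp add: D_add)
  show "\<exists>g. g \<in> free_mod (r (Suc i)) \<and> supp_in A g \<and> supp_in {} (f - D i g)"
    using h(3) supp_in_add[OF g(2) supp_in_mono[OF h(2) sub]] homog_free[OF homog_add[OF g(1) h(1)]]
    by (intro exI[of _ "g + h"]) (simp add: eq)
qed

text \<open>
  The monomial $x^w$ is a nonzerodivisor modulo \<open>B\<close>, and the claim follows from the exact sequence
  $0 \to S/B(-\deg w) \to S/B \to S/(B + (x^w)) \to 0$: a cycle modulo $B + (x^w)$ has boundary
  $x^w h + b$ with a cycle \<open>h\<close> modulo \<open>B\<close>, and subtracting a multiple of $x^w$ makes it a cycle modulo \<open>B\<close>.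
\<close>

lemma vanishing_quotient:
  assumes B: "up_closed B" and nzd: "\<And>u. u + w \<in> B \<Longrightarrow> u \<in> B"
    and van: "vanishing UNIV B i j"
    and van': "\<And>i' j'. i = Suc i' \<Longrightarrow> j = j' + mdeg w \<Longrightarrow> vanishing UNIV B i' j'"
  shows "vanishing UNIV (B \<union> upset {w}) i j"
proof (rule vanishingI)
  fix f assume f: "homog i j f" "\<And>p. i = Suc p \<Longrightarrow> supp_in (B \<union> upset {w}) (D p f)"
  have "\<exists>g. homog i j (smult (monom w) g) \<and> (\<forall>p. i = Suc p \<longrightarrow> supp_in B (D p (f - smult (monom w) g)))"
  proof (cases i)
    case 0
    then show ?thesis
      by (intro exI[of _ 0]) (simp add: homog_def free_mod_def)
  next
    case (Suc i')
    obtain b c where bc: "D i' f = b + c" "b = (\<lambda>a. keep B (D i' f a))" "c = (\<lambda>a. keep (- B) (D i' f a))"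
      "supp_in B b" "\<forall>C. supp_in C (D i' f) \<longrightarrow> supp_in (C - B) c"
      by (rule supp_in_split[of "D i' f" B])
    have c: "supp_in (upset {w}) c"
      using bc(5)[rule_format, OF f(2)[OF Suc]] by (rule supp_in_mono) blast
    have hc: "homog i' j c" unfolding bc(3) using homog_D f(1) Suc by (blast intro: homog_keep)
    show ?thesis
    proof (cases "j < mdeg w")
      case True
      have "c = 0"
      proof
        fix a
        have "u \<notin> keys (c a)" for u
        proof
          assume u: "u \<in> keys (c a)"
          then have "u \<in> upset {w}" using c by (auto simp: supp_in_def)
          then have "mdeg u \<ge> mdeg w" by (auto elim!: upsetE simp: mdeg_add)
          moreover have "mdeg u + d i' a = j" using hc u by (auto simp: homog_def)
          ultimately show False using True by simp
        qed
        then have "keys (c a) = {}" by blast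
        then show "c a = 0 a" by simp
      qed
      then have "D i' f = b" using bc(1) by simp
      then show ?thesis using bc(4) Suc
        by (intro exI[of _ 0]) (simp add: homog_def free_mod_def)
    next
      case False
      then obtain j' where j: "j = j' + mdeg w" by (metis le_add_diff_inverse2 not_less)
      obtain h where h: "c = smult (monom w) h" "h \<in> free_mod (r i')"
        using vector_monom_divides[OF c homog_free[OF hc]] by blast
      have hh: "homog i' j' h" using homog_divide[of i' j' w h] hc h j by simp
      have cyc: "supp_in B (D p h)" if "i' = Suc p" for p
      proof (rule supp_in_monom_cancel[OF nzd])
        have "D p (D i' f) = 0" using D_D[of f p] homog_free[OF f(1)] Suc that by simp
        then have "D p c = - D p b" unfolding bc(1) D_add by (simp add: add_eq_0_iff)
        moreover have "supp_in B (- D p b)" using supp_in_uminus supp_in_D[OF B bc(4)] by blast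
        ultimately show "supp_in B (smult (monom w) (D p h))" by (simp add: h D_smult)
      qed
      obtain g where g: "homog (Suc i') j' g" "supp_in B (h - D i' g)"
        using vanishingD[OF van'[OF Suc j] hh _ cyc] by auto
      have "D i' (f - smult (monom w) g) = b + smult (monom w) (h - D i' g)"
        unfolding D_diff bc(1) h(1) D_smult smult_diff by simp
      then have "supp_in B (D i' (f - smult (monom w) g))"
        using supp_in_add[OF bc(4) supp_in_smult[OF B g(2)]] by simp
      moreover have "homog i j (smult (monom w) g)" using homog_smult[OF g(1), of w] Suc j by simp
      ultimately show ?thesis using Suc by (intro exI[of _ g]) simp
    qed
  qed
  then obtain g where g: "homog i j (smult (monom w) g)"
    "\<And>p. i = Suc p \<Longrightarrow> supp_in B (D p (f - smult (monom w) g))" by blast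
  obtain k where k: "homog (Suc i) j k" "supp_in B (f - smult (monom w) g - D i k)"
    using vanishingD[OF van homog_diff[OF f(1) g(1)] _ g(2)] by auto
  have "f - D i k = (f - smult (monom w) g - D i k) + smult (monom w) g" by simp
  moreover have "supp_in (B \<union> upset {w}) \<dots>"
    by (rule supp_in_add[OF supp_in_mono[OF k(2)] supp_in_mono[OF supp_in_monom_smult]]) auto
  ultimately show "\<exists>k. k \<in> free_mod (r (Suc i)) \<and> supp_in UNIV k \<and> supp_in (B \<union> upset {w}) (f - D i k)"
    using homog_free[OF k(1)] by (intro exI[of _ k]) simp
qed

text \<open>
  The quotient $(A + (x^w))/A$ is a shifted copy of $S/(A : x^w)$.
\<close>

lemma vanishing_adjoin_generator:
  assumes A: "up_closed A" and van: "vanishing UNIV {u. u + w \<in> A} i j"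
  shows "vanishing (A \<union> upset {w}) A i (j + mdeg w)"
proof (rule vanishingI)
  let ?j = "j + mdeg w"
  fix f assume f: "homog i ?j f" "supp_in (A \<union> upset {w}) f" "\<And>p. i = Suc p \<Longrightarrow> supp_in A (D p f)"
  obtain b c where bc: "f = b + c" "b = (\<lambda>a. keep A (f a))" "c = (\<lambda>a. keep (- A) (f a))"
      "supp_in A b" "\<forall>C. supp_in C f \<longrightarrow> supp_in (C - A) c"
    by (rule supp_in_split[of f A])
  have c: "supp_in (upset {w}) c" using bc(5)[rule_format, OF f(2)] by (rule supp_in_mono) blast
  have hc: "homog i ?j c" unfolding bc(3) using f(1) by (rule homog_keep)
  obtain h where h: "c = smult (monom w) h" "h \<in> free_mod (r i)"
    using vector_monom_divides[OF c homog_free[OF hc]] by blast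
  have hh: "homog i j h" using homog_divide[of i j w h] hc h by simp
  have cyc: "supp_in {u. u + w \<in> A} (D p h)" if "i = Suc p" for p
  proof (rule supp_in_monom_cancel)
    have "smult (monom w) (D p h) = D p f - D p b" unfolding bc(1) h(1) D_add D_smult by simp
    then show "supp_in A (smult (monom w) (D p h))"
      using supp_in_diff[OF f(3)[OF that] supp_in_D[OF A bc(4)]] by simp
  qed simp
  obtain g where g: "homog (Suc i) j g" "supp_in {u. u + w \<in> A} (h - D i g)"
    using vanishingD[OF van hh _ cyc] by auto
  have "f - D i (smult (monom w) g) = b + smult (monom w) (h - D i g)"
    unfolding bc(1) h(1) D_smult smult_diff by simp
  moreover have "supp_in A (smult (monom w) (h - D i g))"
    using g(2) by (rule supp_in_monom_lift[rotated]) simp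
  ultimately have "supp_in A (f - D i (smult (monom w) g))" using supp_in_add[OF bc(4)] by simp
  moreover have "supp_in (A \<union> upset {w}) (smult (monom w) g)"
    using supp_in_monom_smult by (rule supp_in_mono) simp
  ultimately show "\<exists>g. g \<in> free_mod (r (Suc i)) \<and> supp_in (A \<union> upset {w}) g \<and> supp_in A (f - D i g)"
    using free_mod_smult[OF homog_free[OF g(1)]] by blast
qed

text \<open>
  The Mayer-Vietoris sequence of $0 \to S/(J_1 \cap J_2) \to S/J_1 \oplus S/J_2 \to S/(J_1 + J_2) \to 0$.
\<close>

lemma vanishing_Int:
  assumes J: "up_closed J1" "up_closed J2"
    and van: "vanishing UNIV J1 q j" "vanishing UNIV J2 q j" "vanishing UNIV (J1 \<union> J2) (Suc q) j"
  shows "vanishing UNIV (J1 \<inter> J2) q j"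
proof (rule vanishingI)
  fix f assume f: "homog q j f" "\<And>p. q = Suc p \<Longrightarrow> supp_in (J1 \<inter> J2) (D p f)"
  have f1: "supp_in J1 (D p f)" and f2: "supp_in J2 (D p f)" if "q = Suc p" for p
    using f(2)[OF that] by (auto elim: supp_in_mono)
  obtain g1 where g1: "homog (Suc q) j g1" "supp_in J1 (f - D q g1)"
    using vanishingD[OF van(1) f(1) _ f1] by auto
  obtain g2 where g2: "homog (Suc q) j g2" "supp_in J2 (f - D q g2)"
    using vanishingD[OF van(2) f(1) _ f2] by auto
  have "supp_in (J1 \<union> J2) (D p (g1 - g2))" if "Suc q = Suc p" for p
  proof -
    have "D q (g1 - g2) = (f - D q g2) - (f - D q g1)" unfolding D_diff by simp
    moreover have "supp_in (J1 \<union> J2) \<dots>"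
      by (rule supp_in_diff[OF supp_in_mono[OF g2(2)] supp_in_mono[OF g1(2)]]) auto
    ultimately show ?thesis using that by simp
  qed
  then obtain l where l: "homog (Suc (Suc q)) j l" "supp_in (J1 \<union> J2) (g1 - g2 - D (Suc q) l)"
    using vanishingD[OF van(3) homog_diff[OF g1(1) g2(1)]] by auto
  obtain b c where bc: "g1 - g2 - D (Suc q) l = b + c" "b = (\<lambda>a. keep J1 ((g1 - g2 - D (Suc q) l) a))"
      "c = (\<lambda>a. keep (- J1) ((g1 - g2 - D (Suc q) l) a))"
      "supp_in J1 b" "\<forall>C. supp_in C (g1 - g2 - D (Suc q) l) \<longrightarrow> supp_in (C - J1) c"
    by (rule supp_in_split[of "g1 - g2 - D (Suc q) l" J1])
  have c: "supp_in J2 c" using bc(5)[rule_format, OF l(2)] by (rule supp_in_mono) blast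
  have hb: "homog (Suc q) j b" unfolding bc(2)
    by (rule homog_keep) (rule homog_diff[OF homog_diff[OF g1(1) g2(1)] homog_D[OF l(1)]])
  have eq1: "f - D q (g1 - b) = (f - D q g1) + D q b" unfolding D_diff by simp
  have 1: "supp_in J1 (f - D q (g1 - b))"
    unfolding eq1 by (rule supp_in_add[OF g1(2) supp_in_D[OF J(1) bc(4)]])
  have "g1 - b = g2 + D (Suc q) l + c"
  proof -
    have "g1 - b = g2 + D (Suc q) l + (g1 - g2 - D (Suc q) l - b)" by simp
    also have "g1 - g2 - D (Suc q) l - b = c" unfolding bc(1) by simp
    finally show ?thesis .
  qed
  then have "D q (g1 - b) = D q g2 + D q c"
    using D_D[OF homog_free[OF l(1)]] by (simp add: D_add)
  then have eq2: "f - D q (g1 - b) = (f - D q g2) - D q c" by simp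
  have 2: "supp_in J2 (f - D q (g1 - b))"
    unfolding eq2 by (rule supp_in_diff[OF g2(2) supp_in_D[OF J(2) c]])
  show "\<exists>g. g \<in> free_mod (r (Suc q)) \<and> supp_in UNIV g \<and> supp_in (J1 \<inter> J2) (f - D q g)"
    using 1 2 homog_free[OF homog_diff[OF g1(1) hb]] by (intro exI[of _ "g1 - b"]) (simp add: supp_in_def)
qed

text \<open>
  The connecting maps of Mayer-Vietoris type send a cycle modulo $I_1 + I_2$ to one of
  $P \otimes (I_1 \cap I_2)$. If its image is a boundary, the cycle is the sum of a cycle modulo $I_1$ and
  one modulo $I_2$. These are boundaries modulo the larger ideals $T_1$ and $T_2$, whose sum is
  still contained in $I_1 + I_2$.
\<close>

lemma vanishing_Un:
  assumes up: "up_closed I1" "up_closed I2"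
    and sub: "I1 \<subseteq> T1" "I2 \<subseteq> T2" "T1 \<union> T2 \<subseteq> I1 \<union> I2"
    and van: "vanishing (I1 \<inter> I2) {} i j" "vanishing UNIV T1 (Suc (Suc i)) j" "vanishing UNIV T2 (Suc (Suc i)) j"
  shows "vanishing UNIV (I1 \<union> I2) (Suc (Suc i)) j"
proof (rule vanishingI)
  fix f assume f: "homog (Suc (Suc i)) j f" "\<And>p. Suc (Suc i) = Suc p \<Longrightarrow> supp_in (I1 \<union> I2) (D p f)"
  obtain b c where bc: "D (Suc i) f = b + c" "b = (\<lambda>a. keep I1 (D (Suc i) f a))"
      "c = (\<lambda>a. keep (- I1) (D (Suc i) f a))"
      "supp_in I1 b" "\<forall>C. supp_in C (D (Suc i) f) \<longrightarrow> supp_in (C - I1) c"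
    by (rule supp_in_split[of "D (Suc i) f" I1])
  have c: "supp_in I2 c" using bc(5)[rule_format, OF f(2)[OF refl]] by (rule supp_in_mono) blast
  have hb: "homog (Suc i) j b" unfolding bc(2) by (rule homog_keep[OF homog_D[OF f(1)]])
  have "D i (D (Suc i) f) = 0" using D_D[OF homog_free[OF f(1)]] .
  then have Db: "D i b = - D i c" unfolding bc(1) D_add by (simp add: eq_neg_iff_add_eq_0)
  have "supp_in I1 (D i b)" by (rule supp_in_D[OF up(1) bc(4)])
  moreover have "supp_in I2 (D i b)"
    unfolding Db by (rule supp_in_uminus[OF supp_in_D[OF up(2) c]])
  ultimately have "supp_in (I1 \<inter> I2) (D i b)" by (simp add: supp_in_def)
  moreover have "supp_in {} (D p (D i b))" if "i = Suc p" for p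
    using D_D[of b p] homog_free[OF hb] that by (simp add: supp_in_empty)
  ultimately obtain h where h: "homog (Suc i) j h" "supp_in (I1 \<inter> I2) h" "supp_in {} (D i b - D i h)"
    using vanishingD[OF van(1) homog_D[OF hb]] by blast
  have "supp_in {} (D p (b - h))" if "Suc i = Suc p" for p
    using h(3) that by (simp add: D_diff)
  then obtain f1 where f1: "homog (Suc (Suc i)) j f1" "supp_in {} (b - h - D (Suc i) f1)"
    using vanishingD[OF vanishing_ring_Suc homog_diff[OF hb h(1)]] by auto
  have Df1: "D (Suc i) f1 = b - h" using f1(2) by (simp add: supp_in_empty)
  have h1: "supp_in I1 h" and h2: "supp_in I2 h" using h(2) by (auto elim: supp_in_mono)
  have "supp_in T1 (D p f1)" if "Suc (Suc i) = Suc p" for p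
    using supp_in_mono[OF supp_in_diff[OF bc(4) h1] sub(1)] Df1 that by simp
  then obtain g1 where g1: "homog (Suc (Suc (Suc i))) j g1" "supp_in T1 (f1 - D (Suc (Suc i)) g1)"
    using vanishingD[OF van(2) f1(1)] by auto
  have "D (Suc i) (f - f1) = c + h" unfolding D_diff Df1 bc(1) by simp
  then have "supp_in T2 (D p (f - f1))" if "Suc (Suc i) = Suc p" for p
    using supp_in_mono[OF supp_in_add[OF c h2] sub(2)] that by simp
  then obtain g2 where g2: "homog (Suc (Suc (Suc i))) j g2" "supp_in T2 (f - f1 - D (Suc (Suc i)) g2)"
    using vanishingD[OF van(3) homog_diff[OF f(1) f1(1)]] by auto
  have eq: "f - D (Suc (Suc i)) (g1 + g2) = (f1 - D (Suc (Suc i)) g1) + (f - f1 - D (Suc (Suc i)) g2)"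
    by (simp add: D_add)
  have "supp_in (I1 \<union> I2) (f - D (Suc (Suc i)) (g1 + g2))"
    unfolding eq using sub(3) by (intro supp_in_add supp_in_mono[OF g1(2)] supp_in_mono[OF g2(2)]) auto
  then show "\<exists>g. g \<in> free_mod (r (Suc (Suc (Suc i)))) \<and> supp_in UNIV g \<and>
      supp_in (I1 \<union> I2) (f - D (Suc (Suc i)) g)"
    using homog_free[OF homog_add[OF g1(1) g2(1)]] by (intro exI[of _ "g1 + g2"]) simp
qed

section \<open>Ideals with linear quotients\<close>

text \<open>
  The quotient by an ideal of variables is resolved by a Koszul complex, which is linear. In terms of
  exact sequences, the variables are adjoined one at a time.
\<close>

lemma vanishing_variables:
  assumes "i < j" shows "vanishing UNIV (upset (var_exp ` X)) i j"
proof -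
  have "finite X" by simp
  then have "\<forall>i j. i < j \<longrightarrow> vanishing UNIV (upset (var_exp ` X)) i j"
  proof (induction X rule: finite_induct)
    case empty
    have "vanishing UNIV {} i j" if "i < j" for i j
      using that by (cases i) (simp_all add: vanishing_ring_0 vanishing_ring_Suc)
    then show ?case by simp
  next
    case (insert x X)
    show ?case unfolding upset_insert_var
    proof (intro allI impI vanishing_quotient)
      show "u \<in> upset (var_exp ` X)" if "u + var_exp x \<in> upset (var_exp ` X)" for u
        using upset_vars_nonzerodivisor[OF insert.hyps(2) that] .
    qed (use insert.IH in auto)
  qed
  then show ?thesis using assms by blast
qed

text \<open>
  Adjoining a regular variable raises the projective dimension by at most one.
\<close>

lemma vanishing_adjoin_variables:
  assumes B: "up_closed B" "\<And>x u. x \<in> X \<Longrightarrow> u + var_exp x \<in> B \<Longrightarrow> u \<in> B"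
    and van: "\<And>i j. n < i \<Longrightarrow> vanishing UNIV B i j" and i: "n + card X < i"
  shows "vanishing UNIV (B \<union> upset (var_exp ` X)) i j"
proof -
  have "finite X" by simp
  then have "\<forall>i j. n + card X < i \<longrightarrow> vanishing UNIV (B \<union> upset (var_exp ` X)) i j"
    using B(2)
  proof (induction X rule: finite_induct)
    case empty
    then show ?case using van by simp
  next
    case (insert x X)
    have IH: "vanishing UNIV (B \<union> upset (var_exp ` X)) i j" if "n + card X < i" for i j
      using insert.IH insert.prems that by blast
    show ?case unfolding upset_insert_var Un_assoc[symmetric]
    proof (intro allI impI vanishing_quotient)
      show "u \<in> B \<union> upset (var_exp ` X)" if "u + var_exp x \<in> B \<union> upset (var_exp ` X)" for u
        using that upset_vars_nonzerodivisor[OF insert.hyps(2)] insert.prems by blast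
      show "up_closed (B \<union> upset (var_exp ` X))" using B(1) up_closed_upset by (rule up_closed_Un)
    qed (use IH insert.hyps in auto)
  qed
  then show ?thesis using i by blast
qed

text \<open>
  Each step of the filtration of the ideal by its first generators is a copy of a quotient of the ring
  by variables, shifted by \<open>t\<close>.
\<close>

lemma vanishing_linear_quotients:
  assumes deg: "\<And>u. u \<in> set us \<Longrightarrow> mdeg u = t"
    and lin: "\<And>m. m < length us \<Longrightarrow> \<exists>V. {u. u + us ! m \<in> upset (set (take m us))} = upset (var_exp ` V)"
    and ij: "i + t < j"
  shows "vanishing (upset (set us)) {} i j"
  using deg lin
proof (induction us rule: rev_induct)
  case Nil
  show ?case by (rule vanishingI) (auto simp: supp_in_empty D_zero free_mod_def intro!: exI[of _ 0])
next
  case (snoc w us)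
  have IH: "vanishing (upset (set us)) {} i j"
  proof (rule snoc.IH)
    show "mdeg u = t" if "u \<in> set us" for u using snoc.prems(1) that by simp
    show "\<exists>V. {u. u + us ! m \<in> upset (set (take m us))} = upset (var_exp ` V)" if "m < length us" for m
      using snoc.prems(2)[of m] that by (simp add: nth_append)
  qed
  obtain V where V: "{u. u + w \<in> upset (set us)} = upset (var_exp ` V)"
    using snoc.prems(2)[of "length us"] by auto
  have w: "mdeg w = t" using snoc.prems(1) by simp
  have j: "j = (j - t) + mdeg w" and lt: "i < j - t" using ij w by auto
  have "vanishing (upset (set us) \<union> upset {w}) (upset (set us)) i (j - t + mdeg w)"
    by (rule vanishing_adjoin_generator) (simp_all add: V vanishing_variables lt)
  then have "vanishing (upset (set us) \<union> upset {w}) {} i j"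
    unfolding j[symmetric] by (rule vanishing_trans[OF _ IH]) simp
  then show ?case using upset_insert[of w "set us"] by simp
qed

text \<open>
  Take a generator of least degree times a basis element \<open>a\<close> of $P_0$ with \<open>e a\<close> nonzero. The functional
  that applies the augmentation to the coefficients of this generator is nonzero on it. It vanishes on
  boundaries: for degree reasons only basis elements of $P_1$ of degree 0 contribute, and their
  boundaries have constant entries and lie in the kernel of the augmentation.
\<close>

lemma not_vanishing_generators:
  assumes U: "u0 \<in> U" "\<And>u. u \<in> U \<Longrightarrow> mdeg u = t"
  shows "\<not> vanishing (upset U) {} 0 t"
proof
  assume van: "vanishing (upset U) {} 0 t"
  obtain f :: "nat \<Rightarrow> ('n, 'k) mpoly" where "augmentation r e f = 1" using augmentation_surj by blast
  then obtain a where a: "a < r 0" "e a \<noteq> 0"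
    unfolding augmentation_def by (metis (no_types, lifting) lessThan_iff mult_zero_right sum.neutral zero_neq_one)
  define f :: "nat \<Rightarrow> ('n, 'k) mpoly" where "f = smult (monom u0) (unit_vec a)"
  have "homog 0 0 (unit_vec a)"
    using e_degree[OF a] unit_vec_free[OF a(1), where 'a = "('n, 'k) mpoly"]
    by (auto simp: homog_def unit_vec_def)
  from homog_smult[OF this, of u0] have hom: "homog 0 t f" using U by (simp add: f_def)
  have "supp_in (upset U) f"
    unfolding f_def by (rule supp_in_mono[OF supp_in_monom_smult]) (rule upset_mono, use U in auto)
  then obtain g where g: "homog (Suc 0) t g" "supp_in (upset U) g" "supp_in {} (f - D 0 g)"
    using vanishingD[OF van hom] by blast
  then have fg: "f = D 0 g" by (simp add: supp_in_empty)
  have zero: "(\<Sum>a<r 0. e a * lookup (M 0 a b * g b) u0) = 0" if b: "b < r (Suc 0)" for b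
  proof (cases "g b = 0")
    case False
    then obtain u where u: "u \<in> keys (g b)" by (meson ex_in_conv keys_eq_empty)
    then have "u \<in> upset U" using g(2) by (auto simp: supp_in_def)
    then have "mdeg u \<ge> t" by (auto elim!: upsetE simp: mdeg_add U(2))
    moreover have "mdeg u + d (Suc 0) b = t" using g(1) u by (auto simp: homog_def)
    ultimately have db: "d (Suc 0) b = 0" by simp
    define c where "c a = lookup (M 0 a b) 0" for a
    have M: "M 0 a b = single 0 (c a)" if "a < r 0" for a
    proof -
      have "u = 0" if "u \<in> keys (M 0 a b)" for u
        using M_degree[OF \<open>a < r 0\<close> b that] db by simp
      then have "lookup (M 0 a b) v = lookup (single 0 (c a)) v" for v
        by (cases "v = 0") (auto simp: c_def lookup_single when_def in_keys_iff)
      then show ?thesis by (rule poly_mapping_eqI)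
    qed
    have "D 0 (unit_vec b) a = M 0 a b" if "a < r 0" for a
      using that b by (simp add: differential_def unit_vec_def if_distrib cong: if_cong)
    moreover have "augmentation r e (D 0 (unit_vec b)) = 0"
      using exact_0[OF D_free] unit_vec_free[OF b] by auto
    ultimately have "(\<Sum>a<r 0. c a * e a) = 0" by (simp add: augmentation_def c_def)
    moreover have "lookup (single 0 x * h) u0 = x * lookup h u0"
      for x :: 'k and h :: "('n, 'k) mpoly"
      by (simp add: mult_map_scale_conv_mult[symmetric] Poly_Mapping.map.rep_eq when_def)
    then have "(\<Sum>a<r 0. e a * lookup (M 0 a b * g b) u0)
        = (\<Sum>a<r 0. c a * e a) * lookup (g b) u0"
      by (simp only: sum_distrib_right) (intro sum.cong, auto simp: M)
    ultimately show ?thesis by simp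
  qed simp
  have "e a = (\<Sum>a'<r 0. e a' * lookup (f a') u0)"
  proof -
    have "(\<Sum>a'<r 0. e a' * lookup (f a') u0) = (\<Sum>a'<r 0. if a' = a then e a else 0)"
      by (intro sum.cong) (auto simp: f_def unit_vec_def monom_def)
    then show ?thesis using a(1) by simp
  qed
  also have "\<dots> = (\<Sum>a'<r 0. \<Sum>b<r (Suc 0). e a' * lookup (M 0 a' b * g b) u0)"
    unfolding fg by (intro sum.cong) (simp_all add: differential_def lookup_sum sum_distrib_left)
  also have "\<dots> = (\<Sum>b<r (Suc 0). \<Sum>a'<r 0. e a' * lookup (M 0 a' b * g b) u0)"
    by (rule sum.swap)
  also have "\<dots> = 0" using zero by (intro sum.neutral) simp
  finally show False using a(2) by simp
qed

lemma not_vanishing_ring: "\<not> vanishing UNIV {} 0 0"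
  using not_vanishing_generators[of 0 "{0}" 0] by (simp add: upset_singleton_zero)

section \<open>Multiplication by a monomial is zero on Tor\<close>

text \<open>
  The linear map $P_p \to P_{p+1}$ whose value at the basis element \<open>b\<close> is \<open>N b\<close>.
\<close>

definition comb :: "nat \<Rightarrow> (nat \<Rightarrow> nat \<Rightarrow> ('n, 'k) mpoly) \<Rightarrow> (nat \<Rightarrow> ('n, 'k) mpoly) \<Rightarrow> nat \<Rightarrow> ('n, 'k) mpoly"
  where "comb p N f = (\<lambda>a. \<Sum>b<r p. f b * N b a)"

lemma comb_free:
  assumes "\<And>b. b < r p \<Longrightarrow> N b \<in> free_mod n" shows "comb p N f \<in> free_mod n"
  unfolding free_mod_def comb_def
proof (intro CollectI allI impI sum.neutral ballI)
  fix a b assume "n \<le> a" "b \<in> {..<r p}"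
  then show "f b * N b a = 0" using assms[of b] by (simp add: free_mod_def)
qed

lemma comb_lincomb: "comb p N (\<lambda>a. \<Sum>b<n. c b * v b a) = (\<lambda>a. \<Sum>b<n. c b * comb p N (v b) a)"
proof
  fix a
  have "(\<Sum>x<r p. (\<Sum>b<n. c b * v b x) * N x a) = (\<Sum>x<r p. \<Sum>b<n. c b * (v b x * N x a))"
    by (simp only: sum_distrib_right mult.assoc)
  also have "\<dots> = (\<Sum>b<n. c b * (\<Sum>x<r p. v b x * N x a))"
    by (subst sum.swap) (simp add: sum_distrib_left)
  finally show "comb p N (\<lambda>a. \<Sum>b<n. c b * v b a) a = (\<Sum>b<n. c b * comb p N (v b) a)"
    by (simp add: comb_def)
qed

lemma supp_in_comb:
  assumes "up_closed A" "supp_in A f" shows "supp_in A (comb p N f)"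
  unfolding supp_in_def
proof
  fix a
  have "keys (\<Sum>b<r p. f b * N b a) \<subseteq> (\<Union>b\<in>{..<r p}. keys (f b * N b a))"
    by (rule keys_sum)
  also have "\<dots> \<subseteq> A"
  proof (rule UN_least)
    fix b
    have "keys (N b a * f b) \<subseteq> A"
      using assms by (intro keys_mult_up_closed) (auto simp: supp_in_def)
    then show "keys (f b * N b a) \<subseteq> A" by (simp add: mult.commute)
  qed
  finally show "keys (comb p N f a) \<subseteq> A" by (simp add: comb_def)
qed

lemma unit_expansion: "f \<in> free_mod n \<Longrightarrow> (\<lambda>a. \<Sum>b<n. f b * unit_vec b a) = (f :: nat \<Rightarrow> ('n, 'k) mpoly)"
  by (auto simp: fun_eq_iff unit_vec_def free_mod_def if_distrib cong: if_cong)

text \<open>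
  Multiplication by $x^w$ is zero on the residue field, hence null-homotopic on its resolution. The
  homotopy is chosen on basis elements one degree after the other: the vector
  $x^w b - N_p(D b)$ is a cycle by the homotopy identity in the previous degree.
\<close>

lemma null_homotopy:
  assumes w: "w \<noteq> 0"
  shows "\<exists>N. \<forall>p. (\<forall>b<r p. N p b \<in> free_mod (r (Suc p))) \<and>
    (\<forall>f\<in>free_mod (r 0). D 0 (comb 0 (N 0) f) = smult (monom w) f) \<and>
    (\<forall>f\<in>free_mod (r (Suc p)). D (Suc p) (comb (Suc p) (N (Suc p)) f) + comb p (N p) (D p f)
        = smult (monom w) f)"
proof -
  (* P is the homotopy identity in degree p for cycles, which suffices to construct the next map; Q is
     the full identity in degree p + 1. *)
  define P where "P p N \<longleftrightarrow> (\<forall>b<r p. N b \<in> free_mod (r (Suc p))) \<and>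
    (\<forall>f\<in>free_mod (r p). (\<forall>q. p = Suc q \<longrightarrow> D q f = 0) \<longrightarrow> D p (comb p N f) = smult (monom w) f)" for p N
  define Q where "Q p N N' \<longleftrightarrow> (\<forall>f\<in>free_mod (r (Suc p)).
    D (Suc p) (comb (Suc p) N' f) + comb p N (D p f) = smult (monom w) f)" for p N N'
  have "\<exists>N. P 0 N"
  proof -
    have "\<exists>g\<in>free_mod (r 1). D 0 g = smult (monom w) (unit_vec b)" if b: "b < r 0" for b
    proof -
      have "lookup (monom w * h) 0 = 0" for h :: "('n, 'k) mpoly"
      proof -
        have "0 \<notin> keys (monom w * h)"
        proof
          assume "0 \<in> keys (monom w * h)"
          then obtain u where "0 = u + w" unfolding keys_monom_times by blast
          from arg_cong[OF this, of mdeg] show False using w by (simp add: mdeg_add)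
        qed
        then show ?thesis by (simp add: in_keys_iff)
      qed
      then have "augmentation r e (smult (monom w) (unit_vec b)) = 0" by (simp add: augmentation_def)
      then show ?thesis using exact_0[OF free_mod_smult[OF unit_vec_free[OF b]]] by blast
    qed
    then obtain N where N: "\<And>b. b < r 0 \<Longrightarrow> N b \<in> free_mod (r 1) \<and> D 0 (N b) = smult (monom w) (unit_vec b)"
      by metis
    have "D 0 (comb 0 N f) = smult (monom w) f" if f: "f \<in> free_mod (r 0)" for f
    proof -
      have "D 0 (comb 0 N f) = (\<lambda>a. \<Sum>b<r 0. f b * D 0 (N b) a)" unfolding comb_def D_lincomb ..
      also have "\<dots> = (\<lambda>a. monom w * (\<Sum>b<r 0. f b * unit_vec b a))"
        by (simp add: N sum_distrib_left ac_simps)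
      also have "\<dots> = smult (monom w) f"
        using fun_cong[OF unit_expansion[OF f]] by (simp add: fun_eq_iff)
      finally show ?thesis .
    qed
    then show ?thesis using N unfolding P_def by auto
  qed
  moreover have "\<exists>N'. P (Suc p) N' \<and> Q p N N'" if P: "P p N" for p N
  proof -
    define T where "T b = smult (monom w) (unit_vec b) - comb p N (D p (unit_vec b))" for b
    have Nfree: "\<And>b. b < r p \<Longrightarrow> N b \<in> free_mod (r (Suc p))" using P by (simp add: P_def)
    have "\<exists>g\<in>free_mod (r (Suc (Suc p))). D (Suc p) g = T b" if b: "b < r (Suc p)" for b
    proof -
      have "D q (D p (unit_vec b)) = 0" if "p = Suc q" for q
        using D_D[of "unit_vec b" q] unit_vec_free[OF b] that by simp
      then have "D p (comb p N (D p (unit_vec b))) = smult (monom w) (D p (unit_vec b))"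
        using P D_free unfolding P_def by blast
      then have "D p (T b) = 0" unfolding T_def D_diff D_smult by simp
      moreover have "T b \<in> free_mod (r (Suc p))" unfolding T_def
        by (intro free_mod_diff free_mod_smult unit_vec_free[OF b] comb_free Nfree)
      ultimately show ?thesis using exact_Suc by (simp add: zero_fun_def)
    qed
    then obtain N' where N': "\<And>b. b < r (Suc p) \<Longrightarrow> N' b \<in> free_mod (r (Suc (Suc p))) \<and> D (Suc p) (N' b) = T b"
      by metis
    have Q: "D (Suc p) (comb (Suc p) N' f) + comb p N (D p f) = smult (monom w) f"
      if f: "f \<in> free_mod (r (Suc p))" for f
    proof -
      have 1: "D (Suc p) (comb (Suc p) N' f) = (\<lambda>a. \<Sum>b<r (Suc p). f b * T b a)"
        unfolding comb_def D_lincomb by (simp add: N')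
      have 2: "comb p N (D p f) = (\<lambda>a. \<Sum>b<r (Suc p). f b * comb p N (D p (unit_vec b)) a)"
        by (subst D_unit_expansion) (rule comb_lincomb)
      have "(\<Sum>b<r (Suc p). f b * T b a) + (\<Sum>b<r (Suc p). f b * comb p N (D p (unit_vec b)) a)
          = monom w * f a" for a
      proof -
        have "(\<Sum>b<r (Suc p). f b * T b a) + (\<Sum>b<r (Suc p). f b * comb p N (D p (unit_vec b)) a)
          = monom w * (\<Sum>b<r (Suc p). f b * unit_vec b a)"
          unfolding sum.distrib[symmetric] sum_distrib_left T_def by (intro sum.cong) (auto simp: algebra_simps)
        then show ?thesis using fun_cong[OF unit_expansion[OF f], of a] by simp
      qed
      then show ?thesis unfolding 1 2 by (simp add: fun_eq_iff)
    qed
    have "D (Suc p) (comb (Suc p) N' f) = smult (monom w) f"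
      if "f \<in> free_mod (r (Suc p))" "D p f = 0" for f
    proof -
      have "comb p N (D p f) = 0" unfolding that(2) by (auto simp: comb_def fun_eq_iff)
      then show ?thesis using Q[OF that(1)] by simp
    qed
    then have "P (Suc p) N'" unfolding P_def using N' by simp
    moreover have "Q p N N'" unfolding Q_def using Q by blast
    ultimately show ?thesis by blast
  qed
  ultimately obtain N where N: "\<And>p. P p (N p)" "\<And>p. Q p (N p) (N (Suc p))"
    using dependent_nat_choice[of P Q] by blast
  show ?thesis
  proof (intro exI[of _ N] allI conjI ballI)
    fix p
    show "\<And>b. b < r p \<longrightarrow> N p b \<in> free_mod (r (Suc p))" using N(1)[of p] by (simp add: P_def)
    show "D 0 (comb 0 (N 0) f) = smult (monom w) f" if "f \<in> free_mod (r 0)" for f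
      using N(1)[of 0] that by (simp add: P_def)
    show "D (Suc p) (comb (Suc p) (N (Suc p)) f) + comb p (N p) (D p f) = smult (monom w) f"
      if "f \<in> free_mod (r (Suc p))" for f
      using N(2)[of p] that by (simp add: Q_def)
  qed
qed

text \<open>
  Multiplication by $x^w$ is zero on Tor. The bounding element has its entries in every monomial ideal
  that contains the entries of \<open>h\<close>.
\<close>

lemma monomial_multiple_bounds:
  assumes w: "w \<noteq> 0" and B: "up_closed B"
    and h: "h \<in> free_mod (r i)" "\<And>p. i = Suc p \<Longrightarrow> supp_in B (D p h)"
  obtains s where "s \<in> free_mod (r (Suc i))" "\<And>A. up_closed A \<Longrightarrow> supp_in A h \<Longrightarrow> supp_in A s"
    "supp_in B (D i s - smult (monom w) h)"
proof -
  obtain N where N: "\<And>p b. b < r p \<Longrightarrow> N p b \<in> free_mod (r (Suc p))"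
    "\<And>f. f\<in>free_mod (r 0) \<Longrightarrow> D 0 (comb 0 (N 0) f) = smult (monom w) f"
    "\<And>p f. f\<in>free_mod (r (Suc p)) \<Longrightarrow>
      D (Suc p) (comb (Suc p) (N (Suc p)) f) + comb p (N p) (D p f) = smult (monom w) f"
    using null_homotopy[OF w] by metis
  show ?thesis
  proof (rule that[of "comb i (N i) h"])
    show "comb i (N i) h \<in> free_mod (r (Suc i))" by (rule comb_free) (rule N(1))
    show "supp_in A (comb i (N i) h)" if "up_closed A" "supp_in A h" for A
      using that by (rule supp_in_comb)
    show "supp_in B (D i (comb i (N i) h) - smult (monom w) h)"
    proof (cases i)
      case 0
      then show ?thesis using N(2) h(1) by (simp add: supp_in_def)
    next
      case (Suc p)
      have eq: "D i (comb i (N i) h) - smult (monom w) h = - comb p (N p) (D p h)"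
        unfolding N(3)[of h p, folded Suc, OF h(1), symmetric] by simp
      show ?thesis unfolding eq
        by (intro supp_in_uminus supp_in_comb[OF B] h(2)[OF Suc])
    qed
  qed
qed

text \<open>
  As multiplication by $x^w$ is zero on Tor, the connecting map
  $\mathrm{Tor}_{i+1}(K, S/(B + (x^w))) \to \mathrm{Tor}_i(K, S/B)(-\deg w)$ is onto.
\<close>

lemma vanishing_quotient_converse:
  assumes w: "w \<noteq> 0" and B: "up_closed B" and nzd: "\<And>u. u + w \<in> B \<Longrightarrow> u \<in> B"
    and van: "vanishing UNIV (B \<union> upset {w}) (Suc i) (j + mdeg w)"
  shows "vanishing UNIV B i j"
proof (rule vanishingI)
  fix h assume h: "homog i j h" "\<And>p. i = Suc p \<Longrightarrow> supp_in B (D p h)"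
  obtain s where s: "s \<in> free_mod (r (Suc i))" "supp_in B (D i s - smult (monom w) h)"
    using monomial_multiple_bounds[OF w B homog_free[OF h(1)] h(2)] by blast
  define f where "f = hcomp (Suc i) (j + mdeg w) s"
  have hf: "homog (Suc i) (j + mdeg w) f" unfolding f_def by (rule hcomp_homog[OF s(1)])
  have "hcomp i (j + mdeg w) (D i s - smult (monom w) h) = D i f - smult (monom w) h"
    unfolding hcomp_diff hcomp_D f_def hcomp_id[OF homog_smult[OF h(1)]] ..
  then have Df: "supp_in B (D i f - smult (monom w) h)" using supp_in_hcomp[OF s(2)] by metis
  have "supp_in (B \<union> upset {w}) (D p f)" if "Suc i = Suc p" for p
  proof -
    have "supp_in (B \<union> upset {w}) ((D i f - smult (monom w) h) + smult (monom w) h)"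
      by (rule supp_in_add[OF supp_in_mono[OF Df] supp_in_mono[OF supp_in_monom_smult]]) auto
    then show ?thesis using that by simp
  qed
  then obtain g where g: "homog (Suc (Suc i)) (j + mdeg w) g" "supp_in (B \<union> upset {w}) (f - D (Suc i) g)"
    using vanishingD[OF van hf] by auto
  obtain b c where bc: "f - D (Suc i) g = b + c" "b = (\<lambda>a. keep B ((f - D (Suc i) g) a))"
      "c = (\<lambda>a. keep (- B) ((f - D (Suc i) g) a))"
      "supp_in B b" "\<forall>C. supp_in C (f - D (Suc i) g) \<longrightarrow> supp_in (C - B) c"
    by (rule supp_in_split[of "f - D (Suc i) g" B])
  have c: "supp_in (upset {w}) c" using bc(5)[rule_format, OF g(2)] by (rule supp_in_mono) blast
  have "homog (Suc i) (j + mdeg w) c" unfolding bc(3)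
    by (rule homog_keep[OF homog_diff[OF hf homog_D[OF g(1)]]])
  then obtain k where k: "c = smult (monom w) k" "k \<in> free_mod (r (Suc i))"
    using vector_monom_divides[OF c homog_free] by blast
  have "D i f = D i (f - D (Suc i) g)" using D_D[OF homog_free[OF g(1)]] by (simp add: D_diff)
  also have "\<dots> = D i b + smult (monom w) (D i k)" unfolding bc(1) k(1) D_add D_smult ..
  finally have "smult (monom w) (h - D i k) = D i b - (D i f - smult (monom w) h)"
    by (simp add: smult_diff)
  moreover have "supp_in B \<dots>" by (rule supp_in_diff[OF supp_in_D[OF B bc(4)] Df])
  ultimately have "supp_in B (h - D i k)" using supp_in_monom_cancel[OF nzd] by metis
  then show "\<exists>k. k \<in> free_mod (r (Suc i)) \<and> supp_in UNIV k \<and> supp_in B (h - D i k)"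
    using k(2) by auto
qed

text \<open>
  Here \<open>A'\<close> consists of the multiples of those monomials of \<open>A\<close> that do not involve \<open>x\<close>. The composition
  $A' \to A \to A'/xA'$ of the inclusion with the map that discards the multiples of \<open>x\<close> is the canonical
  projection, which is injective on Tor because multiplication by \<open>x\<close> is zero there. Therefore
  $\mathrm{Tor}(K, A') \to \mathrm{Tor}(K, A)$ is injective.
\<close>

lemma vanishing_restrict:
  assumes A: "up_closed A'" "A' \<subseteq> A" "\<And>u. u \<in> A \<Longrightarrow> lookup u x = 0 \<Longrightarrow> u \<in> A'"
    and nzd: "\<And>u. u + var_exp x \<in> A' \<Longrightarrow> u \<in> A'"
    and van: "vanishing A {} i j"
  shows "vanishing A' {} i j"
proof (rule vanishingI)
  fix f assume f: "homog i j f" "supp_in A' f" "\<And>p. i = Suc p \<Longrightarrow> supp_in {} (D p f)"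
  obtain g where g: "homog (Suc i) j g" "supp_in A g" "supp_in {} (f - D i g)"
    using vanishingD[OF van f(1) supp_in_mono[OF f(2) A(2)] f(3)] by blast
  obtain b c where bc: "g = b + c" "b = (\<lambda>a. keep (upset {var_exp x}) (g a))"
      "c = (\<lambda>a. keep (- upset {var_exp x}) (g a))"
      "supp_in (upset {var_exp x}) b" "\<forall>C. supp_in C g \<longrightarrow> supp_in (C - upset {var_exp x}) c"
    by (rule supp_in_split[of g "upset {var_exp x}"])
  have c: "supp_in A' c"
    using bc(5)[rule_format, OF g(2)] by (rule supp_in_mono) (auto simp: in_upset_var A(3))
  have hc: "homog (Suc i) j c" unfolding bc(3) by (rule homog_keep[OF g(1)])
  have fg: "f = D i g" using g(3) by (simp add: supp_in_empty)
  have eq: "f - D i c = D i b" unfolding fg bc(1) D_add by simp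
  have hom: "homog i j (f - D i c)" by (rule homog_diff[OF f(1) homog_D[OF hc]])
  have "supp_in (upset {var_exp x}) (f - D i c)" unfolding eq by (rule supp_in_D[OF _ bc(4)]) simp
  then obtain h where h: "f - D i c = smult (monom (var_exp x)) h" "h \<in> free_mod (r i)"
    using vector_monom_divides[OF _ homog_free[OF hom]] by blast
  have "supp_in A' (f - D i c)" by (rule supp_in_diff[OF f(2) supp_in_D[OF A(1) c]])
  then have hA: "supp_in A' h" unfolding h(1) by (rule supp_in_monom_cancel[rotated]) (rule nzd)
  have cyc: "supp_in {} (D p h)" if "i = Suc p" for p
  proof (rule supp_in_monom_cancel[of "var_exp x" "{}"])
    have "smult (monom (var_exp x)) (D p h) = D p f - D p (D i c)"
      unfolding D_smult[symmetric] h(1)[symmetric] D_diff ..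
    also have "\<dots> = D p f" using D_D[of c p] homog_free[OF hc] that by simp
    finally show "supp_in {} (smult (monom (var_exp x)) (D p h))" using f(3)[OF that] by simp
  qed simp
  have "var_exp x \<noteq> 0" using mdeg_var_exp[of x] by (metis mdeg_zero_iff zero_neq_one)
  then obtain s where s: "s \<in> free_mod (r (Suc i))" "supp_in A' s"
    "supp_in {} (D i s - smult (monom (var_exp x)) h)"
    using monomial_multiple_bounds[OF _ up_closed_empty h(2) cyc] A(1) hA by blast
  have "D i (c + s) = f"
    using s(3) unfolding h(1)[symmetric] supp_in_empty by (simp add: D_add)
  then show "\<exists>g. g \<in> free_mod (r (Suc i)) \<and> supp_in A' g \<and> supp_in {} (f - D i g)"
    using free_mod_add[OF homog_free[OF hc] s(1)] supp_in_add[OF c s(2)]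
    by (intro exI[of _ "c + s"]) (simp add: supp_in_empty)
qed

lemma tensor_part_supported: "tensor_part r d (supported A) i j = {f. homog i j f \<and> supp_in A f}"
  unfolding tensor_part_def homog_def supp_in_def supported_def free_mod_def
  by (auto; metis keys_zero empty_iff empty_subsetI not_le subset_iff)

lemma tor_zero_iff:
  assumes A: "up_closed A"
  shows "tor_cycles r d M (supported A) i j = tor_boundaries r d M (supported A) i j \<longleftrightarrow> vanishing A {} i j"
proof
  assume eq: "tor_cycles r d M (supported A) i j = tor_boundaries r d M (supported A) i j"
  show "vanishing A {} i j"
  proof (rule vanishingI)
    fix f assume f: "homog i j f" "supp_in A f" "\<And>p. i = Suc p \<Longrightarrow> supp_in {} (D p f)"
    then have "f \<in> tor_cycles r d M (supported A) i j"
      unfolding tor_cycles_def tensor_part_supported by (simp add: supp_in_empty zero_fun_def)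
    then obtain g where "homog (Suc i) j g" "supp_in A g" "f = D i g"
      unfolding eq tor_boundaries_def tensor_part_supported by blast
    then show "\<exists>g. g \<in> free_mod (r (Suc i)) \<and> supp_in A g \<and> supp_in {} (f - D i g)"
      by (intro exI[of _ g]) (simp add: homog_free supp_in_empty)
  qed
next
  assume van: "vanishing A {} i j"
  show "tor_cycles r d M (supported A) i j = tor_boundaries r d M (supported A) i j"
  proof
    show "tor_cycles r d M (supported A) i j \<subseteq> tor_boundaries r d M (supported A) i j"
    proof
      fix f assume "f \<in> tor_cycles r d M (supported A) i j"
      then have f: "homog i j f" "supp_in A f" "\<And>p. i = Suc p \<Longrightarrow> supp_in {} (D p f)"
        unfolding tor_cycles_def tensor_part_supported by (auto simp: supp_in_empty zero_fun_def)
      obtain g where "homog (Suc i) j g" "supp_in A g" "supp_in {} (f - D i g)"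
        using vanishingD[OF van f] by blast
      then show "f \<in> tor_boundaries r d M (supported A) i j"
        unfolding tor_boundaries_def tensor_part_supported by (intro image_eqI[of _ _ g]) (auto simp: supp_in_empty)
    qed
    show "tor_boundaries r d M (supported A) i j \<subseteq> tor_cycles r d M (supported A) i j"
      unfolding tor_boundaries_def tor_cycles_def tensor_part_supported
      using homog_D supp_in_D[OF A] D_D[OF homog_free] by (auto simp: zero_fun_def)
  qed
qed

end

section \<open>Elimination orders from vanishing homology\<close>

text \<open>
  The monomials of the edge ideal of the subgraph induced on \<open>W\<close>.
\<close>

definition edge_monomials :: "('n \<Rightarrow> 'n \<Rightarrow> bool) \<Rightarrow> 'n set \<Rightarrow> 'n expo set"
  where "edge_monomials E W = {u. \<exists>i\<in>W. \<exists>j\<in>W. E i j \<and> lookup u i > 0 \<and> lookup u j > 0}"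

text \<open>
  The vertex sets that are connected in the complement of \<open>E\<close>. Adding one vertex at a time amounts to
  the choice of a spanning tree.
\<close>

inductive coconnected :: "('n \<Rightarrow> 'n \<Rightarrow> bool) \<Rightarrow> 'n set \<Rightarrow> bool" for E
  where
    single: "coconnected E {v}"
  | insert: "coconnected E U \<Longrightarrow> w \<in> U \<Longrightarrow> v \<notin> U \<Longrightarrow> \<not> E v w \<Longrightarrow> coconnected E (insert v U)"

lemma up_closed_edge_monomials: "up_closed (edge_monomials E W)"
  unfolding up_closed_def edge_monomials_def by (auto simp: lookup_add)

lemma lookup_add_var: "lookup (u + var_exp x) i > 0 \<longleftrightarrow> lookup u i > 0 \<or> i = x"
  by (auto simp: lookup_add lookup_var_exp)

lemma in_upset_pair:
  assumes "c \<noteq> c'"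
  shows "u \<in> upset {var_exp c + var_exp c'} \<longleftrightarrow> lookup u c > 0 \<and> lookup u c' > 0"
proof
  show "lookup u c > 0 \<and> lookup u c' > 0"
    if "u \<in> upset {var_exp c + var_exp c'}"
    using that by (auto elim!: upsetE simp: lookup_add lookup_var_exp)
  assume u: "lookup u c > 0 \<and> lookup u c' > 0"
  define v where "v = u - var_exp c"
  have 1: "u = v + var_exp c" unfolding v_def using u by (intro exponent_split_var) simp
  then have "lookup v c' > 0" using u assms by (simp add: lookup_add_var)
  then have "v = (v - var_exp c') + var_exp c'" by (rule exponent_split_var)
  then have "u = (var_exp c + var_exp c') + (v - var_exp c')" using 1 by (metis add.assoc add.commute)
  then show "u \<in> upset {var_exp c + var_exp c'}" using upsetI[of "var_exp c + var_exp c'" "{var_exp c + var_exp c'}"] by (metis singletonI)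
qed

lemma finite_coconnected: "coconnected E U \<Longrightarrow> finite U \<and> U \<noteq> {}"
  by (induction rule: coconnected.induct) auto

context free_resolution
begin

lemma vanishing_induced_subgraph:
  assumes "vanishing (edge_monomials E UNIV) {} i j"
  shows "vanishing (edge_monomials E W) {} i j"
proof -
  have "vanishing (edge_monomials E (- X)) {} i j" if "finite X" for X
    using that
  proof (induction X rule: finite_induct)
    case empty
    show ?case using assms by simp
  next
    case (insert x X)
    show ?case
    proof (rule vanishing_restrict[OF up_closed_edge_monomials _ _ _ insert.IH])
      show "edge_monomials E (- insert x X) \<subseteq> edge_monomials E (- X)"
        by (auto simp: edge_monomials_def)
      show "u \<in> edge_monomials E (- insert x X)"
        if "u \<in> edge_monomials E (- X)" "lookup u x = 0" for u
        using that by (force simp: edge_monomials_def)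
      show "u \<in> edge_monomials E (- insert x X)" if "u + var_exp x \<in> edge_monomials E (- insert x X)" for u
        using that by (auto simp: edge_monomials_def lookup_add_var)
    qed
  qed
  from this[of "- W"] show ?thesis by simp
qed

text \<open>
  \<open>T\<close> is the ideal generated by the products of two vertices of \<open>U\<close> that are not joined in a spanning tree
  of the complement of \<open>E\<close> on \<open>U\<close>. In topological terms, the tree is
  connected, so its reduced homology vanishes in dimension 0.
  
  Attaching a leaf \<open>v\<close> to the vertex \<open>w\<close> replaces \<open>T\<close> by the intersection of the ideal \<open>J1\<close> of the
  old tree and the ideal \<open>J2\<close> of the edge \<open>vw\<close>, each together with the remaining variables. Their sum is the
  ideal of the single vertex \<open>w\<close>. It is generated by \<open>card U\<close> variables, too few to obstruct the
  Mayer-Vietoris argument.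
\<close>

lemma vanishing_spanning_tree:
  assumes "coconnected E U" and irrefl: "\<And>v. \<not> E v v" and sym: "\<And>v w. E v w \<Longrightarrow> E w v"
  shows "\<exists>T. up_closed T \<and> edge_monomials E U \<subseteq> T \<and> T \<subseteq> edge_monomials (\<noteq>) U \<and>
    (\<forall>x u. x \<notin> U \<longrightarrow> u + var_exp x \<in> T \<longrightarrow> u \<in> T) \<and>
    (\<forall>q. card U \<le> Suc q \<longrightarrow> vanishing UNIV T q (Suc q))"
  using assms(1)
proof (induction rule: coconnected.induct)
  case (single v)
  have "vanishing UNIV {} q (Suc q)" for q
    by (cases q) (simp_all add: vanishing_ring_0 vanishing_ring_Suc)
  then show ?case using irrefl by (intro exI[of _ "{}"]) (auto simp: edge_monomials_def)
next
  case (insert U w v)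
  note wv = insert.hyps(2-4)
  from insert.IH obtain T where T: "up_closed T" "edge_monomials E U \<subseteq> T" "T \<subseteq> edge_monomials (\<noteq>) U"
    and nzd: "\<And>x u. x \<notin> U \<Longrightarrow> u + var_exp x \<in> T \<Longrightarrow> u \<in> T"
    and van: "\<And>q. card U \<le> Suc q \<Longrightarrow> vanishing UNIV T q (Suc q)" by blast
  have finU: "finite U" using finite_coconnected[OF insert.hyps(1)] by simp
  (* J1 is the ideal of the old tree and J2 the ideal of the new edge vw, on the enlarged vertex set. *)
  define J1 where "J1 = T \<union> upset {var_exp v}"
  define J2 where "J2 = upset (var_exp ` (U - {w}))"
  have TJ2: "T \<subseteq> J2"
  proof
    fix u assume "u \<in> T"
    then obtain a b where "a \<in> U" "b \<in> U" "a \<noteq> b" "lookup u a > 0" "lookup u b > 0"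
      using T(3) by (auto simp: edge_monomials_def)
    then show "u \<in> J2" unfolding J2_def in_upset_vars by (metis DiffI singletonD)
  qed
  have up: "up_closed J1" "up_closed J2" unfolding J1_def J2_def using T(1) by (auto intro: up_closed_Un)
  have mem: "u \<in> J1 \<inter> J2 \<longleftrightarrow> u \<in> T \<or> (lookup u v > 0 \<and> (\<exists>x\<in>U - {w}. lookup u x > 0))" for u
  proof -
    have "u \<in> J2 \<longleftrightarrow> (\<exists>x\<in>U - {w}. lookup u x > 0)" unfolding J2_def by (rule in_upset_vars)
    moreover have "u \<in> J1 \<longleftrightarrow> u \<in> T \<or> lookup u v > 0" by (simp add: J1_def in_upset_var)
    ultimately show ?thesis using TJ2 by blast
  qed
  show ?case
  proof (intro exI[of _ "J1 \<inter> J2"] conjI allI impI)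
    show "up_closed (J1 \<inter> J2)" using up by (rule up_closed_Int)
    show "edge_monomials E (insert v U) \<subseteq> J1 \<inter> J2"
    proof
      fix u assume "u \<in> edge_monomials E (insert v U)"
      then obtain i j where ij: "i \<in> insert v U" "j \<in> insert v U" "E i j"
        "lookup u i > 0" "lookup u j > 0" by (auto simp: edge_monomials_def)
      consider "i \<in> U" "j \<in> U" | "i = v" "j \<in> U" | "i \<in> U" "j = v" using ij irrefl by auto
      then show "u \<in> J1 \<inter> J2"
      proof cases
        case 1
        then show ?thesis unfolding mem using T(2) ij(3-5) by (auto simp: edge_monomials_def)
      next
        case 2
        then have "j \<noteq> w" using wv(3) ij(3) by auto
        then show ?thesis unfolding mem using 2 ij(4,5) by auto
      next
        case 3
        then have "i \<noteq> w" using wv(3) ij(3) sym by auto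
        then show ?thesis unfolding mem using 3 ij(4,5) by auto
      qed
    qed
    show "J1 \<inter> J2 \<subseteq> edge_monomials (\<noteq>) (insert v U)"
    proof
      fix u assume "u \<in> J1 \<inter> J2"
      then consider "u \<in> T" | x where "lookup u v > 0" "x \<in> U" "lookup u x > 0"
        unfolding mem by blast
      then show "u \<in> edge_monomials (\<noteq>) (insert v U)"
        using T(3) wv(2) by cases (auto simp: edge_monomials_def)
    qed
    show "u \<in> J1 \<inter> J2" if "x \<notin> insert v U" "u + var_exp x \<in> J1 \<inter> J2" for x u
      using that nzd[of x u] unfolding mem lookup_add_var by auto
    show "vanishing UNIV (J1 \<inter> J2) q (Suc q)" if q: "card (insert v U) \<le> Suc q" for q
    proof (rule vanishing_Int[OF up])
      have cU: "card U \<le> q" using q finU wv(2) by simp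
      show "vanishing UNIV J1 q (Suc q)" unfolding J1_def
      proof (rule vanishing_quotient[OF T(1)])
        show "u \<in> T" if "u + var_exp v \<in> T" for u using nzd[OF wv(2) that] .
        show "vanishing UNIV T q (Suc q)" using cU by (intro van) simp
        show "vanishing UNIV T i' j'" if "q = Suc i'" "Suc q = j' + mdeg (var_exp v)" for i' j'
          using van[of i'] cU that by simp
      qed
      show "vanishing UNIV J2 q (Suc q)" unfolding J2_def by (rule vanishing_variables) simp
      have "J1 \<union> J2 = {} \<union> upset (var_exp ` insert v (U - {w}))"
        using TJ2 unfolding upset_insert_var J1_def J2_def by blast
      moreover have "vanishing UNIV \<dots> (Suc q) (Suc q)"
      proof (rule vanishing_adjoin_variables[where n = 0])
        show "vanishing UNIV {} i j" if "0 < i" for i j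
          using that by (cases i) (simp_all add: vanishing_ring_Suc)
        have "card (insert v (U - {w})) = card U"
          using finU wv(1,2) by (metis card.insert card.remove finite_Diff Diff_iff)
        then show "0 + card (insert v (U - {w})) < Suc q" using cU by simp
      qed simp_all
      ultimately show "vanishing UNIV (J1 \<union> J2) (Suc q) (Suc q)" by simp
    qed
  qed
qed

text \<open>
  If the homology of $S/(B + (X))$ vanishes in one place, then so does that of $S/B$, with both indices lowered by
  the number of variables.
\<close>

lemma vanishing_descend_variables:
  assumes B: "up_closed B" "\<And>x u. x \<in> X \<Longrightarrow> u + var_exp x \<in> B \<Longrightarrow> u \<in> B"
    and "vanishing UNIV (B \<union> upset (var_exp ` X)) (n + card X) (t + card X)"
  shows "vanishing UNIV B n t"
proof -
  have "finite X" by simp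
  then show ?thesis using B(2) assms(3)
  proof (induction X rule: finite_induct)
    case empty
    then show ?case by simp
  next
    case (insert x X)
    have "vanishing UNIV (B \<union> upset (var_exp ` X)) (n + card X) (t + card X)"
    proof (rule vanishing_quotient_converse)
      show "var_exp x \<noteq> 0" using mdeg_var_exp[of x] by (metis mdeg_zero_iff zero_neq_one)
      show "up_closed (B \<union> upset (var_exp ` X))" using B(1) up_closed_upset by (rule up_closed_Un)
      show "u \<in> B \<union> upset (var_exp ` X)" if "u + var_exp x \<in> B \<union> upset (var_exp ` X)" for u
        using that upset_vars_nonzerodivisor[OF insert.hyps(2)] insert.prems(1) by blast
      show "vanishing UNIV (B \<union> upset (var_exp ` X) \<union> upset {var_exp x}) (Suc (n + card X)) (t + card X + mdeg (var_exp x))"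
        using insert.prems(2) insert.hyps unfolding upset_insert_var Un_assoc by simp
    qed
    then show ?case using insert.IH insert.prems(1) by blast
  qed
qed

text \<open>
  In the complement of \<open>E\<close>, the vertices \<open>c\<close> and \<open>c'\<close> are joined through \<open>A\<close> and through \<open>b\<close>. The clique
  complex of the complement is thus the union of two connected pieces that meet in the two points \<open>c\<close>
  and \<open>c'\<close>, and its first homology does not vanish.
  
  Algebraically, the edge ideal of the induced subgraph is the intersection of \<open>I1\<close> and \<open>I2\<close>, one for
  each piece. The ideals \<open>T1\<close> and \<open>I2\<close> of spanning trees of the pieces have no homology in bidegree
  \<open>(card A + 2, card A + 3)\<close>. By \<open>vanishing_Un\<close> the same holds for \<open>I1 + I2\<close>, which is generated by
  $x_c x_{c'}$ and the other \<open>card A + 1\<close> variables. Removing these generators one after the other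
  leads to $\mathrm{Tor}_0(K, S)_0 = 0$, which is absurd.
\<close>

lemma no_missing_diagonal:
  assumes irrefl: "\<And>v. \<not> E v v" and sym: "\<And>v w. E v w \<Longrightarrow> E w v"
    and van: "\<And>i j. i + 2 < j \<Longrightarrow> vanishing (edge_monomials E UNIV) {} i j"
    and conn: "coconnected E (insert c (insert c' A))" and E: "E c c'"
    and A: "c \<notin> A" "c' \<notin> A" "\<And>a. a \<in> A \<Longrightarrow> E a b" and b: "\<not> E b c" "\<not> E b c'" "b \<noteq> c" "b \<noteq> c'"
  shows False
proof -
  define U where "U = insert c (insert c' A)"
  define p where "p = var_exp c + var_exp c'"
  have cc: "c \<noteq> c'" using E irrefl by auto
  have bU: "b \<notin> U" using A(3) irrefl b by (auto simp: U_def)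
  have finA: "finite A" by simp
  have cU: "card U = card A + 2" using A(1,2) cc by (simp add: U_def)
  obtain T where T: "up_closed T" "edge_monomials E U \<subseteq> T" "T \<subseteq> edge_monomials (\<noteq>) U"
    and nzd: "\<And>x u. x \<notin> U \<Longrightarrow> u + var_exp x \<in> T \<Longrightarrow> u \<in> T"
    and vT: "\<And>q. card U \<le> Suc q \<Longrightarrow> vanishing UNIV T q (Suc q)"
    using vanishing_spanning_tree[OF conn irrefl sym] unfolding U_def by blast
  define EW where "EW = edge_monomials E (insert b U)"
  define I1 where "I1 = EW \<union> upset {var_exp b}"
  define I2 where "I2 = upset {p} \<union> upset (var_exp ` A)"
  define T1 where "T1 = T \<union> upset {var_exp b}"
  have memI2: "u \<in> I2 \<longleftrightarrow> (lookup u c > 0 \<and> lookup u c' > 0) \<or>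
      (\<exists>a\<in>A. lookup u a > 0)" for u
    unfolding I2_def p_def Un_iff in_upset_pair[OF cc] in_upset_vars ..
  (* In the complement of E the vertices b, c, c' form a path with middle vertex b, so every edge of E on
     the induced subgraph meets A or is cc'. *)
  have EW_I2: "EW \<subseteq> I2"
  proof
    fix u assume "u \<in> EW"
    then obtain i j where ij: "i \<in> insert b U" "j \<in> insert b U" "E i j"
      "lookup u i > 0" "lookup u j > 0" by (auto simp: EW_def edge_monomials_def)
    show "u \<in> I2"
    proof (cases "i \<in> A \<or> j \<in> A")
      case True
      then show ?thesis unfolding memI2 using ij(4,5) by blast
    next
      case False
      then have "i \<in> {b, c, c'}" "j \<in> {b, c, c'}" using ij(1,2) by (auto simp: U_def)
      then have "(i = c \<and> j = c') \<or> (i = c' \<and> j = c)" using ij(3) b irrefl sym by auto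
      then show ?thesis unfolding memI2 using ij(4,5) by blast
    qed
  qed
  have Int: "I1 \<inter> I2 = EW"
  proof
    show "EW \<subseteq> I1 \<inter> I2" using EW_I2 by (simp add: I1_def)
    show "I1 \<inter> I2 \<subseteq> EW"
    proof
      fix u assume u: "u \<in> I1 \<inter> I2"
      show "u \<in> EW"
      proof (cases "u \<in> EW")
        case False
        then have ub: "lookup u b > 0" using u by (simp add: I1_def in_upset_var)
        from u have "u \<in> I2" by simp
        then show ?thesis unfolding memI2
        proof (elim disjE conjE bexE)
          assume "lookup u c > 0" "lookup u c' > 0"
          then show ?thesis unfolding EW_def edge_monomials_def U_def using E by blast
        next
          fix a assume "a \<in> A" "lookup u a > 0"
          then show ?thesis unfolding EW_def edge_monomials_def U_def using A(3) ub by blast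
        qed
      qed
    qed
  qed
  have I1T1: "I1 \<subseteq> T1"
  proof
    fix u assume "u \<in> I1"
    then have "u \<in> edge_monomials E U \<or> lookup u b > 0"
      unfolding I1_def EW_def edge_monomials_def by (auto simp: in_upset_var)
    then show "u \<in> T1" using T(2) by (auto simp: T1_def in_upset_var)
  qed
  have sub: "T1 \<union> I2 \<subseteq> I1 \<union> I2"
  proof -
    have "u \<in> I2" if u: "u \<in> T" for u
    proof -
      obtain x y where "x \<in> U" "y \<in> U" "x \<noteq> y" "lookup u x > 0" "lookup u y > 0"
        using u T(3) by (auto simp: edge_monomials_def)
      then show ?thesis unfolding memI2 U_def by blast
    qed
    then show ?thesis unfolding T1_def I1_def by blast
  qed
  have up: "up_closed I1" "up_closed I2"
    unfolding I1_def I2_def EW_def by (intro up_closed_Un up_closed_edge_monomials up_closed_upset)+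
  have nzd_p: "u \<in> upset {p}" if "x \<notin> {c, c'}" "u + var_exp x \<in> upset {p}" for x u
    using that unfolding p_def in_upset_pair[OF cc] lookup_add_var by auto
  have p2: "mdeg p = 2" unfolding p_def mdeg_add mdeg_var_exp by simp
  have "vanishing UNIV (I1 \<union> I2) (Suc (Suc (card A))) (card A + 3)"
  proof (rule vanishing_Un[OF up I1T1 _ sub])
    show "vanishing (I1 \<inter> I2) {} (card A) (card A + 3)"
      unfolding Int EW_def by (rule vanishing_induced_subgraph[OF van]) simp
    show "vanishing UNIV T1 (Suc (Suc (card A))) (card A + 3)" unfolding T1_def
    proof (rule vanishing_quotient[OF T(1) nzd[OF bU]])
      show "vanishing UNIV T (Suc (Suc (card A))) (card A + 3)"
        using vT[of "Suc (Suc (card A))"] cU by (simp add: eval_nat_numeral)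
      show "vanishing UNIV T i' j'"
        if "Suc (Suc (card A)) = Suc i'" "card A + 3 = j' + mdeg (var_exp b)" for i' j'
        using vT[of i'] cU that by (simp add: eval_nat_numeral)
    qed
    show "vanishing UNIV I2 (Suc (Suc (card A))) (card A + 3)" unfolding I2_def
    proof (rule vanishing_adjoin_variables[where n = 1])
      show "u \<in> upset {p}" if "x \<in> A" "u + var_exp x \<in> upset {p}" for x u
        using nzd_p[of x u] that A(1,2) by auto
      show "vanishing UNIV (upset {p}) i j" if "1 < i" for i j
      proof -
        have "vanishing UNIV ({} \<union> upset {p}) i j"
        proof (rule vanishing_quotient)
          show "vanishing UNIV {} i j" using that by (cases i) (simp_all add: vanishing_ring_Suc)
          show "vanishing UNIV {} i' j'" if "i = Suc i'" for i' j'
            using \<open>1 < i\<close> that by (cases i') (simp_all add: vanishing_ring_Suc)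
        qed simp_all
        then show ?thesis by simp
      qed
    qed simp_all
  qed simp
  moreover have "I1 \<union> I2 = upset {p} \<union> upset (var_exp ` insert b A)"
    using EW_I2 unfolding upset_insert_var I1_def I2_def by blast
  moreover have "b \<notin> A" using bU by (simp add: U_def)
  ultimately have "vanishing UNIV (upset {p} \<union> upset (var_exp ` insert b A))
      (1 + card (insert b A)) (2 + card (insert b A))"
    by (simp add: eval_nat_numeral)
  then have "vanishing UNIV (upset {p}) 1 2"
  proof (rule vanishing_descend_variables[rotated 2])
    show "u \<in> upset {p}" if "x \<in> insert b A" "u + var_exp x \<in> upset {p}" for x u
      using nzd_p[of x u] that A(1,2) b(3,4) by auto
  qed simp
  moreover have "p \<noteq> 0" using p2 by (metis mdeg_zero_iff zero_neq_numeral)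
  ultimately have "vanishing UNIV {} 0 0"
    using vanishing_quotient_converse[of p "{}" 0 0] p2 by (auto simp: numeral_2_eq_2)
  then show False using not_vanishing_ring by blast
qed

end

text \<open>
  Dirac's theorem for the complement of \<open>E\<close>, to which adjacency refers in this comment. If not all
  vertices of \<open>W\<close> are adjacent, choose a largest connected set \<open>A\<close> with the property that some vertex
  outside has no neighbour in \<open>A\<close>. Let \<open>C\<close> be the set of outside vertices with a neighbour in \<open>A\<close>, and \<open>B\<close>
  the set of those without. By maximality every vertex of \<open>C\<close> is adjacent to all of \<open>B\<close>. Two nonadjacent
  vertices of \<open>C\<close> would form, with \<open>A\<close> and any vertex of \<open>B\<close>, the excluded configuration. Hence \<open>C\<close> is a
  clique, and a simplicial vertex of \<open>B\<close>, which exists by induction, is simplicial in \<open>W\<close>.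
\<close>

lemma exists_simplicial_vertex:
  fixes E :: "'n \<Rightarrow> 'n \<Rightarrow> bool"
  assumes irrefl: "\<And>v. \<not> E v v" and sym: "\<And>v w. E v w \<Longrightarrow> E w v"
    and diag: "\<And>A b c c'. coconnected E (insert c (insert c' A)) \<Longrightarrow> E c c' \<Longrightarrow> c \<notin> A \<Longrightarrow> c' \<notin> A \<Longrightarrow>
      (\<And>a. a \<in> A \<Longrightarrow> E a b) \<Longrightarrow> \<not> E b c \<Longrightarrow> \<not> E b c' \<Longrightarrow> b \<noteq> c \<Longrightarrow> b \<noteq> c' \<Longrightarrow> False"
    and W: "finite W" "W \<noteq> {}"
  shows "\<exists>c\<in>W. \<forall>j\<in>W - {c}. \<forall>k\<in>W - {c}. E j k \<longrightarrow> E c j \<or> E c k"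
  using W
proof (induction "card W" arbitrary: W rule: less_induct)
  case less
  show ?case
  proof (cases "\<exists>a\<in>W. \<exists>b\<in>W. E a b")
    case False
    then show ?thesis using less.prems(2) by blast
  next
    case True
    then obtain a b where ab: "a \<in> W" "b \<in> W" "E a b" by blast
    define F where "F = {A. A \<subseteq> W \<and> coconnected E A \<and> (\<exists>b\<in>W - A. \<forall>x\<in>A. E x b)}"
    have "{a} \<in> F" using ab irrefl by (auto simp: F_def intro: coconnected.single)
    moreover have "card A' < Suc (card W)" if "A' \<in> F" for A'
      using that card_mono[OF less.prems(1), of A'] by (auto simp: F_def)
    ultimately obtain A where A: "A \<in> F" and max: "\<And>A'. A' \<in> F \<Longrightarrow> card A' \<le> card A"
      using ex_has_greatest_nat[of "\<lambda>A. A \<in> F" "{a}" card "Suc (card W)"] by auto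
    have AW: "A \<subseteq> W" and conn: "coconnected E A" using A by (auto simp: F_def)
    have finA: "finite A" using AW less.prems(1) by (rule finite_subset)
    define B where "B = {b \<in> W - A. \<forall>x\<in>A. E x b}"
    define C where "C = W - A - B"
    have "B \<noteq> {}" using A by (auto simp: F_def B_def)
    have attach: "\<exists>x\<in>A. \<not> E c x" if "c \<in> C" for c
      using that sym by (auto simp: C_def B_def)
    have conn_C: "coconnected E (insert c A)" if c: "c \<in> C" for c
    proof -
      obtain x where "x \<in> A" "\<not> E c x" using attach[OF c] by blast
      then show ?thesis using conn c by (intro coconnected.insert[of E A x c]) (auto simp: C_def)
    qed
    have CB: "\<not> E c b" if c: "c \<in> C" and b: "b \<in> B" for b c
    proof
      assume "E c b"
      then have "insert c A \<in> F" unfolding F_def using conn_C[OF c] AW c b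
        by (auto simp: B_def C_def)
      then have "card (insert c A) \<le> card A" by (rule max)
      then show False using finA c by (simp add: C_def)
    qed
    have CC: "\<not> E c c'" if c: "c \<in> C" "c' \<in> C" for c c'
    proof
      assume E: "E c c'"
      then have "c \<noteq> c'" using irrefl by auto
      obtain x where x: "x \<in> A" "\<not> E c x" using attach[OF c(1)] by blast
      have "coconnected E (insert c (insert c' A))"
        using conn_C[OF c(2)] x c(1) \<open>c \<noteq> c'\<close> by (intro coconnected.insert[of E _ x c]) (auto simp: C_def)
      moreover obtain b where "b \<in> B" using \<open>B \<noteq> {}\<close> by blast
      moreover have "\<not> E b c" "\<not> E b c'" using CB c \<open>b \<in> B\<close> sym by blast+
      moreover have "c \<notin> A" "c' \<notin> A" "b \<noteq> c" "b \<noteq> c'" "\<And>a. a \<in> A \<Longrightarrow> E a b"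
        using c \<open>b \<in> B\<close> by (auto simp: C_def B_def)
      ultimately show False using diag[of c c' A b] E by blast
    qed
    have "A \<noteq> {}" using finite_coconnected[OF conn] by simp
    then have "B \<subset> W" using AW by (auto simp: B_def)
    then have "card B < card W" using less.prems(1) by (rule psubset_card_mono[rotated])
    moreover have "finite B" using \<open>B \<subset> W\<close> less.prems(1) by (metis finite_subset psubset_imp_subset)
    ultimately obtain c where c: "c \<in> B" "\<And>j k. j \<in> B - {c} \<Longrightarrow> k \<in> B - {c} \<Longrightarrow> E j k \<Longrightarrow> E c j \<or> E c k"
      using less.hyps[of B] \<open>B \<noteq> {}\<close> by blast
    have "E c j \<or> E c k" if jk: "j \<in> W - {c}" "k \<in> W - {c}" "E j k" for j k
    proof (cases "j \<in> A \<or> k \<in> A")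
      case True
      then show ?thesis using c(1) sym by (auto simp: B_def)
    next
      case False
      then have "j \<in> B \<union> C" "k \<in> B \<union> C" using jk by (auto simp: C_def)
      then have "j \<in> B" "k \<in> B" using CC CB jk(3) sym by blast+
      then show ?thesis using c(2) jk by blast
    qed
    moreover have "c \<in> W" using c(1) by (simp add: B_def)
    ultimately show ?thesis by blast
  qed
qed

text \<open>
  Simplicial vertices are removed successively. The ranks are positive because rank 0 is reserved for a
  cone point.
\<close>

lemma elimination_ranking:
  fixes E :: "'n \<Rightarrow> 'n \<Rightarrow> bool"
  assumes simplicial: "\<And>W. finite W \<Longrightarrow> W \<noteq> {} \<Longrightarrow> \<exists>c\<in>W. \<forall>j\<in>W - {c}. \<forall>k\<in>W - {c}. E j k \<longrightarrow> E c j \<or> E c k"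
    and W: "finite W"
  shows "\<exists>\<rho>::'n \<Rightarrow> nat. inj_on \<rho> W \<and> (\<forall>i\<in>W. \<rho> i > 0) \<and>
    (\<forall>i\<in>W. \<forall>j\<in>W. \<forall>k\<in>W. E j k \<longrightarrow> \<rho> i < \<rho> j \<longrightarrow> \<rho> i < \<rho> k \<longrightarrow> E i j \<or> E i k)"
  using W
proof (induction W rule: finite_psubset_induct)
  case (psubset W)
  show ?case
  proof (cases "W = {}")
    case True then show ?thesis by simp
  next
    case False
    then obtain c where c: "c \<in> W" "\<forall>j\<in>W - {c}. \<forall>k\<in>W - {c}. E j k \<longrightarrow> E c j \<or> E c k"
      using simplicial[OF psubset.hyps(1)] by blast
    have "W - {c} \<subset> W" using c(1) by blast
    from psubset.IH[OF this] obtain \<rho> :: "'n \<Rightarrow> nat" where \<rho>: "inj_on \<rho> (W - {c})" "\<forall>i\<in>W - {c}. \<rho> i > 0"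
      "\<forall>i\<in>W - {c}. \<forall>j\<in>W - {c}. \<forall>k\<in>W - {c}. E j k \<longrightarrow> \<rho> i < \<rho> j \<longrightarrow> \<rho> i < \<rho> k \<longrightarrow> E i j \<or> E i k"
      by blast
    define \<sigma> where "\<sigma> = (\<lambda>i. if i = c then 1 else Suc (\<rho> i))"
    have "inj_on \<sigma> W" using \<rho>(1,2) unfolding \<sigma>_def inj_on_def by auto
    moreover have "\<forall>i\<in>W. \<sigma> i > 0" by (simp add: \<sigma>_def)
    moreover have "E i j \<or> E i k" if "i \<in> W" "j \<in> W" "k \<in> W" "E j k" "\<sigma> i < \<sigma> j" "\<sigma> i < \<sigma> k" for i j k
    proof -
      have "j \<noteq> c" "k \<noteq> c" using that(1,5,6) by (auto simp: \<sigma>_def split: if_splits)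
      then show ?thesis
        using that c(2) \<rho>(3) by (cases "i = c") (auto simp: \<sigma>_def)
    qed
    ultimately show ?thesis by blast
  qed
qed

section \<open>Products of vertices and edges\<close>

text \<open>
  The products of \<open>a\<close> vertices lying on edges and \<open>s\<close> edges.
\<close>

inductive vertex_edge_product :: "('n \<Rightarrow> 'n \<Rightarrow> bool) \<Rightarrow> nat \<Rightarrow> nat \<Rightarrow> 'n expo \<Rightarrow> bool" for E
  where
    zero: "vertex_edge_product E 0 0 0"
  | vertex: "vertex_edge_product E a s u \<Longrightarrow> E i j \<Longrightarrow> vertex_edge_product E (Suc a) s (u + var_exp i)"
  | edge: "vertex_edge_product E a s u \<Longrightarrow> E i j \<Longrightarrow>
      vertex_edge_product E a (Suc s) (u + var_exp i + var_exp j)"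

definition gens :: "('n \<Rightarrow> 'n \<Rightarrow> bool) \<Rightarrow> nat \<Rightarrow> nat \<Rightarrow> 'n expo set"
  where "gens E a s = {u. vertex_edge_product E a s u}"

lemma gens_zero: "gens E 0 0 = {0}"
  unfolding gens_def by (auto intro: zero elim: vertex_edge_product.cases)

lemma gens_vertex: "u \<in> gens E a s \<Longrightarrow> E i j \<Longrightarrow> u + var_exp i \<in> gens E (Suc a) s"
  and gens_edge: "u \<in> gens E a s \<Longrightarrow> E i j \<Longrightarrow> u + var_exp i + var_exp j \<in> gens E a (Suc s)"
  unfolding gens_def by (simp_all add: vertex edge)

lemma mdeg_gens: "u \<in> gens E a s \<Longrightarrow> mdeg u = a + 2 * s" for u :: "'n::finite expo"
  unfolding gens_def mem_Collect_eq
proof (induction rule: vertex_edge_product.induct)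
  case zero show ?case by simp
qed (simp_all add: mdeg_add)

lemma gens_Suc_vertexE:
  assumes "u \<in> gens E (Suc a) s"
  obtains v i j where "v \<in> gens E a s" "E i j" "u = v + var_exp i"
proof -
  have "\<exists>v i j. vertex_edge_product E a' s v \<and> E i j \<and> u = v + var_exp i"
    if "vertex_edge_product E a s u" "a = Suc a'" for a a' u
    using that
  proof (induction arbitrary: a' rule: vertex_edge_product.induct)
    case zero then show ?case by simp
  next
    case (vertex a s u i j) then show ?case by auto
  next
    case (edge a s u i j)
    then obtain v k l where v: "vertex_edge_product E a' s v" "E k l" "u = v + var_exp k" by blast
    have "vertex_edge_product E a' (Suc s) (v + var_exp i + var_exp j)"
      using v(1) edge.hyps(2) by (rule vertex_edge_product.edge)
    moreover have "u + var_exp i + var_exp j = (v + var_exp i + var_exp j) + var_exp k"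
      by (simp add: v(3) ac_simps)
    ultimately show ?case using v(2) by blast
  qed
  then show ?thesis using assms that unfolding gens_def by blast
qed

lemma gens_Suc_edgeE:
  assumes "u \<in> gens E a (Suc s)"
  obtains v i j where "v \<in> gens E a s" "E i j" "u = v + var_exp i + var_exp j"
proof -
  have "\<exists>v i j. vertex_edge_product E a s' v \<and> E i j \<and> u = v + var_exp i + var_exp j"
    if "vertex_edge_product E a s u" "s = Suc s'" for s s' u
    using that
  proof (induction arbitrary: s' rule: vertex_edge_product.induct)
    case zero then show ?case by simp
  next
    case (edge a s u i j) then show ?case by auto
  next
    case (vertex a s u i j)
    then obtain v k l where v: "vertex_edge_product E a s' v" "E k l" "u = v + var_exp k + var_exp l" by blast
    have "vertex_edge_product E (Suc a) s' (v + var_exp i)"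
      using v(1) vertex.hyps(2) by (rule vertex_edge_product.vertex)
    moreover have "u + var_exp i = (v + var_exp i) + var_exp k + var_exp l"
      by (simp add: v(3) ac_simps)
    ultimately show ?case using v(2) by blast
  qed
  then show ?thesis using assms that unfolding gens_def by blast
qed

lemma finite_gens: "finite (gens E a s)" for E :: "'n::finite \<Rightarrow> 'n \<Rightarrow> bool"
proof (induction a)
  case 0
  show ?case
  proof (induction s)
    case 0 show ?case by (simp add: gens_zero)
  next
    case (Suc s)
    have "gens E 0 (Suc s) \<subseteq> (\<lambda>(v, i, j). v + var_exp i + var_exp j) ` (gens E 0 s \<times> UNIV)"
    proof
      fix u assume "u \<in> gens E 0 (Suc s)"
      then obtain v i j where "v \<in> gens E 0 s" "u = v + var_exp i + var_exp j" by (rule gens_Suc_edgeE)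
      then show "u \<in> (\<lambda>(v, i, j). v + var_exp i + var_exp j) ` (gens E 0 s \<times> UNIV)"
        by (intro image_eqI[of _ _ "(v, i, j)"]) auto
    qed
    then show ?case by (rule finite_subset) (simp add: Suc)
  qed
next
  case (Suc a)
  have "gens E (Suc a) s \<subseteq> (\<lambda>(v, i). v + var_exp i) ` (gens E a s \<times> UNIV)"
  proof
    fix u assume "u \<in> gens E (Suc a) s"
    then obtain v i j where "v \<in> gens E a s" "u = v + var_exp i" by (rule gens_Suc_vertexE)
    then show "u \<in> (\<lambda>(v, i). v + var_exp i) ` (gens E a s \<times> UNIV)"
      by (intro image_eqI[of _ _ "(v, i)"]) auto
  qed
  then show ?case by (rule finite_subset) (simp add: Suc)
qed

lemma gens_nonempty:
  assumes "E i j" shows "\<exists>u. u \<in> gens E a s"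
proof (induction a)
  case 0
  show ?case
  proof (induction s)
    case 0 show ?case by (simp add: gens_zero)
  next
    case (Suc s)
    then obtain u where "u \<in> gens E 0 s" by blast
    from gens_edge[OF this assms] show ?case by (rule exI)
  qed
next
  case (Suc a)
  then obtain u where "u \<in> gens E a s" by blast
  from gens_vertex[OF this assms] show ?case by (rule exI)
qed

lemma gens_relax:
  assumes sym: "\<And>i j. E i j \<Longrightarrow> E j i" and u: "u \<in> gens E a (Suc s)"
  shows "u \<in> gens E (Suc (Suc a)) s"
proof -
  obtain v i j where v: "v \<in> gens E a s" "E i j" "u = v + var_exp i + var_exp j"
    using u by (rule gens_Suc_edgeE)
  show ?thesis unfolding v(3) by (rule gens_vertex[OF gens_vertex[OF v(1,2)] sym[OF v(2)]])
qed

lemma add_var_eq_cases: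
  fixes u v :: "'n expo"
  assumes "u + var_exp i = v + var_exp k" "i \<noteq> k"
  shows "\<exists>w. u = w + var_exp k \<and> v = w + var_exp i"
proof -
  have "lookup u k > 0"
    using arg_cong[OF assms(1), of "\<lambda>u. lookup u k"] assms(2)
    by (simp add: lookup_add lookup_var_exp)
  then have u: "u = (u - var_exp k) + var_exp k" by (rule exponent_split_var)
  have "v + var_exp k = ((u - var_exp k) + var_exp i) + var_exp k"
    using assms(1) u by (metis add.assoc add.commute)
  then have "v = (u - var_exp k) + var_exp i" by simp
  then show ?thesis using u by blast
qed

text \<open>
  The removed variable is one of the \<open>a\<close> vertices, or it is an end of one of the \<open>s\<close> edges, whose other
  end then becomes a further vertex.
\<close>

lemma gens_divide:
  assumes sym: "\<And>i j. E i j \<Longrightarrow> E j i" and u: "v + var_exp i \<in> gens E a s"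
  shows "(\<exists>a'. a = Suc a' \<and> v \<in> gens E a' s) \<or> (\<exists>s'. s = Suc s' \<and> v \<in> gens E (Suc a) s')"
proof -
  have "(\<exists>a'. a = Suc a' \<and> vertex_edge_product E a' s v) \<or>
      (\<exists>s'. s = Suc s' \<and> vertex_edge_product E (Suc a) s' v)"
    if "vertex_edge_product E a s u" "u = v + var_exp k" for u v k
    using that
  proof (induction arbitrary: v rule: vertex_edge_product.induct)
    case zero
    then have "lookup (0 :: 'a \<Rightarrow>\<^sub>0 nat) k = lookup (v + var_exp k) k" by simp
    then show ?case by (simp add: lookup_add lookup_var_exp)
  next
    case (vertex a s u i j)
    show ?case
    proof (cases "i = k")
      case True
      then have "u = v" using vertex.prems by simp
      then show ?thesis using vertex.hyps(1) by blast
    next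
      case False
      then obtain w where w: "u = w + var_exp k" "v = w + var_exp i"
        using add_var_eq_cases[OF vertex.prems] by blast
      from vertex.IH[OF w(1)] vertex.hyps(2) show ?thesis
        unfolding w(2) by (auto intro: vertex_edge_product.vertex)
    qed
  next
    case (edge a s u i j)
    show ?case
    proof (cases "j = k")
      case True
      then have "u + var_exp i = v" using edge.prems by simp
      then show ?thesis using vertex_edge_product.vertex[OF edge.hyps(1,2)] by blast
    next
      case False
      then obtain w where w: "u + var_exp i = w + var_exp k" "v = w + var_exp j"
        using add_var_eq_cases[OF edge.prems] by blast
      show ?thesis
      proof (cases "i = k")
        case True
        then have "u = w" using w(1) by simp
        then show ?thesis unfolding w(2)
          using vertex_edge_product.vertex[OF edge.hyps(1) sym[OF edge.hyps(2)]] by blast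
      next
        case False
        then obtain x where x: "u = x + var_exp k" "w = x + var_exp i"
          using add_var_eq_cases[OF w(1)] by blast
        from edge.IH[OF x(1)] edge.hyps(2) show ?thesis
          unfolding w(2) x(2) by (auto intro: vertex_edge_product.edge)
      qed
    qed
  qed
  then show ?thesis using u unfolding gens_def by blast
qed

definition quotients :: "'n expo set \<Rightarrow> 'n expo set"
  where "quotients U = {u - var_exp i | u i. u \<in> U \<and> i \<in> keys u}"

lemma quotients_iff: "v \<in> quotients U \<longleftrightarrow> (\<exists>i. v + var_exp i \<in> U)"
proof
  assume "v \<in> quotients U"
  then obtain u i where "v = u - var_exp i" "u \<in> U" "lookup u i > 0"
    by (auto simp: quotients_def in_keys_iff)
  then have "v + var_exp i \<in> U" using exponent_split_var[of u i] by simp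
  then show "\<exists>i. v + var_exp i \<in> U" by (rule exI)
next
  assume "\<exists>i. v + var_exp i \<in> U"
  then obtain i where "v + var_exp i \<in> U" by blast
  moreover have "v = (v + var_exp i) - var_exp i" by simp
  moreover have "i \<in> keys (v + var_exp i)" by (simp add: in_keys_iff lookup_add lookup_var_exp)
  ultimately show "v \<in> quotients U" unfolding quotients_def by blast
qed

lemma quotients_gens_edge:
  assumes sym: "\<And>i j. E i j \<Longrightarrow> E j i"
  shows "quotients (gens E a (Suc s)) = gens E (Suc a) s"
proof
  show "quotients (gens E a (Suc s)) \<subseteq> gens E (Suc a) s"
  proof
    fix v assume "v \<in> quotients (gens E a (Suc s))"
    then obtain i where "v + var_exp i \<in> gens E a (Suc s)" by (auto simp: quotients_iff)
    have "(\<exists>a'. a = Suc a' \<and> v \<in> gens E a' (Suc s)) \<or> (\<exists>s'. Suc s = Suc s' \<and> v \<in> gens E (Suc a) s')"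
      by (rule gens_divide[OF _ \<open>v + var_exp i \<in> gens E a (Suc s)\<close>]) (rule sym)
    then show "v \<in> gens E (Suc a) s"
    proof (elim disjE exE conjE)
      fix a' assume a: "a = Suc a'" "v \<in> gens E a' (Suc s)"
      have "v \<in> gens E (Suc (Suc a')) s" by (rule gens_relax[OF _ a(2)]) (rule sym)
      then show ?thesis by (simp add: a(1))
    qed simp
  qed
  show "gens E (Suc a) s \<subseteq> quotients (gens E a (Suc s))"
  proof
    fix u assume "u \<in> gens E (Suc a) s"
    then obtain v i j where "v \<in> gens E a s" "E i j" "u = v + var_exp i" by (rule gens_Suc_vertexE)
    then have "u + var_exp j \<in> gens E a (Suc s)" using gens_edge[of v E a s i j] by simp
    then show "u \<in> quotients (gens E a (Suc s))" unfolding quotients_iff by (rule exI)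
  qed
qed

lemma quotients_gens_vertex:
  assumes sym: "\<And>i j. E i j \<Longrightarrow> E j i" and "E i j"
  shows "quotients (gens E (Suc a) 0) = gens E a 0"
proof
  show "quotients (gens E (Suc a) 0) \<subseteq> gens E a 0"
  proof
    fix v assume "v \<in> quotients (gens E (Suc a) 0)"
    then obtain i where "v + var_exp i \<in> gens E (Suc a) 0" by (auto simp: quotients_iff)
    have "(\<exists>a'. Suc a = Suc a' \<and> v \<in> gens E a' 0) \<or> (\<exists>s'. 0 = Suc s' \<and> v \<in> gens E (Suc (Suc a)) s')"
      by (rule gens_divide[OF _ \<open>v + var_exp i \<in> gens E (Suc a) 0\<close>]) (rule sym)
    then show "v \<in> gens E a 0" by simp
  qed
  show "gens E a 0 \<subseteq> quotients (gens E (Suc a) 0)"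
  proof
    fix u assume "u \<in> gens E a 0"
    from gens_vertex[OF this assms(2)] show "u \<in> quotients (gens E (Suc a) 0)"
      unfolding quotients_iff by (rule exI)
  qed
qed

section \<open>An order of the generators with linear quotients\<close>

definition to_mset :: "('n::finite \<Rightarrow> nat) \<Rightarrow> 'n expo \<Rightarrow> nat multiset"
  where "to_mset \<rho> u = (\<Sum>i\<in>UNIV. replicate_mset (lookup u i) (\<rho> i))"

lemma to_mset_zero [simp]: "to_mset \<rho> 0 = {#}"
  by (simp add: to_mset_def)

lemma to_mset_add: "to_mset \<rho> (u + v) = to_mset \<rho> u + to_mset \<rho> v"
proof -
  have "replicate_mset (m + n) x = replicate_mset m x + replicate_mset n x" for m n and x :: nat
    by (simp add: multiset_eq_iff)
  then show ?thesis by (simp add: to_mset_def lookup_add sum.distrib)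
qed

lemma to_mset_var [simp]: "to_mset \<rho> (var_exp i) = {#\<rho> i#}"
proof -
  have "to_mset \<rho> (var_exp i) = (\<Sum>j\<in>UNIV. if j = i then {#\<rho> i#} else {#})"
    unfolding to_mset_def by (intro sum.cong) (auto simp: lookup_var_exp)
  then show ?thesis by simp
qed

lemma count_to_mset:
  assumes "inj \<rho>" shows "count (to_mset \<rho> u) (\<rho> i) = lookup u i"
proof -
  have "count (to_mset \<rho> u) (\<rho> i) = (\<Sum>j\<in>UNIV. if j = i then lookup u i else 0)"
    unfolding to_mset_def count_sum using assms by (intro sum.cong) (auto simp: inj_eq)
  then show ?thesis by simp
qed

lemma in_to_mset: "x \<in># to_mset \<rho> u \<Longrightarrow> \<exists>i. x = \<rho> i"
proof -
  assume "x \<in># to_mset \<rho> u"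
  then show "\<exists>i. x = \<rho> i" by (auto simp: to_mset_def set_mset_sum split: if_splits)
qed

lemma to_mset_inj:
  assumes "inj \<rho>" "to_mset \<rho> u = to_mset \<rho> v" shows "u = v"
  using assms count_to_mset[OF assms(1)] by (metis poly_mapping_eqI)

text \<open>
  The edges of the cone over the graph, written with the smaller vertex first. The cone point 0 is
  joined to the vertices that lie on an edge.
\<close>

definition cone_edges :: "('n \<Rightarrow> nat) \<Rightarrow> ('n \<Rightarrow> 'n \<Rightarrow> bool) \<Rightarrow> (nat \<times> nat) set"
  where "cone_edges \<rho> E = {(0, \<rho> i) | i j. E i j} \<union> {(\<rho> i, \<rho> j) | i j. E i j \<and> \<rho> i < \<rho> j}"

text \<open>
  A product of \<open>a\<close> vertices and \<open>s\<close> edges becomes a product of \<open>a + s\<close> edges of the cone after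
  multiplication by the \<open>a\<close>-th power of the cone point.
\<close>

definition cone_mset :: "('n::finite \<Rightarrow> nat) \<Rightarrow> nat \<Rightarrow> 'n expo \<Rightarrow> nat multiset"
  where "cone_mset \<rho> a u = replicate_mset a 0 + to_mset \<rho> u"

lemma gens_in_products:
  assumes "inj \<rho>" and sym: "\<And>i j. E i j \<Longrightarrow> E j i" and irrefl: "\<And>i. \<not> E i i"
    and u: "u \<in> gens E a s"
  shows "cone_mset \<rho> a u \<in> products (cone_edges \<rho> E)"
  using u unfolding gens_def mem_Collect_eq
proof (induction rule: vertex_edge_product.induct)
  case zero
  show ?case unfolding products_def cone_mset_def by (simp add: exI[of _ "{#}"])
next
  case (vertex a s u i j)
  then obtain A where A: "set_mset A \<subseteq> cone_edges \<rho> E" "cone_mset \<rho> a u = verts A" by (auto simp: products_def)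
  have "set_mset (add_mset (0, \<rho> i) A) \<subseteq> cone_edges \<rho> E" using A(1) vertex.hyps(2) by (auto simp: cone_edges_def)
  moreover have "cone_mset \<rho> (Suc a) (u + var_exp i) = verts (add_mset (0, \<rho> i) A)"
    unfolding verts_add_mset A(2)[symmetric] by (simp add: cone_mset_def to_mset_add ends_def)
  ultimately show ?case unfolding products_def by blast
next
  case (edge a s u i j)
  then obtain A where A: "set_mset A \<subseteq> cone_edges \<rho> E" "cone_mset \<rho> a u = verts A" by (auto simp: products_def)
  have "\<rho> i \<noteq> \<rho> j" using edge.hyps(2) irrefl assms(1) by (metis injD)
  then obtain f where f: "f \<in> cone_edges \<rho> E" "ends f = {#\<rho> i, \<rho> j#}"
  proof (cases "\<rho> i < \<rho> j")
    case True
    then show ?thesis using edge.hyps(2) by (intro that[of "(\<rho> i, \<rho> j)"]) (auto simp: cone_edges_def ends_def)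
  next
    case False
    then have "\<rho> j < \<rho> i" using \<open>\<rho> i \<noteq> \<rho> j\<close> by simp
    then show ?thesis using sym[OF edge.hyps(2)]
      by (intro that[of "(\<rho> j, \<rho> i)"]) (auto simp: cone_edges_def ends_def)
  qed
  have "cone_mset \<rho> a (u + var_exp i + var_exp j) = verts (add_mset f A)"
    unfolding verts_add_mset A(2)[symmetric] f(2) by (simp add: cone_mset_def to_mset_add)
  moreover have "set_mset (add_mset f A) \<subseteq> cone_edges \<rho> E" using A(1) f(1) by simp
  ultimately show ?case unfolding products_def by blast
qed

text \<open>
  The numbers of vertices and edges can be read off from the multiplicity of the cone point and from
  the degree.
\<close>

lemma products_in_gens:
  assumes inj: "inj \<rho>" and pos: "\<And>i. \<rho> i > 0"
    and u: "cone_mset \<rho> a u \<in> products (cone_edges \<rho> E)" "mdeg u = a + 2 * s"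
  shows "u \<in> gens E a s"
proof -
  have zero: "count (to_mset \<rho> v) 0 = 0" for v
    using in_to_mset[of 0 \<rho> v] pos by (metis count_inI less_irrefl)
  have ex: "\<exists>a s v. v \<in> gens E a s \<and> verts A = cone_mset \<rho> a v" if "set_mset A \<subseteq> cone_edges \<rho> E" for A
    using that
  proof (induction A)
    case empty
    then show ?case by (intro exI[of _ 0]) (simp add: gens_zero cone_mset_def)
  next
    case (add f A)
    then obtain a s v where v: "v \<in> gens E a s" "verts A = cone_mset \<rho> a v" by auto
    from add.prems consider i j where "f = (0, \<rho> i)" "E i j" | i j where "f = (\<rho> i, \<rho> j)" "E i j"
      by (auto simp: cone_edges_def)
    then show ?case
    proof cases
      case 1
      have "verts (add_mset f A) = cone_mset \<rho> (Suc a) (v + var_exp i)"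
        by (simp add: v(2) 1(1) ends_def cone_mset_def to_mset_add)
      then show ?thesis using gens_vertex[OF v(1) 1(2)] by blast
    next
      case 2
      have "verts (add_mset f A) = cone_mset \<rho> a (v + var_exp i + var_exp j)"
        by (simp add: v(2) 2(1) ends_def cone_mset_def to_mset_add)
      then show ?thesis using gens_edge[OF v(1) 2(2)] by blast
    qed
  qed
  from u(1) obtain A where "set_mset A \<subseteq> cone_edges \<rho> E" "cone_mset \<rho> a u = verts A" by (auto simp: products_def)
  then obtain a' s' v where v: "v \<in> gens E a' s'" "cone_mset \<rho> a u = cone_mset \<rho> a' v" using ex by metis
  have "a = a'" using arg_cong[OF v(2), of "\<lambda>M. count M 0"] zero by (simp add: cone_mset_def)
  then have "u = v" using v(2) to_mset_inj[OF inj] by (simp add: cone_mset_def)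
  then have "s = s'" using mdeg_gens[OF v(1)] u(2) \<open>a = a'\<close> by simp
  then show ?thesis using v(1) \<open>a = a'\<close> \<open>u = v\<close> by simp
qed

text \<open>
  The generators are sorted by the least factorizations of their cones. The cone point occurs in all
  of these cones with the same multiplicity, so the variables exchanged by \<open>linear_exchange\<close> are
  vertices of the original graph and the exchange stays within \<open>gens E a s\<close>.
\<close>

lemma gens_linear_quotients:
  fixes E :: "'n::finite \<Rightarrow> 'n \<Rightarrow> bool" and \<rho> :: "'n \<Rightarrow> nat"
  assumes sym: "\<And>i j. E i j \<Longrightarrow> E j i" and irrefl: "\<And>i. \<not> E i i"
    and inj: "inj \<rho>" and pos: "\<And>i. \<rho> i > 0"
    and elim: "\<And>i j k. E j k \<Longrightarrow> \<rho> i < \<rho> j \<Longrightarrow> \<rho> i < \<rho> k \<Longrightarrow> E i j \<or> E i k"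
  shows "\<exists>us. distinct us \<and> set us = gens E a s \<and>
    (\<forall>m<length us. \<exists>V. {u. u + us ! m \<in> upset (set (take m us))} = upset (var_exp ` V))"
proof -
  define F where "F = cone_edges \<rho> E"
  define key where "key u = std_factorization F (cone_mset \<rho> a u)" for u
  have cover: "(fst f, fst e) \<in> F \<or> (fst f, snd e) \<in> F"
    if ef: "e \<in> F" "f \<in> F" "fst f < fst e" for e f
  proof -
    obtain j k where e: "e = (\<rho> j, \<rho> k)" "E j k" "\<rho> j < \<rho> k"
      using ef(1,3) by (auto simp: F_def cone_edges_def)
    from ef(2) consider "fst f = 0" | i where "fst f = \<rho> i" by (auto simp: F_def cone_edges_def)
    then show ?thesis
    proof cases
      case 1
      then show ?thesis using e by (auto simp: F_def cone_edges_def)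
    next
      case 2
      then have lt: "\<rho> i < \<rho> j" "\<rho> i < \<rho> k" using ef(3) e by auto
      have "(\<rho> i, \<rho> j) \<in> F" if "E i j" using that lt(1) unfolding F_def cone_edges_def by blast
      moreover have "(\<rho> i, \<rho> k) \<in> F" if "E i k" using that lt(2) unfolding F_def cone_edges_def by blast
      ultimately show ?thesis using elim[OF e(2) lt] 2 e(1) by auto
    qed
  qed
  have prod: "cone_mset \<rho> a u \<in> products F" if "u \<in> gens E a s" for u
    unfolding F_def
  proof (rule gens_in_products[OF inj _ _ that])
    show "E j i" if "E i j" for i j using that by (rule sym)
    show "\<not> E i i" for i by (rule irrefl)
  qed
  have key_inj: "u = v" if "u \<in> gens E a s" "v \<in> gens E a s" "key u = key v" for u v
  proof -
    have "verts (key u) = cone_mset \<rho> a u" "verts (key v) = cone_mset \<rho> a v"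
      unfolding key_def by (rule std_factorization_factorizes(2)[OF prod[OF that(1)]],
        rule std_factorization_factorizes(2)[OF prod[OF that(2)]])
    then have "cone_mset \<rho> a u = cone_mset \<rho> a v" unfolding that(3) by simp
    then have "to_mset \<rho> u = to_mset \<rho> v" by (simp add: cone_mset_def)
    then show ?thesis by (rule to_mset_inj[OF inj])
  qed
  obtain xs where xs: "distinct xs" "set xs = gens E a s" using finite_distinct_list[OF finite_gens[of E a s]] by blast
  define us where "us = sort_key key xs"
  have us: "distinct us" "set us = gens E a s" "sorted (map key us)" unfolding us_def using xs by simp_all
  have "\<exists>V. {u. u + us ! m \<in> upset (set (take m us))} = upset (var_exp ` V)" if m: "m < length us" for m
  proof -
    define w where "w = us ! m"
    have w: "w \<in> gens E a s" unfolding w_def us(2)[symmetric] using m by (rule nth_mem)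
    (* V collects the variables v such that an earlier generator arises from w by exchanging some variable
       for v. *)
    define V where "V = {v. \<exists>w'\<in>set (take m us). \<exists>y. w + var_exp v = w' + var_exp y}"
    have "{u. u + w \<in> upset (set (take m us))} = upset (var_exp ` V)"
    proof
      show "upset (var_exp ` V) \<subseteq> {u. u + w \<in> upset (set (take m us))}"
      proof
        fix u assume "u \<in> upset (var_exp ` V)"
        then obtain v t where v: "v \<in> V" "u = var_exp v + t" by (auto elim!: upsetE)
        then obtain w' y where w': "w' \<in> set (take m us)" "w + var_exp v = w' + var_exp y" by (auto simp: V_def)
        have "u + w = (w + var_exp v) + t" by (simp add: v(2) ac_simps)
        also have "\<dots> = w' + (var_exp y + t)" by (simp add: w'(2) ac_simps)
        finally show "u \<in> {u. u + w \<in> upset (set (take m us))}" using w'(1) by (simp add: upsetI)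
      qed
      show "{u. u + w \<in> upset (set (take m us))} \<subseteq> upset (var_exp ` V)"
      proof
        fix u assume "u \<in> {u. u + w \<in> upset (set (take m us))}"
        then have "u + w \<in> upset (set (take m us))" by simp
        then obtain w0 t where w0: "w0 \<in> set (take m us)" "u + w = w0 + t" by (rule upsetE)
        then obtain p where p: "p < m" "w0 = us ! p" by (auto simp: in_set_conv_nth)
        have w0g: "w0 \<in> gens E a s" unfolding p(2) us(2)[symmetric] using p(1) m by (intro nth_mem) simp
        have "key w0 \<le> key w"
          using sorted_nth_mono[OF us(3), of p m] p m by (simp add: w_def)
        moreover have "w0 \<noteq> w" using us(1) p m by (simp add: w_def nth_eq_iff_index_eq)
        then have "key w0 \<noteq> key w" using key_inj w0g w by blast
        ultimately have less: "key w0 < key w" by simp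
        have "size (cone_mset \<rho> a w0) = size (cone_mset \<rho> a w)"
          using mdeg_gens[OF w] mdeg_gens[OF w0g]
          by (simp add: cone_mset_def to_mset_def mdeg_def size_multiset_sum)
        from linear_exchange[OF cover prod[OF w0g] prod[OF w] this less[unfolded key_def]]
        obtain x y where xy: "count (cone_mset \<rho> a w) x < count (cone_mset \<rho> a w0) x"
          "count (cone_mset \<rho> a w0) y < count (cone_mset \<rho> a w) y"
          "add_mset x (cone_mset \<rho> a w - {#y#}) \<in> products F"
          "std_factorization F (add_mset x (cone_mset \<rho> a w - {#y#})) < key w" unfolding key_def by blast
        have zero: "count (to_mset \<rho> v) 0 = 0" for v
          using in_to_mset[of 0 \<rho> v] pos by (metis count_inI less_irrefl)
        have x0: "x \<noteq> 0" "y \<noteq> 0"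
        proof -
          show "x \<noteq> 0"
          proof
            assume "x = 0"
            with xy(1) zero show False by (simp add: cone_mset_def)
          qed
          show "y \<noteq> 0"
          proof
            assume "y = 0"
            with xy(2) zero show False by (simp add: cone_mset_def)
          qed
        qed
        then have "x \<in># to_mset \<rho> w0" "y \<in># to_mset \<rho> w"
          using xy(1,2) by (auto simp: cone_mset_def count_greater_zero_iff[symmetric] simp del: count_greater_zero_iff)
        then obtain v z where vz: "x = \<rho> v" "y = \<rho> z" using in_to_mset by metis
        have lv: "lookup w v < lookup w0 v"
          and lz: "lookup w0 z < lookup w z"
          using xy(1,2) x0 unfolding vz by (simp_all add: cone_mset_def count_to_mset[OF inj])
        define w1 where "w1 = w - var_exp z"
        have w1: "w = w1 + var_exp z" unfolding w1_def using lz by (intro exponent_split_var) simp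
        have cone_w1: "add_mset x (cone_mset \<rho> a w - {#y#}) = cone_mset \<rho> a (w1 + var_exp v)"
          unfolding vz by (simp add: w1 cone_mset_def to_mset_add)
        have "mdeg (w1 + var_exp v) = mdeg w" by (simp add: w1 mdeg_add)
        then have w1g: "w1 + var_exp v \<in> gens E a s"
          using products_in_gens[OF inj pos, of a "w1 + var_exp v" E s] xy(3) mdeg_gens[OF w]
          unfolding cone_w1 F_def by simp
        have "key (w1 + var_exp v) < key w" using xy(4) unfolding cone_w1 key_def .
        moreover obtain q where q: "q < length us" "w1 + var_exp v = us ! q"
          using w1g us(2) by (metis in_set_conv_nth)
        ultimately have "q < m"
          using sorted_nth_mono[OF us(3), of m q] m by (force simp: w_def not_less[symmetric])
        then have "w1 + var_exp v \<in> set (take m us)" using q by (auto simp: in_set_conv_nth)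
        moreover have "w + var_exp v = (w1 + var_exp v) + var_exp z" by (simp add: w1 ac_simps)
        ultimately have "v \<in> V" unfolding V_def by blast
        moreover have "lookup u v > 0"
          using arg_cong[OF w0(2), of "\<lambda>u. lookup u v"] lv by (simp add: lookup_add)
        ultimately show "u \<in> upset (var_exp ` V)" unfolding in_upset_vars by blast
      qed
    qed
    then show ?thesis unfolding w_def by blast
  qed
  then show ?thesis using us(1,2) by blast
qed

section \<open>Gradient ideals\<close>

text \<open>
  This coefficient formula makes the linearity of the derivative evident.
\<close>

lemma lookup_partial_deriv:
  "lookup (partial_deriv i f) w =
    of_nat (Suc (lookup w i)) * lookup f (w + var_exp i)"
proof -
  have "lookup (partial_deriv i f) w = (\<Sum>u\<in>keys f.
      (if u = w + var_exp i then of_nat (Suc (lookup w i)) * lookup f (w + var_exp i) else 0))"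
    unfolding partial_deriv_def lookup_sum
  proof (intro sum.cong refl)
    fix u
    show "lookup (single (u - var_exp i)
        (of_nat (lookup u i) * lookup f u)) w =
      (if u = w + var_exp i then of_nat (Suc (lookup w i)) * lookup f (w + var_exp i) else 0)"
    proof (cases "lookup u i = 0")
      case True
      then have "u \<noteq> w + var_exp i" by (auto simp: lookup_add lookup_var_exp)
      then show ?thesis using True by simp
    next
      case False
      then have "u = (u - var_exp i) + var_exp i" by (intro exponent_split_var) simp
      then have "u - var_exp i = w \<longleftrightarrow> u = w + var_exp i" by auto
      then show ?thesis by (auto simp: lookup_single when_def lookup_add lookup_var_exp)
    qed
  qed
  also have "\<dots> = of_nat (Suc (lookup w i)) * lookup f (w + var_exp i)"
    by (simp add: sum.delta in_keys_iff)
  finally show ?thesis .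
qed

lemma lookup_const_mult: "lookup (single 0 c * f) w = c * lookup f w"
  for c :: "'k::comm_ring_1"
  by (simp add: mult_map_scale_conv_mult[symmetric] Poly_Mapping.map.rep_eq when_def)

lemma partial_deriv_lincomb:
  "partial_deriv i (\<Sum>g\<in>T. single 0 (c g) * g) = (\<Sum>g\<in>T. single 0 (c g) * partial_deriv i g)"
  for c :: "('n, 'k::comm_ring_1) mpoly \<Rightarrow> 'k"
  by (intro poly_mapping_eqI)
    (simp add: lookup_partial_deriv lookup_sum lookup_const_mult sum_distrib_left mult.left_commute)

lemma partial_deriv_monom:
  assumes "lookup u i > 0"
  shows "partial_deriv i (monom u :: ('n, 'k::comm_ring_1) mpoly) =
    single (u - var_exp i) (of_nat (lookup u i))"
  by (simp add: partial_deriv_def monom_def)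

lemma keys_partial_deriv:
  "w \<in> keys (partial_deriv i f) \<Longrightarrow> w + var_exp i \<in> keys f"
  by (auto simp: in_keys_iff lookup_partial_deriv)

lemma min_hom_gens_monom:
  fixes U :: "'n::finite expo set"
  assumes "antichain U"
  shows "min_hom_gens (monom ` U) (supported (upset U) :: ('n, 'k::field) mpoly set)"
  unfolding min_hom_gens_def min_gens_monom_iff using assms by (auto simp: homogeneous_def monom_def)

text \<open>
  If all terms of \<open>g\<close> have degree at least \<open>t\<close>, only the constant term of \<open>c\<close> contributes to the part of
  degree \<open>t\<close> of \<open>c * g\<close>.
\<close>

lemma homogeneous_part_of_multiple:
  fixes g c :: "('n::finite, 'k::field) mpoly"
  assumes g: "homogeneous e g" and low: "\<And>u. u \<in> keys g \<Longrightarrow> t \<le> mdeg u"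
  shows "\<exists>c0. keep {u. mdeg u = t} (c * g) = single 0 c0 * g"
proof (cases "e = t \<and> g \<noteq> 0")
  case True
  define c' where "c' = c - single 0 (lookup c 0)"
  have "lookup c' 0 = 0" by (simp add: c'_def lookup_minus)
  then have c': "0 \<notin> keys c'" by (simp add: in_keys_iff)
  have deg: "mdeg v = t" if "v \<in> keys g" for v
    using g that True by (auto simp: homogeneous_def)
  have eq: "c * g = single 0 (lookup c 0) * g + c' * g"
    by (simp add: c'_def algebra_simps)
  have "keep {u. mdeg u = t} (c' * g) = 0"
  proof (rule keep_zero)
    have "mdeg u \<noteq> t" if "u \<in> keys (c' * g)" for u
    proof -
      from that keys_mult[of c' g] have "u \<in> {a + b |a b. a \<in> keys c' \<and> b \<in> keys g}" by blast
      then obtain a b where ab: "u = a + b" "a \<in> keys c'" "b \<in> keys g" by blast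
      then have "a \<noteq> 0" using c' by auto
      then have "mdeg a \<noteq> 0" by simp
      then show ?thesis using deg[OF ab(3)] by (simp add: ab(1) mdeg_add)
    qed
    then show "keys (c' * g) \<inter> {u. mdeg u = t} = {}" by blast
  qed
  moreover have "keep {u. mdeg u = t} (single 0 (lookup c 0) * g)
      = single 0 (lookup c 0) * g"
    by (rule keep_id) (auto simp: in_keys_iff lookup_const_mult intro!: deg)
  ultimately show ?thesis unfolding eq keep_add by auto
next
  case False
  have "keep {u. mdeg u = t} (c * g) = 0"
  proof (rule keep_zero)
    have "mdeg u \<noteq> t" if "u \<in> keys (c * g)" for u
    proof -
      from that keys_mult[of c g] have "u \<in> {a + b |a b. a \<in> keys c \<and> b \<in> keys g}" by blast
      then obtain a b where ab: "u = a + b" "b \<in> keys g" by blast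
      then have "mdeg b = e" "g \<noteq> 0" using g by (auto simp: homogeneous_def)
      then show ?thesis using low[OF ab(2)] False by (simp add: ab(1) mdeg_add)
    qed
    then show "keys (c * g) \<inter> {u. mdeg u = t} = {}" by blast
  qed
  then show ?thesis by (intro exI[of _ 0]) simp
qed

text \<open>
  Derivatives of elements of the ideal stay in the ideal on the right: a factor is removed either
  from the generator or from the cofactor, and in the latter case the generator has positive degree.
  Conversely, let \<open>u\<close> be one of the monomials and \<open>G\<close> any homogeneous generating set. In degree \<open>t\<close>, the
  representation of \<open>u\<close> by \<open>G\<close> has constant coefficients. So the derivatives of \<open>u\<close> are linear combinations of
  the derivatives of elements of \<open>G\<close>, and their coefficients are invertible in characteristic 0.
\<close>

lemma gradient_monomial_ideal:
  fixes U :: "'n::finite expo set"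
  assumes char: "CHAR('k::field) = 0" and deg: "\<And>u. u \<in> U \<Longrightarrow> mdeg u = t" and t: "t > 0"
  shows "gradient (supported (upset U)) = (supported (upset (quotients U)) :: ('n, 'k) mpoly set)"
proof -
  define J where "J = (supported (upset U) :: ('n, 'k) mpoly set)"
  define G where "G = (SOME G. min_hom_gens G J)"
  have "min_hom_gens G J" unfolding G_def J_def
    by (rule someI) (rule min_hom_gens_monom[OF antichain_equigenerated[OF deg]])
  then have hom: "\<And>g. g \<in> G \<Longrightarrow> \<exists>e. homogeneous e g" and gen: "ideal_gen G = J"
    by (auto simp: min_hom_gens_def min_gens_def)
  define P where "P = {partial_deriv i f | i f. f \<in> G}"
  have grad: "gradient J = ideal_gen P" unfolding gradient_def P_def G_def ..
  have GJ: "G \<subseteq> J" using ideal_gen_base[of _ G] gen by auto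
  have "ideal_gen P \<subseteq> supported (upset (quotients U))"
  proof (rule supported_ideal)
    have "w \<in> upset (quotients U)" if f: "f \<in> G" and w: "w \<in> keys (partial_deriv i f)" for i f w
    proof -
      have "w + var_exp i \<in> upset U"
        using keys_partial_deriv[OF w] f GJ by (auto simp: J_def supported_def)
      then obtain u s where u: "u \<in> U" "w + var_exp i = u + s" by (rule upsetE)
      show ?thesis
      proof (cases "lookup u i > 0")
        case True
        then have ui: "u = (u - var_exp i) + var_exp i" by (rule exponent_split_var)
        have "w + var_exp i = ((u - var_exp i) + s) + var_exp i"
          using u(2) ui by (metis add.assoc add.commute)
        then have "w = (u - var_exp i) + s" by simp
        moreover have "(u - var_exp i) + var_exp i \<in> U" using ui u(1) by simp
        then have "u - var_exp i \<in> quotients U" unfolding quotients_iff by (rule exI)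
        ultimately show ?thesis using upsetI by simp
      next
        case False
        then have "lookup s i > 0"
          using arg_cong[OF u(2), of "\<lambda>v. lookup v i"] by (simp add: lookup_add lookup_var_exp)
        then have si: "s = (s - var_exp i) + var_exp i" by (rule exponent_split_var)
        have "w + var_exp i = (u + (s - var_exp i)) + var_exp i"
          using u(2) si by (metis add.assoc)
        then have w: "w = u + (s - var_exp i)" by simp
        have "u \<noteq> 0" using deg[OF u(1)] t by auto
        then obtain j where "lookup u j \<noteq> 0" by (metis lookup_zero poly_mapping_eqI)
        then have uj: "u = (u - var_exp j) + var_exp j" by (intro exponent_split_var) simp
        then have "(u - var_exp j) + var_exp j \<in> U" using u(1) by simp
        then have "u - var_exp j \<in> quotients U" unfolding quotients_iff by (rule exI)
        moreover have "w = (u - var_exp j) + (var_exp j + (s - var_exp i))"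
          using w uj by (metis add.assoc)
        ultimately show ?thesis using upsetI by simp
      qed
    qed
    then show "P \<subseteq> supported (upset (quotients U))" by (auto simp: P_def supported_def)
  qed simp
  moreover have "monom v \<in> ideal_gen P" if "v \<in> quotients U" for v
  proof -
    obtain i where i: "v + var_exp i \<in> U" using \<open>v \<in> quotients U\<close> by (auto simp: quotients_iff)
    define u where "u = v + var_exp i"
    have uU: "u \<in> U" using i by (simp add: u_def)
    have ui: "lookup u i > 0" by (simp add: u_def lookup_add lookup_var_exp)
    have "(monom u :: ('n, 'k) mpoly) \<in> ideal_gen G"
      unfolding gen J_def using uU by (simp add: upset_base)
    from ideal_gen_explicit[OF this]
    obtain T c where T: "finite T" "T \<subseteq> G" "(monom u :: ('n, 'k) mpoly) = (\<Sum>g\<in>T. c g * g)"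
      by (elim exE conjE) (rule that)
    have low: "t \<le> mdeg w" if "g \<in> G" "w \<in> keys g" for g w
    proof -
      have "w \<in> upset U" using that GJ by (auto simp: J_def supported_def)
      then obtain u s where "u \<in> U" "w = u + s" by (rule upsetE)
      then show ?thesis using deg by (simp add: mdeg_add)
    qed
    have "\<forall>g\<in>T. \<exists>c0. keep {u. mdeg u = t} (c g * g) = single 0 c0 * g"
    proof
      fix g assume "g \<in> T"
      then have "g \<in> G" using T(2) by blast
      then obtain e where "homogeneous e g" using hom by blast
      then show "\<exists>c0. keep {u. mdeg u = t} (c g * g) = single 0 c0 * g"
        using low[OF \<open>g \<in> G\<close>] by (rule homogeneous_part_of_multiple)
    qed
    then obtain c0 where c0: "\<And>g. g \<in> T \<Longrightarrow> keep {u. mdeg u = t} (c g * g) = single 0 (c0 g) * g"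
      by metis
    (* Comparing the parts of degree t makes all coefficients constant. *)
    have "(monom u :: ('n, 'k) mpoly) = keep {u. mdeg u = t} (monom u)"
      by (rule keep_id[symmetric]) (simp add: monom_def deg[OF uU])
    also have "\<dots> = (\<Sum>g\<in>T. single 0 (c0 g) * g)"
      unfolding T(3) keep_sum using c0 by (intro sum.cong) auto
    finally have "partial_deriv i (monom u :: ('n, 'k) mpoly) = (\<Sum>g\<in>T. single 0 (c0 g) * partial_deriv i g)"
      using partial_deriv_lincomb[of i c0 T] by simp
    also have "\<dots> \<in> ideal_gen P"
      using T(2) by (intro ideal_gen_sum ideal_gen_scale ideal_gen_base) (auto simp: P_def)
    finally have "partial_deriv i (monom u :: ('n, 'k) mpoly) \<in> ideal_gen P" .
    then have mem: "single v (of_nat (lookup u i)) \<in> ideal_gen P"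
      unfolding partial_deriv_monom[OF ui] by (simp add: u_def)
    have "(of_nat (lookup u i) :: 'k) \<noteq> 0"
      using char ui by (simp add: of_nat_eq_0_iff_char_dvd)
    then have "monom v = single 0 (inverse (of_nat (lookup u i) :: 'k)) *
        single v (of_nat (lookup u i))"
      by (simp add: mult_single monom_def)
    then show ?thesis using ideal_gen_scale[OF mem] by simp
  qed
  then have "supported (upset (quotients U)) \<subseteq> ideal_gen P"
    unfolding ideal_gen_monom[symmetric] ideal_gen_subset_iff by blast
  ultimately show ?thesis using grad unfolding J_def by blast
qed

lemma ideal_power_gens:
  fixes I :: "('n::finite, 'k::field) mpoly set"
  assumes I: "I = supported (upset (gens E 0 1))"
  shows "ideal_power I k = supported (upset (gens E 0 k))"
proof (induction k)
  case 0
  show ?case by (simp add: gens_zero upset_singleton_zero supported_def)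
next
  case (Suc k)
  have "{u + v |u v. u \<in> gens E 0 1 \<and> v \<in> gens E 0 k} = gens E 0 (Suc k)"
  proof
    show "{u + v |u v. u \<in> gens E 0 1 \<and> v \<in> gens E 0 k} \<subseteq> gens E 0 (Suc k)"
    proof
      fix w assume "w \<in> {u + v |u v. u \<in> gens E 0 1 \<and> v \<in> gens E 0 k}"
      then obtain u v where w: "w = u + v" "u \<in> gens E 0 (Suc 0)" "v \<in> gens E 0 k" by auto
      obtain u' i j where "u' \<in> gens E 0 0" and u: "E i j" "u = u' + var_exp i + var_exp j"
        using w(2) by (rule gens_Suc_edgeE)
      then have "u = var_exp i + var_exp j" by (simp add: gens_zero)
      then have "w = v + var_exp i + var_exp j" by (simp add: w(1) ac_simps)
      then show "w \<in> gens E 0 (Suc k)" using gens_edge[of v E 0 k i j] w(3) u(1) by simp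
    qed
    show "gens E 0 (Suc k) \<subseteq> {u + v |u v. u \<in> gens E 0 1 \<and> v \<in> gens E 0 k}"
    proof
      fix w assume "w \<in> gens E 0 (Suc k)"
      then obtain v i j where v: "v \<in> gens E 0 k" "E i j" "w = v + var_exp i + var_exp j"
        by (rule gens_Suc_edgeE)
      have "0 + var_exp i + var_exp j \<in> gens E 0 (Suc 0)"
        using gens_edge[of 0 E 0 0 i j] v(2) by (simp add: gens_zero)
      moreover have "w = (0 + var_exp i + var_exp j) + v" by (simp add: v(3) ac_simps)
      ultimately show "w \<in> {u + v |u v. u \<in> gens E 0 1 \<and> v \<in> gens E 0 k}" using v(1) by auto
    qed
  qed
  then have "ideal_mult I (supported (upset (gens E 0 k))) = supported (upset (gens E 0 (Suc k)))"
    unfolding I ideal_mult_supported by (simp only:)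
  then show ?case by (simp add: Suc)
qed

section \<open>Regularity\<close>

lemma resolution_exists:
  fixes I :: "('n::finite, 'k::field) mpoly set"
  assumes "tor_nonzero I i j"
  obtains r d M and e :: "nat \<Rightarrow> 'k" where "free_resolution r d (M :: nat \<Rightarrow> nat \<Rightarrow> nat \<Rightarrow> ('n, 'k) mpoly) e"
  using assms unfolding tor_nonzero_def free_resolution_def by blast

lemma tor_nonzero_iff:
  fixes A :: "'n::finite expo set"
  assumes "up_closed A"
  shows "tor_nonzero (supported A :: ('n, 'k::field) mpoly set) i j \<longleftrightarrow>
    (\<exists>r d (M :: nat \<Rightarrow> nat \<Rightarrow> nat \<Rightarrow> ('n, 'k) mpoly) e. free_resolution r d M e \<and>
      \<not> free_resolution.vanishing r d M A {} i j)"
  unfolding tor_nonzero_def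
  using free_resolution.tor_zero_iff[OF _ assms] by (metis free_resolution_def)

text \<open>
  The generators give a nonzero Tor in bidegree \<open>(0, t)\<close>, and no nonzero Tor lies above the line
  \<open>j = i + t\<close>.
\<close>

lemma regularity_of_linear_quotients:
  fixes U :: "'n::finite expo set"
  assumes us: "set us = U" and deg: "\<And>u. u \<in> U \<Longrightarrow> mdeg u = t" and ne: "u0 \<in> U"
    and lin: "\<And>m. m < length us \<Longrightarrow> \<exists>V. {u. u + us ! m \<in> upset (set (take m us))} = upset (var_exp ` V)"
    and res: "free_resolution r d (M :: nat \<Rightarrow> nat \<Rightarrow> nat \<Rightarrow> ('n, 'k::field) mpoly) e"
  shows "has_regularity (supported (upset U) :: ('n, 'k) mpoly set) (int t)"
  unfolding has_regularity_def
proof (intro conjI allI impI)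
  have "\<not> free_resolution.vanishing r d M (upset U) {} 0 t"
    by (rule free_resolution.not_vanishing_generators[OF res ne deg])
  then have "tor_nonzero (supported (upset U) :: ('n, 'k) mpoly set) 0 t"
    unfolding tor_nonzero_iff[OF up_closed_upset] using res by blast
  then show "\<exists>i j. tor_nonzero (supported (upset U) :: ('n, 'k) mpoly set) i j \<and> int j - int i = int t"
    by (intro exI[of _ 0] exI[of _ t]) simp
next
  fix i j assume "tor_nonzero (supported (upset U) :: ('n, 'k) mpoly set) i j"
  then obtain r d and M :: "nat \<Rightarrow> nat \<Rightarrow> nat \<Rightarrow> ('n, 'k) mpoly" and e
    where res: "free_resolution r d M e" and nv: "\<not> free_resolution.vanishing r d M (upset U) {} i j"
    unfolding tor_nonzero_iff[OF up_closed_upset] by blast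
  have "\<not> i + t < j"
  proof
    assume "i + t < j"
    then have "free_resolution.vanishing r d M (upset (set us)) {} i j"
      by (intro free_resolution.vanishing_linear_quotients[OF res _ lin]) (use us deg in auto)
    then show False using nv us by simp
  qed
  then show "int j - int i \<le> int t" by simp
qed

lemma linear_quotients_supported:
  fixes U :: "'n::finite expo set"
  assumes us: "distinct us" "set us = U" and U: "antichain U"
    and lin: "\<And>m. m < length us \<Longrightarrow> \<exists>V. {u. u + us ! m \<in> upset (set (take m us))} = upset (var_exp ` V)"
  shows "linear_quotients (supported (upset U) :: ('n, 'k::field) mpoly set)"
  unfolding linear_quotients_def
proof (intro conjI exI[of _ us] ballI)
  show "monomial_ideal (supported (upset U) :: ('n, 'k) mpoly set)"
    unfolding monomial_ideal_def ideal_gen_monom by blast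
  show "set us = monomial_gens (supported (upset U) :: ('n, 'k) mpoly set)"
    using us(2) monomial_gens_supported[OF U, where 'k = 'k] by simp
  show "\<exists>V. ideal_colon (ideal_gen (monom ` set (take i us))) (ideal_gen {monom (us ! i)}) =
      ideal_gen ((\<lambda>v. monom (var_exp v) :: ('n, 'k) mpoly) ` V)" if i: "i \<in> {1..<length us}" for i
  proof -
    obtain V where V: "{u. u + us ! i \<in> upset (set (take i us))} = upset (var_exp ` V)"
      using lin[of i] i by auto
    have "ideal_gen ((\<lambda>v. monom (var_exp v) :: ('n, 'k) mpoly) ` V) = supported (upset (var_exp ` V))"
      using ideal_gen_monom[of "var_exp ` V", where 'k = 'k] by (simp add: image_image)
    then show ?thesis unfolding ideal_gen_monom ideal_colon_supported V by blast
  qed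
qed (rule us)

section \<open>Powers of squarefree ideals with 2-linear resolution\<close>

lemma quadratic_squarefree_exponent:
  fixes u :: "'n::finite expo"
  assumes sq: "\<And>i. lookup u i \<le> 1" and deg: "mdeg u = 2"
  shows "\<exists>i j. i \<noteq> j \<and> u = var_exp i + var_exp j"
proof -
  have "u \<noteq> 0" using deg by auto
  then obtain i where "lookup u i \<noteq> 0" by (metis lookup_zero poly_mapping_eqI)
  then have i: "u = (u - var_exp i) + var_exp i" by (intro exponent_split_var) simp
  define v where "v = u - var_exp i"
  have "mdeg v = 1" using arg_cong[OF i, of mdeg] deg by (simp add: v_def mdeg_add)
  then have "v \<noteq> 0" by auto
  then obtain j where "lookup v j \<noteq> 0" by (metis lookup_zero poly_mapping_eqI)
  then have j: "v = (v - var_exp j) + var_exp j" by (intro exponent_split_var) simp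
  have "mdeg (v - var_exp j) = 0" using arg_cong[OF j, of mdeg] \<open>mdeg v = 1\<close> by (simp add: mdeg_add)
  then have "v = var_exp j" using j by simp
  then have u: "u = var_exp i + var_exp j" using i by (simp add: v_def ac_simps)
  have "i \<noteq> j"
  proof
    assume "i = j"
    then show False using sq[of i] u by (simp add: lookup_add lookup_var_exp)
  qed
  then show ?thesis using u by blast
qed

text \<open>
  The edges are the minimal monomial generators, which have degree 2 and are squarefree.
\<close>

lemma squarefree_2_linear_graph:
  fixes I :: "('n::finite, 'k::field) mpoly set"
  assumes sq: "squarefree_monomial_ideal I" and lin: "linear_resolution 2 I"
  obtains E :: "'n \<Rightarrow> 'n \<Rightarrow> bool" where "\<And>i. \<not> E i i" "\<And>i j. E i j \<Longrightarrow> E j i" "\<exists>i j. E i j"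
    "I = supported (upset (gens E 0 1))" "upset (gens E 0 1) = edge_monomials E UNIV"
proof -
  obtain U where U: "\<And>u i. u \<in> U \<Longrightarrow> lookup u i \<le> 1" "I = ideal_gen (monom ` U)"
    using sq by (auto simp: squarefree_monomial_ideal_def)
  obtain V where V: "V \<subseteq> U" "antichain V" "upset V = upset U" by (rule minimal_elements)
  have I: "I = supported (upset V)" using U(2) V(3) by (simp add: ideal_gen_monom)
  have hom: "\<forall>f\<in>monom ` V. homogeneous 2 (f :: ('n, 'k) mpoly)"
    using lin min_hom_gens_monom[OF V(2), where 'k = 'k] unfolding linear_resolution_def I by blast
  have deg: "mdeg u = 2" if "u \<in> V" for u
    using hom that by (auto simp: homogeneous_def monom_def)
  have "V \<noteq> {}" using lin unfolding linear_resolution_def I by (auto simp: supported_def)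
  define E where "E i j \<longleftrightarrow> i \<noteq> j \<and> var_exp i + var_exp j \<in> V" for i j
  have pair: "\<exists>i j. E i j \<and> u = var_exp i + var_exp j" if "u \<in> V" for u
    using quadratic_squarefree_exponent[OF U(1) deg] that V(1) unfolding E_def by blast
  have sym: "E j i" if "E i j" for i j using that by (auto simp: E_def add.commute)
  have gens: "gens E 0 1 = V"
  proof
    show "gens E 0 1 \<subseteq> V"
    proof
      fix u assume "u \<in> gens E 0 1"
      then have "u \<in> gens E 0 (Suc 0)" by simp
      then obtain v i j where "v \<in> gens E 0 0" "E i j" "u = v + var_exp i + var_exp j"
        by (rule gens_Suc_edgeE)
      then show "u \<in> V" by (simp add: gens_zero E_def)
    qed
    show "V \<subseteq> gens E 0 1"
    proof
      fix u assume "u \<in> V"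
      then obtain i j where ij: "E i j" "u = var_exp i + var_exp j" using pair by blast
      have "0 + var_exp i + var_exp j \<in> gens E 0 (Suc 0)"
        using gens_edge[of 0 E 0 0 i j] ij(1) by (simp add: gens_zero)
      then show "u \<in> gens E 0 1" by (simp add: ij(2))
    qed
  qed
  have mono: "upset V = edge_monomials E UNIV"
  proof
    show "upset V \<subseteq> edge_monomials E UNIV"
    proof
      fix u assume "u \<in> upset V"
      then obtain v t where v: "v \<in> V" "u = v + t" by (rule upsetE)
      then obtain i j where ij: "E i j" "v = var_exp i + var_exp j" using pair by blast
      have "lookup u i > 0" "lookup u j > 0"
        unfolding v(2) ij(2) by (simp_all add: lookup_add lookup_var_exp)
      with ij(1) show "u \<in> edge_monomials E UNIV" unfolding edge_monomials_def by blast
    qed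
    show "edge_monomials E UNIV \<subseteq> upset V"
    proof
      fix u assume "u \<in> edge_monomials E UNIV"
      then obtain i j where ij: "E i j" "lookup u i > 0" "lookup u j > 0"
        by (auto simp: edge_monomials_def)
      then have "u \<in> upset {var_exp i + var_exp j}" using in_upset_pair[of i j u] by (simp add: E_def)
      moreover have "upset {var_exp i + var_exp j} \<subseteq> upset V" by (rule upset_mono) (use ij(1) in \<open>simp add: E_def\<close>)
      ultimately show "u \<in> upset V" by blast
    qed
  qed
  show ?thesis
  proof (rule that[of E])
    show "\<not> E i i" for i by (simp add: E_def)
    show "E j i" if "E i j" for i j using that by (rule sym)
    show "\<exists>i j. E i j" using \<open>V \<noteq> {}\<close> pair by blast
    show "I = supported (upset (gens E 0 1))" unfolding gens by (rule I)
    show "upset (gens E 0 1) = edge_monomials E UNIV" unfolding gens by (rule mono)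
  qed
qed

text \<open>
  While \<open>m \<le> k\<close> each gradient turns an edge into a vertex, and afterwards it removes a vertex.
\<close>

lemma gradient_gens:
  fixes I :: "('n::finite, 'k::field) mpoly set" and k l :: nat
  assumes sym: "\<And>i j. E i j \<Longrightarrow> E j i" and ex: "E i0 j0"
    and I: "I = supported (upset (gens E 0 1))" and l: "l \<le> 2 * k"
    and char: "CHAR('k) = 0 \<or>
      (\<forall>m<l. let J = (gradient ^^ m) (ideal_power I k) in
        gradient J = ideal_gen {monom (u - var_exp i) | u i. u \<in> monomial_gens J \<and> i \<in> keys u})"
    and m: "m \<le> l"
  shows "(gradient ^^ m) (ideal_power I k) =
    supported (upset (if m \<le> k then gens E m (k - m) else gens E (2 * k - m) 0))"
  using m
proof (induction m)
  case 0
  show ?case using ideal_power_gens[OF I, of k] by simp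
next
  case (Suc m)
  define U where "U = (if m \<le> k then gens E m (k - m) else gens E (2 * k - m) 0)"
  define J where "J = (gradient ^^ m) (ideal_power I k)"
  have J: "J = supported (upset U)" unfolding J_def U_def using Suc by simp
  have deg: "mdeg u = 2 * k - m" if "u \<in> U" for u
    using that Suc.prems l mdeg_gens[of u E] unfolding U_def by (auto split: if_splits)
  have pos: "2 * k - m > 0" using Suc.prems l by simp
  have "gradient J = supported (upset (quotients U))"
    using char
  proof
    assume "CHAR('k) = 0"
    then show ?thesis unfolding J by (rule gradient_monomial_ideal[OF _ deg pos])
  next
    assume "\<forall>m<l. let J = (gradient ^^ m) (ideal_power I k) in
        gradient J = ideal_gen {monom (u - var_exp i) | u i. u \<in> monomial_gens J \<and> i \<in> keys u}"
    then have "gradient J = ideal_gen {monom (u - var_exp i) | u i. u \<in> monomial_gens J \<and> i \<in> keys u}"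
      using Suc.prems unfolding J_def by (auto simp: Let_def)
    moreover have "monomial_gens J = U"
      unfolding J by (rule monomial_gens_supported[OF antichain_equigenerated[OF deg]])
    moreover have "{monom (u - var_exp i) | u i. u \<in> U \<and> i \<in> keys u} =
        (monom ` quotients U :: ('n, 'k) mpoly set)"
      unfolding quotients_def by blast
    ultimately show ?thesis by (simp add: ideal_gen_monom)
  qed
  moreover have "quotients U = (if Suc m \<le> k then gens E (Suc m) (k - Suc m) else gens E (2 * k - Suc m) 0)"
  proof (cases "Suc m \<le> k")
    case True
    then have "U = gens E m (Suc (k - Suc m))" by (simp add: U_def Suc_diff_Suc)
    moreover have "quotients (gens E m (Suc (k - Suc m))) = gens E (Suc m) (k - Suc m)"
      by (rule quotients_gens_edge) (rule sym)
    ultimately show ?thesis using True by simp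
  next
    case False
    then have "U = gens E (Suc (2 * k - Suc m)) 0"
      using pos by (cases "m = k") (simp_all add: U_def Suc_diff_Suc)
    moreover have "quotients (gens E (Suc (2 * k - Suc m)) 0) = gens E (2 * k - Suc m) 0"
      by (rule quotients_gens_vertex[of E i0 j0]) (rule sym, assumption, rule ex)
    ultimately show ?thesis using False by simp
  qed
  ultimately show ?case by (simp add: J_def)
qed

theorem theorem6p1:
  fixes I :: "('n::finite, 'k::field) mpoly set"
    and k l :: nat
  assumes "squarefree_monomial_ideal I"
    and "linear_resolution 2 I"
    and "k \<ge> 1"
    and "l \<le> 2 * k"
    and "CHAR('k) = 0 \<or>
      (\<forall>m<l. let J = (gradient ^^ m) (ideal_power I k) in
        gradient J = ideal_gen {monom (u - var_exp i) | u i. u \<in> monomial_gens J \<and> i \<in> Poly_Mapping.keys u})"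
  shows "linear_quotients ((gradient ^^ l) (ideal_power I k)) \<and>
    has_regularity ((gradient ^^ l) (ideal_power I k)) (2 * int k - int l)"
proof -
  obtain E :: "'n \<Rightarrow> 'n \<Rightarrow> bool" where irrefl: "\<And>i. \<not> E i i" and sym: "\<And>i j. E i j \<Longrightarrow> E j i"
    and ex: "\<exists>i j. E i j" and I: "I = supported (upset (gens E 0 1))"
    and edges: "upset (gens E 0 1) = edge_monomials E UNIV"
    using squarefree_2_linear_graph[OF assms(1,2)] by blast
  have reg: "has_regularity I 2" using assms(2) by (simp add: linear_resolution_def)
  then obtain i0 j0 where "tor_nonzero I i0 j0" unfolding has_regularity_def by blast
  then obtain r d and M :: "nat \<Rightarrow> nat \<Rightarrow> nat \<Rightarrow> ('n, 'k) mpoly" and e where res: "free_resolution r d M e"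
    by (rule resolution_exists)
  (* The regularity hypothesis says that some Tor is nonzero, which provides a resolution. *)
  interpret free_resolution r d M e by (rule res)
  have van: "vanishing (edge_monomials E UNIV) {} i j" if "i + 2 < j" for i j
  proof (rule ccontr)
    assume "\<not> vanishing (edge_monomials E UNIV) {} i j"
    then have "tor_nonzero I i j"
      unfolding I edges tor_nonzero_iff[OF up_closed_edge_monomials] using res by blast
    then have "int j - int i \<le> 2" using reg by (simp add: has_regularity_def)
    then show False using that by simp
  qed
  have simplicial: "\<exists>c\<in>W. \<forall>j\<in>W - {c}. \<forall>k\<in>W - {c}. E j k \<longrightarrow> E c j \<or> E c k"
    if "finite W" "W \<noteq> {}" for W
  proof (rule exists_simplicial_vertex[OF _ _ _ that])
    show "\<not> E v v" for v by (rule irrefl)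
    show "E w v" if "E v w" for v w using that by (rule sym)
    show False if "coconnected E (insert c (insert c' A))" "E c c'" "c \<notin> A" "c' \<notin> A"
      "\<And>a. a \<in> A \<Longrightarrow> E a b" "\<not> E b c" "\<not> E b c'" "b \<noteq> c" "b \<noteq> c'" for A b c c'
      using irrefl sym van that by (rule no_missing_diagonal)
  qed
  have "finite (UNIV :: 'n set)" by simp
  from elimination_ranking[OF simplicial this] obtain \<rho> :: "'n \<Rightarrow> nat" where \<rho>: "inj \<rho>" "\<And>i. \<rho> i > 0"
    "\<And>i j k. E j k \<Longrightarrow> \<rho> i < \<rho> j \<Longrightarrow> \<rho> i < \<rho> k \<Longrightarrow> E i j \<or> E i k" by auto
  obtain a s where as: "(if l \<le> k then gens E l (k - l) else gens E (2 * k - l) 0) = gens E a s"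
    "a + 2 * s = 2 * k - l"
  proof (cases "l \<le> k")
    case True
    then show ?thesis by (intro that[of l "k - l"]) auto
  next
    case False
    then show ?thesis by (intro that[of "2 * k - l" 0]) auto
  qed
  obtain v w where vw: "E v w" using ex by blast
  have grad: "(gradient ^^ l) (ideal_power I k) = supported (upset (gens E a s))"
    unfolding as(1)[symmetric] using sym vw I assms(4,5) order_refl by (rule gradient_gens)
  have "\<exists>us. distinct us \<and> set us = gens E a s \<and>
    (\<forall>m<length us. \<exists>V. {u. u + us ! m \<in> upset (set (take m us))} = upset (var_exp ` V))"
  proof (rule gens_linear_quotients[OF _ _ \<rho>(1)])
    show "E j i" if "E i j" for i j using that by (rule sym)
    show "\<not> E i i" for i by (rule irrefl)
    show "\<rho> i > 0" for i by (rule \<rho>(2))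
    show "E i j \<or> E i k" if "E j k" "\<rho> i < \<rho> j" "\<rho> i < \<rho> k" for i j k
      using that by (rule \<rho>(3))
  qed
  then obtain us where us: "distinct us" "set us = gens E a s"
    "\<And>m. m < length us \<Longrightarrow> \<exists>V. {u. u + us ! m \<in> upset (set (take m us))} = upset (var_exp ` V)"
    by (elim exE conjE) (rule that, auto)
  have deg: "mdeg u = 2 * k - l" if "u \<in> gens E a s" for u using mdeg_gens[OF that] as(2) by simp
  obtain u0 where u0: "u0 \<in> gens E a s" using gens_nonempty[of E v w a s] vw by blast
  have "int (2 * k - l) = 2 * int k - int l" using assms(4) by simp
  then show ?thesis unfolding grad
    using linear_quotients_supported[OF us(1,2) antichain_equigenerated[OF deg] us(3)]
      regularity_of_linear_quotients[OF us(2) deg u0 us(3) res] by simp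
qed

end
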